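(* Let $N\geq2$, let $1\leq p\leq N$, and let $p^*=Np/(N-p)$ if $p<N$ and $p^*=+\infty$ if $p=N$. If $1\leq q<\infty$ and $p<q\leq p^*$, there is a constant $\Sigma_q(N,p)$, depending only on $q$, $N$ and $p$, such that, for every domain $\Omega\subset\mathbb{R}^N$ with $\partial\Omega\neq\emptyset$, \[ \left(\int_\Omega\frac{|u|^q}{\delta^N}\right)^{1/q}\leq\Sigma_q(N,p)\left(\int_\Omega\frac{|\nabla u|^p}{\delta^{N-p}}+\frac{|u|^p}{\delta^N}\right)^{1/p} \] for any $u\in W^{1,p}(\Omega)$.
   Context: A domain is a connected open set. $\delta(x)$ denotes the distance from $x\in\Omega$ to $\partial\Omega$. Functions are real-valued and integrals are with respect to Lebesgue measure. The right-hand side is allowed to be $+\infty$, in which case the inequality is trivially true. *)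

theory Defs
  imports "HOL-Analysis.Analysis"
begin

definition partial_deriv :: "'n::finite \<Rightarrow> (real^'n \<Rightarrow> real) \<Rightarrow> real^'n \<Rightarrow> real" where
  "partial_deriv i f x = frechet_derivative f (at x) (axis i 1)"

primrec Ck :: "nat \<Rightarrow> (real^'n::finite \<Rightarrow> real) \<Rightarrow> bool" where
  "Ck 0 f \<longleftrightarrow> continuous_on UNIV f"
| "Ck (Suc k) f \<longleftrightarrow> (\<forall>x. f differentiable (at x)) \<and> (\<forall>i. Ck k (partial_deriv i f))"

text \<open>The space \<open>C\<^sub>c\<^sup>\<infinity>(\<Omega>)\<close>, its elements being extended by zero to the whole space.\<close>

definition test_fun :: "(real^'n::finite) set \<Rightarrow> (real^'n \<Rightarrow> real) set" where
  "test_fun \<Omega> = {\<phi>. (\<forall>k. Ck k \<phi>) \<and> compact (closure {x. \<phi> x \<noteq> 0}) \<and> closure {x. \<phi> x \<noteq> 0} \<subseteq> \<Omega>}"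

definition locally_integrable_on ::
    "('a::euclidean_space \<Rightarrow> 'b::euclidean_space) \<Rightarrow> 'a set \<Rightarrow> bool" where
  "locally_integrable_on f \<Omega> \<longleftrightarrow> (\<forall>K. compact K \<and> K \<subseteq> \<Omega> \<longrightarrow> f absolutely_integrable_on K)"

text \<open>Elements of Lebesgue and Sobolev spaces are represented by functions rather than by classes
  modulo null sets. The weak gradient is therefore a relation: \<open>G\<close> ranges over all
  representatives, and the values of \<open>u\<close> and \<open>G\<close> outside \<open>\<Omega>\<close> are irrelevant.\<close>

definition has_weak_gradient ::
    "(real^'n::finite) set \<Rightarrow> (real^'n \<Rightarrow> real) \<Rightarrow> (real^'n \<Rightarrow> real^'n) \<Rightarrow> bool" where
  "has_weak_gradient \<Omega> u G \<longleftrightarrow>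
     locally_integrable_on u \<Omega> \<and> locally_integrable_on G \<Omega> \<and>
     (\<forall>\<phi>\<in>test_fun \<Omega>. \<forall>i.
        (LINT x:\<Omega>|lebesgue. u x * partial_deriv i \<phi> x) = - (LINT x:\<Omega>|lebesgue. G x $ i * \<phi> x))"

definition Lp_space ::
    "real \<Rightarrow> 'a::euclidean_space set \<Rightarrow> ('a \<Rightarrow> 'b::euclidean_space) set" where
  "Lp_space p \<Omega> = {f. f \<in> borel_measurable (lebesgue_on \<Omega>) \<and>
                      integrable (lebesgue_on \<Omega>) (\<lambda>x. norm (f x) powr p)}"

definition sobolev_W1 :: "real \<Rightarrow> (real^'n::finite) set \<Rightarrow> (real^'n \<Rightarrow> real) set" where
  "sobolev_W1 p \<Omega> = {u. u \<in> Lp_space p \<Omega> \<and> (\<exists>G. has_weak_gradient \<Omega> u G \<and> G \<in> Lp_space p \<Omega>)}"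

definition sobolev_exponent :: "nat \<Rightarrow> real \<Rightarrow> ereal" where
  "sobolev_exponent N p = (if p < real N then ereal (real N * p / (real N - p)) else \<infinity>)"

definition bdry_dist :: "'a::metric_space set \<Rightarrow> 'a \<Rightarrow> real" where
  "bdry_dist \<Omega> x = infdist x (frontier \<Omega>)"

text \<open>Powers with exponent \<open>a > 0\<close> of extended nonnegative reals.\<close>

definition ennreal_powr :: "ennreal \<Rightarrow> real \<Rightarrow> ennreal" where
  "ennreal_powr t a = (if t = \<infinity> then \<infinity> else ennreal (enn2real t powr a))"

end

theory Submission
  imports Defs
begin

text \<open>Write \<open>N\<close> for the dimension, \<open>\<delta>\<close> for the distance to the boundary and \<open>\<mu>\<close> for the measure \<open>dx / \<delta>\<^sup>N\<close>.
The inequality bounds the \<open>L\<^sup>q\<close> norm of \<open>u\<close> by the \<open>L\<^sup>p\<close> norms of \<open>u\<close> and of \<open>\<delta> |\<nabla>u|\<close>, all taken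
with respect to \<open>\<mu>\<close>. On a cube centred at \<open>x\<close> whose side is a small multiple of \<open>\<delta>(x)\<close>, the
function \<open>\<delta>\<close> is comparable to a constant, so that the inequality there is the scale invariant form of
the ordinary Sobolev inequality (\<open>local_sobolev\<close>).

The local inequalities are assembled by averaging over all centres \<open>x\<close> against \<open>\<mu>\<close>, which
replaces a Whitney decomposition by Fubini's theorem (\<open>weighted_sobolev_borel\<close>). If \<open>H(x)\<close> is the integral of
\<open>|u|\<^sup>p + \<delta>\<^sup>p |\<nabla>u|\<^sup>p\<close> over the cube at \<open>x\<close>, with respect to \<open>\<mu>\<close>, and \<open>a\<close> is the integral
over the whole domain, then the local inequality has the right-hand side \<open>H(x)\<close> to the power \<open>q/p\<close>, which
is at most \<open>H(x)\<close> times \<open>a\<close> to the power \<open>q/p - 1\<close>: this is where \<open>p < q\<close> is used. What remains is linear in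
\<open>H\<close>, and a given point belongs to the cubes of a set of centres whose \<open>\<mu>\<close>-measure is bounded above and below by
constants.

The inequality on a cube starts from \<open>p = 1\<close>. A continuously differentiable function is bounded at \<open>x\<close> by the
integral of \<open>|u| / L + |\<nabla>u|\<close> along each of the \<open>N\<close> segments through \<open>x\<close> that are parallel to the axes, \<open>L\<close> being the
side of the cube, and Gagliardo's iterated Hoelder inequality (\<open>nn_integral_prod_line_integral_le\<close>)
integrates the product of these \<open>N\<close> bounds. Applied to \<open>|u|\<close> to the power \<open>\<gamma> = q (N - 1) / N\<close>, and combined with
Hoelder's inequality for the exponent \<open>s = N q / (N + q)\<close>, it gives the inequality from \<open>L\<^sup>s\<close> to \<open>L\<^sup>q\<close>. The condition
\<open>s \<le> p\<close> says exactly that \<open>q\<close> does not exceed the Sobolev exponent of \<open>p\<close>, and on a cube the passage from \<open>s\<close> to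
\<open>p\<close> is again Hoelder's inequality; the cases \<open>p < N\<close> and \<open>p = N\<close> need no distinction.

For weak gradients, \<open>u\<close> is mollified. The mollified functions are smooth, their gradient is the mollification
of the weak gradient, and by Jensen's inequality their norms on a cube are bounded by those of \<open>u\<close> and its weak
gradient on a cube twice as large. Since they converge to \<open>u\<close> almost everywhere along a subsequence, Fatou's lemma
carries the inequality over to \<open>u\<close>.\<close>

section \<open>Integrals along coordinate lines and Gagliardo's inequality\<close>

text \<open>The integrals along lines that are multiplied below may be infinite, so roots are needed on the
extended half-line.\<close>

definition ennroot :: "nat \<Rightarrow> ennreal \<Rightarrow> ennreal" where
  "ennroot m t = (if t = top then top else ennreal (root m (enn2real t)))"

lemma ennroot_measurable [measurable]: "ennroot m \<in> borel_measurable borel"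
  unfolding ennroot_def by measurable

lemma ennroot_ennreal: "x \<ge> 0 \<Longrightarrow> ennroot m (ennreal x) = ennreal (root m x)"
  by (simp add: ennroot_def)

lemma ennroot_mono:
  assumes "m > 0" "s \<le> t" shows "ennroot m s \<le> ennroot m t"
  using assms by (cases s; cases t) (auto simp: ennroot_def ennreal_leI real_root_le_mono top_unique)

lemma ennroot_eq_0_iff: "m > 0 \<Longrightarrow> ennroot m t = 0 \<longleftrightarrow> t = 0"
  by (cases t) (auto simp: ennroot_def ennreal_eq_0_iff real_root_le_0_iff)

lemma root_eq_powr: "m > 0 \<Longrightarrow> x \<ge> 0 \<Longrightarrow> root m x = x powr (1 / real m)"
  by (cases "x = 0") (auto simp: root_powr_inverse)

text \<open>The inequality of arithmetic and geometric means for the numbers \<open>f k / a k\<close>, cleared of denominators. The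
\<open>a k\<close> will be the integrals of the \<open>f k\<close>, so that the last factor integrates to \<open>1\<close>.\<close>

lemma ennroot_prod_le:
  assumes K: "finite K" "K \<noteq> {}"
    and a: "\<And>k. k \<in> K \<Longrightarrow> 0 < a k"
  shows "(\<Prod>k\<in>K. ennroot (card K) (f k))
     \<le> (\<Prod>k\<in>K. ennroot (card K) (ennreal (a k))) * (\<Sum>k\<in>K. f k * ennreal (1 / (a k * real (card K))))"
proof -
  define m where "m = card K"
  have m: "m > 0" using K by (simp add: m_def card_gt_0_iff)
  show ?thesis
  proof (cases "\<exists>k\<in>K. f k = top")
    case True
    then obtain k where k: "k \<in> K" "f k = top" by auto
    have "f k * ennreal (1 / (a k * real m)) = top"
      using k a[OF k(1)] m by (simp add: ennreal_top_mult)
    then have "(\<Sum>k\<in>K. f k * ennreal (1 / (a k * real m))) = top"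
      by (simp add: sum.remove[OF K(1) k(1)])
    moreover have "(\<Prod>k\<in>K. ennroot m (ennreal (a k))) \<noteq> 0"
      using a m by (fastforce simp: prod_zero_iff[OF K(1)] ennroot_eq_0_iff ennreal_eq_0_iff)
    ultimately have "(\<Prod>k\<in>K. ennroot m (ennreal (a k))) * (\<Sum>k\<in>K. f k * ennreal (1 / (a k * real m))) = top"
      by (metis ennreal_mult_top)
    then show ?thesis unfolding m_def[symmetric] by (simp only: top_greatest)
  next
    case False
    define g where "g k = enn2real (f k)" for k
    have g: "f k = ennreal (g k)" if "k \<in> K" for k
      using False that by (simp add: g_def ennreal_enn2real_if)
    have g0: "g k \<ge> 0" for k by (simp add: g_def)
    have "(\<Prod>k\<in>K. g k / a k) powr (1 / m) \<le> (\<Sum>k\<in>K. (g k / a k) / m)"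
      unfolding m_def by (rule arith_geom_mean) (use K g0 a in \<open>auto intro!: divide_nonneg_pos\<close>)
    moreover have "(\<Prod>k\<in>K. g k / a k) powr (1 / m) = root m (\<Prod>k\<in>K. g k / a k)"
      using m g0 a by (intro root_eq_powr[symmetric] prod_nonneg divide_nonneg_pos) auto
    moreover have "root m (\<Prod>k\<in>K. g k / a k) = (\<Prod>k\<in>K. root m (g k)) / (\<Prod>k\<in>K. root m (a k))"
      using K(1) m by (induction K) (auto simp: real_root_mult real_root_divide)
    ultimately have *: "(\<Prod>k\<in>K. root m (g k)) \<le> (\<Prod>k\<in>K. root m (a k)) * (\<Sum>k\<in>K. g k * (1 / (a k * m)))"
      using a m by (simp add: divide_le_eq prod_pos mult.commute)
    have "(\<Prod>k\<in>K. ennroot m (f k)) = ennreal (\<Prod>k\<in>K. root m (g k))"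
      using g0 m by (simp add: g ennroot_ennreal prod_ennreal)
    also have "\<dots> \<le> ennreal ((\<Prod>k\<in>K. root m (a k)) * (\<Sum>k\<in>K. g k * (1 / (a k * m))))"
      using * by (rule ennreal_leI)
    also have "\<dots> = ennreal (\<Prod>k\<in>K. root m (a k)) * ennreal (\<Sum>k\<in>K. g k * (1 / (a k * m)))"
      using m a g0 by (intro ennreal_mult prod_nonneg sum_nonneg) (auto intro!: divide_nonneg_pos simp: less_imp_le)
    also have "ennreal (\<Prod>k\<in>K. root m (a k)) = (\<Prod>k\<in>K. ennroot m (ennreal (a k)))"
      using m a by (subst prod_ennreal[symmetric]) (auto simp: ennroot_ennreal less_imp_le)
    also have "ennreal (\<Sum>k\<in>K. g k * (1 / (a k * m))) = (\<Sum>k\<in>K. f k * ennreal (1 / (a k * m)))"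
    proof -
      have "0 \<le> 1 / (a k * m)" if "k \<in> K" for k
        using a[OF that] m by simp
      then show ?thesis
        using g0 by (subst sum_ennreal[symmetric]) (auto simp: g ennreal_mult[symmetric] intro!: sum.cong)
    qed
    finally show ?thesis by (simp add: m_def)
  qed
qed

text \<open>Hoelder's inequality for several factors with equal exponents: the preceding inequality with the integrals as
\<open>a k\<close> is integrated. A vanishing or infinite integral is treated apart.\<close>

lemma nn_integral_prod_root_le:
  assumes K: "finite K" "K \<noteq> {}"
    and f [measurable]: "\<And>k. k \<in> K \<Longrightarrow> f k \<in> borel_measurable M"
  shows "(\<integral>\<^sup>+x. (\<Prod>k\<in>K. ennroot (card K) (f k x)) \<partial>M) \<le> (\<Prod>k\<in>K. ennroot (card K) (\<integral>\<^sup>+x. f k x \<partial>M))"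
proof -
  define m where "m = card K"
  have m: "m > 0" using K by (simp add: m_def card_gt_0_iff)
  consider (zero) k where "k \<in> K" "(\<integral>\<^sup>+x. f k x \<partial>M) = 0"
    | (inf) k where "k \<in> K" "(\<integral>\<^sup>+x. f k x \<partial>M) = top" "\<And>k. k \<in> K \<Longrightarrow> (\<integral>\<^sup>+x. f k x \<partial>M) \<noteq> 0"
    | (fin) "\<And>k. k \<in> K \<Longrightarrow> (\<integral>\<^sup>+x. f k x \<partial>M) \<noteq> 0" "\<And>k. k \<in> K \<Longrightarrow> (\<integral>\<^sup>+x. f k x \<partial>M) \<noteq> top"
    by blast
  then show ?thesis
  proof cases
    case zero
    then have "AE x in M. f k x = 0"
      by (simp add: nn_integral_0_iff_AE)
    then have "AE x in M. (\<Prod>k\<in>K. ennroot m (f k x)) = 0"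
    proof eventually_elim
      case (elim x)
      then show ?case using zero(1) K(1) m by (auto intro!: prod_zero bexI[of _ k] simp: ennroot_eq_0_iff)
    qed
    then have "(\<integral>\<^sup>+x. (\<Prod>k\<in>K. ennroot m (f k x)) \<partial>M) = (\<integral>\<^sup>+x. 0 \<partial>M)"
      by (rule nn_integral_cong_AE)
    then show ?thesis by (simp add: m_def)
  next
    case inf
    have "ennroot m (\<integral>\<^sup>+x. f k x \<partial>M) = top" using inf by (simp add: ennroot_def)
    moreover have "(\<Prod>k\<in>K - {k}. ennroot m (\<integral>\<^sup>+x. f k x \<partial>M)) \<noteq> 0"
      using inf m K by (auto simp: prod_zero_iff ennroot_eq_0_iff)
    ultimately have "(\<Prod>k\<in>K. ennroot m (\<integral>\<^sup>+x. f k x \<partial>M)) = top"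
      by (subst prod.remove[OF K(1) inf(1)]) (simp add: ennreal_top_mult)
    then show ?thesis by (simp add: m_def)
  next
    case fin
    define a where "a k = enn2real (\<integral>\<^sup>+x. f k x \<partial>M)" for k
    have a: "(\<integral>\<^sup>+x. f k x \<partial>M) = ennreal (a k)" if "k \<in> K" for k
      using fin(2)[OF that] by (simp add: a_def ennreal_enn2real_if)
    have a0: "a k > 0" if "k \<in> K" for k
      using fin[OF that] a[OF that] by (metis a_def enn2real_positive_iff ennreal_enn2real_if ennreal_less_top less_top not_gr_zero)
    let ?P = "\<Prod>k\<in>K. ennroot m (ennreal (a k))"
    have "(\<integral>\<^sup>+x. (\<Prod>k\<in>K. ennroot m (f k x)) \<partial>M)
        \<le> (\<integral>\<^sup>+x. ?P * (\<Sum>k\<in>K. f k x * ennreal (1 / (a k * real m))) \<partial>M)"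
      unfolding m_def by (intro nn_integral_mono ennroot_prod_le K a0)
    also have "\<dots> = ?P * (\<Sum>k\<in>K. (\<integral>\<^sup>+x. f k x \<partial>M) * ennreal (1 / (a k * real m)))"
      by (simp add: nn_integral_cmult nn_integral_sum nn_integral_multc)
    also have "(\<Sum>k\<in>K. (\<integral>\<^sup>+x. f k x \<partial>M) * ennreal (1 / (a k * real m))) = (\<Sum>k\<in>K. ennreal (1 / m))"
    proof (intro sum.cong refl)
      fix k assume k: "k \<in> K"
      show "(\<integral>\<^sup>+x. f k x \<partial>M) * ennreal (1 / (a k * real m)) = ennreal (1 / m)"
        using a0[OF k] m by (simp add: a[OF k] ennreal_mult[symmetric])
    qed
    also have "(\<Sum>k\<in>K. ennreal (1 / m)) = 1"
      using m by (subst sum_ennreal) (auto simp: m_def)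
    finally show ?thesis by (simp add: a m_def cong: prod.cong)
  qed
qed

text \<open>The integration variable is the displacement from \<open>x\<close>, not the coordinate: this makes
sense without splitting the space into a product, and invariance under moves along the line becomes
translation invariance of Lebesgue measure on the real line.\<close>

definition line_integral :: "'a::euclidean_space \<Rightarrow> ('a \<Rightarrow> ennreal) \<Rightarrow> 'a \<Rightarrow> ennreal" where
  "line_integral b F x = (\<integral>\<^sup>+t. F (x + t *\<^sub>R b) \<partial>lborel)"

lemma line_integral_measurable [measurable]:
  assumes [measurable]: "F \<in> borel_measurable borel"
  shows "line_integral b F \<in> borel_measurable borel"
  unfolding line_integral_def by measurable

lemma line_integral_shift:
  assumes [measurable]: "F \<in> borel_measurable borel"
  shows "line_integral b F (x + s *\<^sub>R b) = line_integral b F x"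
proof -
  have "line_integral b F x = (\<integral>\<^sup>+t. F (x + t *\<^sub>R b) \<partial>distr lborel borel ((+) s))"
    by (simp add: line_integral_def lborel_distr_plus)
  also have "\<dots> = line_integral b F (x + s *\<^sub>R b)"
    by (subst nn_integral_distr) (auto simp: line_integral_def algebra_simps)
  finally show ?thesis ..
qed

lemma line_integral_commute:
  assumes [measurable]: "F \<in> borel_measurable borel"
  shows "line_integral b (line_integral c F) = line_integral c (line_integral b F)"
proof
  fix x
  have "line_integral b (line_integral c F) x
      = (\<integral>\<^sup>+t. (\<integral>\<^sup>+s. F (x + t *\<^sub>R b + s *\<^sub>R c) \<partial>lborel) \<partial>lborel)"
    by (simp add: line_integral_def)
  also have "\<dots> = (\<integral>\<^sup>+s. (\<integral>\<^sup>+t. F (x + t *\<^sub>R b + s *\<^sub>R c) \<partial>lborel) \<partial>lborel)"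
    by (rule lborel_pair.Fubini') measurable
  finally show "line_integral b (line_integral c F) x = line_integral c (line_integral b F) x"
    by (simp add: line_integral_def algebra_simps)
qed

text \<open>For distinct basis vectors this is the integral over the affine coordinate plane through \<open>x\<close> that they span.
Iterating over a list allows the induction of Gagliardo's inequality over the directions.\<close>

primrec plane_integral :: "'a::euclidean_space list \<Rightarrow> ('a \<Rightarrow> ennreal) \<Rightarrow> 'a \<Rightarrow> ennreal" where
  "plane_integral [] F = F"
| "plane_integral (b # bs) F = line_integral b (plane_integral bs F)"

lemma plane_integral_measurable [measurable]:
  "F \<in> borel_measurable borel \<Longrightarrow> plane_integral bs F \<in> borel_measurable borel"
  by (induction bs) auto

lemma plane_integral_eq_PiM:
  fixes F :: "'a::euclidean_space \<Rightarrow> ennreal"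
  assumes F [measurable]: "F \<in> borel_measurable borel" and "distinct bs"
  shows "plane_integral bs F x = (\<integral>\<^sup>+f. F (x + (\<Sum>b\<in>set bs. f b *\<^sub>R b)) \<partial>(\<Pi>\<^sub>M b\<in>set bs. lborel))"
  using assms(2)
proof (induction bs arbitrary: x)
  case Nil
  interpret product_sigma_finite "\<lambda>_::'a. lborel :: real measure" by standard
  show ?case by (simp add: PiM_empty nn_integral_count_space_finite)
next
  case (Cons b bs)
  interpret product_sigma_finite "\<lambda>_::'a. lborel :: real measure" by standard
  have meas: "(\<lambda>f. F (x + (\<Sum>c\<in>set (b # bs). f c *\<^sub>R c))) \<in> borel_measurable (\<Pi>\<^sub>M c\<in>set (b # bs). lborel)" for x
    by measurable
  have "(\<integral>\<^sup>+f. F (x + (\<Sum>c\<in>set (b # bs). f c *\<^sub>R c)) \<partial>(\<Pi>\<^sub>M c\<in>set (b # bs). lborel))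
      = (\<integral>\<^sup>+t. (\<integral>\<^sup>+f. F (x + (\<Sum>c\<in>set (b # bs). (f(b := t)) c *\<^sub>R c)) \<partial>(\<Pi>\<^sub>M c\<in>set bs. lborel)) \<partial>lborel)"
    using meas[of x] Cons.prems unfolding list.set(2)
    by (subst product_nn_integral_insert_rev) auto
  also have "\<dots> = (\<integral>\<^sup>+t. (\<integral>\<^sup>+f. F (x + t *\<^sub>R b + (\<Sum>c\<in>set bs. f c *\<^sub>R c)) \<partial>(\<Pi>\<^sub>M c\<in>set bs. lborel)) \<partial>lborel)"
  proof -
    have "(\<Sum>c\<in>set (b # bs). (f(b := t)) c *\<^sub>R c) = t *\<^sub>R b + (\<Sum>c\<in>set bs. f c *\<^sub>R c)" for f t
      using Cons.prems by (auto intro!: sum.cong)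
    then show ?thesis by (simp add: add.assoc)
  qed
  finally show ?case
    using Cons by (simp add: line_integral_def)
qed

lemma plane_integral_Basis:
  fixes F :: "'a::euclidean_space \<Rightarrow> ennreal"
  assumes [measurable]: "F \<in> borel_measurable borel" and "distinct bs" "set bs = Basis"
  shows "plane_integral bs F x = (\<integral>\<^sup>+y. F y \<partial>lborel)"
proof -
  have "plane_integral bs F x = plane_integral bs (\<lambda>y. F (x + y)) 0"
    using assms by (simp add: plane_integral_eq_PiM)
  also have "\<dots> = (\<integral>\<^sup>+y. F (x + y) \<partial>distr (\<Pi>\<^sub>M b\<in>Basis. lborel) borel (\<lambda>f. \<Sum>b\<in>Basis. f b *\<^sub>R b))"
    using assms(2,3) by (subst plane_integral_eq_PiM) (auto simp: nn_integral_distr)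
  also have "\<dots> = (\<integral>\<^sup>+y. F (x + y) \<partial>lborel)" by (simp flip: lborel_eq)
  also have "\<dots> = (\<integral>\<^sup>+y. F y \<partial>distr lborel borel ((+) x))"
    by (simp add: nn_integral_distr)
  finally show ?thesis by (simp add: lborel_distr_plus)
qed

text \<open>One direction \<open>c\<close> is integrated at a time. Of the \<open>N\<close> factors the one that already contains the
integration along \<open>c\<close> is constant on lines parallel to \<open>c\<close>; the other \<open>N - 1\<close> factors are
handled by Hoelder's inequality with exponent \<open>N - 1\<close>. The separated factor remains the same function, but with \<open>c\<close>
joining the list it passes from the second case of the conditional to the first.\<close>

lemma plane_integral_prod_root_le:
  fixes w :: "'a::euclidean_space \<Rightarrow> ennreal"
  assumes w [measurable]: "w \<in> borel_measurable borel" and "DIM('a) \<ge> 2"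
    and "distinct bs" "set bs \<subseteq> Basis"
  shows "plane_integral bs (\<lambda>x. \<Prod>b\<in>Basis. ennroot (DIM('a) - 1) (line_integral b w x)) x
    \<le> (\<Prod>b\<in>Basis. ennroot (DIM('a) - 1)
          ((if b \<in> set bs then plane_integral bs w else line_integral b (plane_integral bs w)) x))"
  using assms(3,4)
proof (induction bs arbitrary: x)
  case Nil
  then show ?case by simp
next
  case (Cons c bs)
  define m where "m = DIM('a) - 1"
  let ?W = "\<lambda>b. if b \<in> set bs then plane_integral bs w else line_integral b (plane_integral bs w)"
  \<comment> \<open>The factor of \<open>c\<close> is separated from the \<open>N - 1\<close> factors in \<open>K\<close>.\<close>
  have c: "c \<in> Basis" "c \<notin> set bs" using Cons.prems by auto
  define K where "K = Basis - {c}"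
  have K: "finite K" "K \<noteq> {}" "card K = m"
    using c assms(2) by (auto simp: K_def m_def card_Diff_singleton dest!: card_mono[rotated])
  have [measurable]: "?W b \<in> borel_measurable borel" for b by auto
  have "plane_integral (c # bs) (\<lambda>x. \<Prod>b\<in>Basis. ennroot m (line_integral b w x)) x
      \<le> (\<integral>\<^sup>+t. (\<Prod>b\<in>Basis. ennroot m (?W b (x + t *\<^sub>R c))) \<partial>lborel)"
    unfolding plane_integral.simps line_integral_def[of c] m_def
    by (intro nn_integral_mono Cons.IH) (use Cons.prems in auto)
  also have "\<dots> = (\<integral>\<^sup>+t. ennroot m (?W c (x + t *\<^sub>R c)) * (\<Prod>b\<in>K. ennroot m (?W b (x + t *\<^sub>R c))) \<partial>lborel)"
    by (simp only: K_def prod.remove[OF finite_Basis c(1)])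
  also have "\<dots> = (\<integral>\<^sup>+t. ennroot m (?W c x) * (\<Prod>b\<in>K. ennroot m (?W b (x + t *\<^sub>R c))) \<partial>lborel)"
    using c by (simp add: line_integral_shift)
  also have "\<dots> = ennroot m (?W c x) * (\<integral>\<^sup>+t. (\<Prod>b\<in>K. ennroot m (?W b (x + t *\<^sub>R c))) \<partial>lborel)"
    by (rule nn_integral_cmult) measurable
  also have "\<dots> \<le> ennroot m (?W c x) * (\<Prod>b\<in>K. ennroot m (\<integral>\<^sup>+t. ?W b (x + t *\<^sub>R c) \<partial>lborel))"
    using nn_integral_prod_root_le[OF K(1,2), of "\<lambda>b t. ?W b (x + t *\<^sub>R c)" lborel] unfolding K(3)
    by (intro mult_left_mono) auto
  also have "\<dots> = (\<Prod>b\<in>Basis. ennroot m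
      ((if b \<in> set (c # bs) then plane_integral (c # bs) w else line_integral b (plane_integral (c # bs) w)) x))"
  proof -
    have "(\<integral>\<^sup>+t. ?W b (x + t *\<^sub>R c) \<partial>lborel)
       = (if b \<in> set (c # bs) then plane_integral (c # bs) w else line_integral b (plane_integral (c # bs) w)) x"
      if "b \<in> K" for b
      using that by (auto simp: K_def line_integral_def[of c, symmetric] line_integral_commute[of _ c])
    then show ?thesis
      unfolding prod.remove[OF finite_Basis c(1)] K_def[symmetric] using c by simp
  qed
  finally show ?case by (simp add: m_def)
qed

text \<open>Gagliardo's inequality, in the form of the Loomis-Whitney inequality in which all functions of
\<open>N - 1\<close> variables arise from the same function \<open>w\<close> by integrating out one coordinate.\<close>

lemma nn_integral_prod_line_integral_le:
  fixes w :: "'a::euclidean_space \<Rightarrow> ennreal"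
  assumes w [measurable]: "w \<in> borel_measurable borel" and "DIM('a) \<ge> 2"
  shows "(\<integral>\<^sup>+x. (\<Prod>b\<in>Basis. ennroot (DIM('a) - 1) (line_integral b w x)) \<partial>lborel)
    \<le> ennroot (DIM('a) - 1) (\<integral>\<^sup>+x. w x \<partial>lborel) ^ DIM('a)"
proof -
  obtain bs where bs: "distinct bs" "set bs = (Basis :: 'a set)"
    using finite_distinct_list[OF finite_Basis] by blast
  have "(\<integral>\<^sup>+x. (\<Prod>b\<in>Basis. ennroot (DIM('a) - 1) (line_integral b w x)) \<partial>lborel)
      = plane_integral bs (\<lambda>x. \<Prod>b\<in>Basis. ennroot (DIM('a) - 1) (line_integral b w x)) 0"
    by (rule plane_integral_Basis[OF _ bs, symmetric]) measurable
  also have "\<dots> \<le> (\<Prod>b\<in>Basis. ennroot (DIM('a) - 1)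
          ((if b \<in> set bs then plane_integral bs w else line_integral b (plane_integral bs w)) 0))"
    by (rule plane_integral_prod_root_le) (use assms bs in auto)
  also have "\<dots> = ennroot (DIM('a) - 1) (\<integral>\<^sup>+x. w x \<partial>lborel) ^ DIM('a)"
    using bs by (simp add: plane_integral_Basis[OF w bs])
  finally show ?thesis .
qed

section \<open>The Sobolev inequality on cubes for exponent one\<close>

text \<open>By the fundamental theorem of calculus \<open>|\<phi>(s)|\<close> exceeds \<open>|\<phi>(t)|\<close> by at most the integral of \<open>|\<phi>'|\<close>; the mean over
\<open>t\<close> is taken. The term with \<open>|\<phi>|\<close> plays the part of a boundary condition.\<close>

lemma abs_le_nn_integral_Icc:
  fixes \<phi> \<phi>' :: "real \<Rightarrow> real"
  assumes "a < b" and s: "s \<in> {a..b}"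
    and D: "\<And>t. t \<in> {a..b} \<Longrightarrow> (\<phi> has_real_derivative \<phi>' t) (at t within {a..b})"
    and C: "continuous_on {a..b} \<phi>'"
  shows "ennreal \<bar>\<phi> s\<bar> \<le> (\<integral>\<^sup>+t. ennreal (indicator {a..b} t * (\<bar>\<phi> t\<bar> / (b - a) + \<bar>\<phi>' t\<bar>)) \<partial>lborel)"
proof -
  define I where "I = integral {a..b} (\<lambda>t. \<bar>\<phi>' t\<bar>)"
  have C\<phi>: "continuous_on {a..b} \<phi>"
    by (rule DERIV_continuous_on[OF D])
  have int: "(\<lambda>t. \<bar>\<phi>' t\<bar>) integrable_on {c..d}" if "{c..d} \<subseteq> {a..b}" for c d
    using that by (intro integrable_continuous_interval continuous_intros continuous_on_subset[OF C])
  have diff: "\<bar>\<phi> d - \<phi> c\<bar> \<le> I" if "a \<le> c" "c \<le> d" "d \<le> b" for c d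
  proof -
    have "(\<phi>' has_integral (\<phi> d - \<phi> c)) {c..d}"
    proof (rule fundamental_theorem_of_calculus)
      fix t assume "t \<in> {c..d}"
      then have "(\<phi> has_real_derivative \<phi>' t) (at t within {c..d})"
        using that by (intro DERIV_subset[OF D]) auto
      then show "(\<phi> has_vector_derivative \<phi>' t) (at t within {c..d})"
        by (simp add: has_real_derivative_iff_has_vector_derivative)
    qed (use that in auto)
    then have "\<bar>\<phi> d - \<phi> c\<bar> = norm (integral {c..d} \<phi>')" by (simp add: integral_unique)
    also have "\<dots> \<le> integral {c..d} (\<lambda>t. \<bar>\<phi>' t\<bar>)"
      using that by (intro integral_norm_bound_integral integrable_continuous_interval continuous_on_subset[OF C] int) auto
    also have "\<dots> \<le> I" unfolding I_def
      using that by (intro integral_subset_le int) auto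
    finally show ?thesis .
  qed
  have pt: "\<bar>\<phi> s\<bar> \<le> \<bar>\<phi> t\<bar> + I" if "t \<in> {a..b}" for t
    using diff[of s t] diff[of t s] s that by (cases "s \<le> t") auto
  let ?f = "\<lambda>t. \<bar>\<phi> t\<bar> / (b - a) + \<bar>\<phi>' t\<bar>"
  have Cf: "continuous_on {a..b} ?f" using assms(1) by (intro continuous_intros C C\<phi>) auto
  have "\<bar>\<phi> s\<bar> = integral {a..b} (\<lambda>t. \<bar>\<phi> s\<bar> / (b - a))"
    using assms(1) by simp
  also have "\<dots> \<le> integral {a..b} (\<lambda>t. (\<bar>\<phi> t\<bar> + I) / (b - a))"
    using assms(1) pt
    by (intro integral_le integrable_continuous_interval continuous_intros C\<phi> divide_right_mono) auto
  also have "\<dots> = integral {a..b} (\<lambda>t. \<bar>\<phi> t\<bar> / (b - a)) + I"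
    using assms(1) unfolding add_divide_distrib
    by (subst integral_add) (auto intro!: integrable_continuous_interval continuous_intros C\<phi>)
  also have "\<dots> = integral {a..b} ?f"
    unfolding I_def using assms(1)
    by (subst integral_add) (auto intro!: integrable_continuous_interval continuous_intros C\<phi> C)
  also have "\<dots> = (LINT t:{a..b}|lborel. ?f t)"
    by (rule set_borel_integral_eq_integral(2)[symmetric]) (rule borel_integrable_atLeastAtMost'[OF Cf])
  finally have "\<bar>\<phi> s\<bar> \<le> (LINT t|lborel. indicator {a..b} t * ?f t)"
    by (simp add: set_lebesgue_integral_def)
  moreover have "integrable lborel (\<lambda>t. indicator {a..b} t * ?f t)"
    using borel_integrable_atLeastAtMost'[OF Cf] by (simp add: set_integrable_def)
  ultimately show ?thesis
    using assms(1) by (subst nn_integral_eq_integral) (auto intro!: ennreal_leI)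
qed

lemma abs_le_line_integral_cube:
  fixes v :: "'a::euclidean_space \<Rightarrow> real" and g :: "'a \<Rightarrow> 'a"
  assumes "L > 0" and side: "\<And>b. b \<in> Basis \<Longrightarrow> (u - l) \<bullet> b = L"
    and D: "\<And>x. x \<in> cbox l u \<Longrightarrow> (v has_derivative (\<lambda>h. g x \<bullet> h)) (at x within cbox l u)"
    and C: "continuous_on (cbox l u) g"
    and b: "b \<in> Basis" and x: "x \<in> cbox l u"
  shows "ennreal \<bar>v x\<bar> \<le> line_integral b (\<lambda>y. ennreal (indicator (cbox l u) y * (\<bar>v y\<bar> / L + norm (g y)))) x"
proof -
  define \<alpha> \<beta> where "\<alpha> = l \<bullet> b - x \<bullet> b" and "\<beta> = u \<bullet> b - x \<bullet> b"
  have ab: "\<alpha> < \<beta>" "\<beta> - \<alpha> = L" "0 \<in> {\<alpha>..\<beta>}"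
    using side[OF b] \<open>L > 0\<close> x b by (auto simp: \<alpha>_def \<beta>_def inner_diff_left mem_box)
  have mem: "x + t *\<^sub>R b \<in> cbox l u \<longleftrightarrow> t \<in> {\<alpha>..\<beta>}" for t
  proof -
    have "(x + t *\<^sub>R b) \<bullet> c = (if c = b then x \<bullet> b + t else x \<bullet> c)" if "c \<in> Basis" for c
      using b that by (auto simp: inner_add_left inner_Basis)
    then show ?thesis
      using x b by (auto simp: mem_box \<alpha>_def \<beta>_def algebra_simps)
  qed
  have "ennreal \<bar>v (x + 0 *\<^sub>R b)\<bar> \<le> (\<integral>\<^sup>+t. ennreal (indicator {\<alpha>..\<beta>} t *
      (\<bar>v (x + t *\<^sub>R b)\<bar> / (\<beta> - \<alpha>) + \<bar>g (x + t *\<^sub>R b) \<bullet> b\<bar>)) \<partial>lborel)"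
  proof (rule abs_le_nn_integral_Icc[OF ab(1,3), where \<phi> = "\<lambda>t. v (x + t *\<^sub>R b)" and \<phi>' = "\<lambda>t. g (x + t *\<^sub>R b) \<bullet> b"])
    show "continuous_on {\<alpha>..\<beta>} (\<lambda>t. g (x + t *\<^sub>R b) \<bullet> b)"
    proof -
      have "continuous_on {\<alpha>..\<beta>} (\<lambda>t. x + t *\<^sub>R b)" by (intro continuous_intros)
      then have "continuous_on {\<alpha>..\<beta>} (\<lambda>t. g (x + t *\<^sub>R b))"
        by (rule continuous_on_compose2[OF C]) (rule image_subsetI, simp only: mem)
      then show ?thesis by (intro continuous_intros)
    qed
    fix t assume t: "t \<in> {\<alpha>..\<beta>}"
    have "((\<lambda>t. v (x + t *\<^sub>R b)) has_derivative (\<lambda>h. g (x + t *\<^sub>R b) \<bullet> (h *\<^sub>R b))) (at t within {\<alpha>..\<beta>})"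
    proof (rule has_derivative_in_compose2[where t = "cbox l u" and g' = "\<lambda>x h. g x \<bullet> h", OF D])
      show "(\<lambda>t. x + t *\<^sub>R b) ` {\<alpha>..\<beta>} \<subseteq> cbox l u"
        by (rule image_subsetI) (simp only: mem)
      show "((\<lambda>t. x + t *\<^sub>R b) has_derivative (\<lambda>h. h *\<^sub>R b)) (at t within {\<alpha>..\<beta>})"
        by (auto intro!: derivative_eq_intros)
    qed (use t in auto)
    then show "((\<lambda>t. v (x + t *\<^sub>R b)) has_real_derivative g (x + t *\<^sub>R b) \<bullet> b) (at t within {\<alpha>..\<beta>})"
      by (rule has_derivative_imp_has_field_derivative) (simp add: mult.commute)
  qed
  also have "\<dots> \<le> (\<integral>\<^sup>+t. ennreal (indicator (cbox l u) (x + t *\<^sub>R b) *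
      (\<bar>v (x + t *\<^sub>R b)\<bar> / L + norm (g (x + t *\<^sub>R b)))) \<partial>lborel)"
  proof (intro nn_integral_mono ennreal_leI)
    fix t
    have "(indicator {\<alpha>..\<beta>} t :: real) = indicator (cbox l u) (x + t *\<^sub>R b)"
      by (simp only: indicator_def mem)
    then show "indicator {\<alpha>..\<beta>} t * (\<bar>v (x + t *\<^sub>R b)\<bar> / (\<beta> - \<alpha>) + \<bar>g (x + t *\<^sub>R b) \<bullet> b\<bar>)
      \<le> indicator (cbox l u) (x + t *\<^sub>R b) * (\<bar>v (x + t *\<^sub>R b)\<bar> / L + norm (g (x + t *\<^sub>R b)))"
      using b by (simp add: ab(2) Basis_le_norm mult_left_mono)
  qed
  finally show ?thesis by (simp add: line_integral_def)
qed

text \<open>The bound along lines holds in all \<open>N\<close> directions, so \<open>|v|\<close> to the power \<open>N / (N - 1)\<close> is at most the product of the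
\<open>N\<close> line integrals to the power \<open>1 / (N - 1)\<close>, to which Gagliardo's inequality applies.\<close>

lemma cube_sobolev_exponent_one:
  fixes v :: "'a::euclidean_space \<Rightarrow> real" and g :: "'a \<Rightarrow> 'a"
  assumes "L > 0" and side: "\<And>b. b \<in> Basis \<Longrightarrow> (u - l) \<bullet> b = L"
    and D: "\<And>x. x \<in> cbox l u \<Longrightarrow> (v has_derivative (\<lambda>h. g x \<bullet> h)) (at x within cbox l u)"
    and C: "continuous_on (cbox l u) g"
    and dim: "DIM('a) \<ge> 2" and "W \<ge> 0"
    and W: "(\<integral>\<^sup>+x. ennreal (indicator (cbox l u) x * (\<bar>v x\<bar> / L + norm (g x))) \<partial>lborel) \<le> ennreal W"
  shows "(\<integral>\<^sup>+x. ennreal (indicator (cbox l u) x * \<bar>v x\<bar> powr (real DIM('a) / (real DIM('a) - 1))) \<partial>lborel)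
    \<le> ennreal (W powr (real DIM('a) / (real DIM('a) - 1)))"
proof -
  define m where "m = DIM('a) - 1"
  have m: "m > 0" "real DIM('a) - 1 = real m" using dim by (auto simp: m_def)
  let ?Q = "cbox l u"
  let ?w = "\<lambda>y. ennreal (indicator ?Q y * (\<bar>v y\<bar> / L + norm (g y)))"
  \<comment> \<open>Each of the \<open>N\<close> factors contributes \<open>|v|\<close> to the power \<open>1 / (N - 1)\<close>.\<close>
  have root: "root m y ^ DIM('a) = y powr (real DIM('a) / real m)" if "y \<ge> 0" for y
  proof (cases "y = 0")
    case False
    then have "root m y ^ DIM('a) = (y powr (1 / real m)) powr real DIM('a)"
      using m that by (subst powr_realpow) (auto simp: root_powr_inverse)
    then show ?thesis by (simp add: powr_powr)
  qed (use m in auto)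
  have ennroot_pow: "ennroot m (ennreal y) ^ DIM('a) = ennreal (y powr (real DIM('a) / real m))" if "y \<ge> 0" for y
    by (subst ennroot_ennreal[OF that], subst ennreal_power) (simp_all only: root[OF that] real_root_ge_zero[OF that])
  have "continuous_on ?Q v"
    using D by (intro has_derivative_continuous_on) auto
  then have "continuous_on ?Q (\<lambda>y. \<bar>v y\<bar> / L + norm (g y))"
    using \<open>L > 0\<close> by (intro continuous_intros C) auto
  then have "(\<lambda>y. indicator ?Q y *\<^sub>R (\<bar>v y\<bar> / L + norm (g y))) \<in> borel_measurable borel"
    by (intro borel_measurable_continuous_on_indicator) auto
  then have w [measurable]: "?w \<in> borel_measurable borel" by simp
  have "(\<integral>\<^sup>+x. ennreal (indicator ?Q x * \<bar>v x\<bar> powr (real DIM('a) / real m)) \<partial>lborel)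
     \<le> (\<integral>\<^sup>+x. (\<Prod>b\<in>Basis. ennroot m (line_integral b ?w x)) \<partial>lborel)"
  proof (rule nn_integral_mono)
    fix x
    show "ennreal (indicator ?Q x * \<bar>v x\<bar> powr (real DIM('a) / real m)) \<le> (\<Prod>b\<in>Basis. ennroot m (line_integral b ?w x))"
    proof (cases "x \<in> ?Q")
      case True
      have "ennreal (\<bar>v x\<bar> powr (real DIM('a) / real m)) = (\<Prod>b\<in>(Basis::'a set). ennroot m (ennreal \<bar>v x\<bar>))"
        by (simp only: prod_constant ennroot_pow[OF abs_ge_zero])
      also have "\<dots> \<le> (\<Prod>b\<in>Basis. ennroot m (line_integral b ?w x))"
        using abs_le_line_integral_cube[OF assms(1-4) _ True] m
        by (intro prod_mono_ennreal ennroot_mono) auto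
      finally show ?thesis using True by simp
    qed simp
  qed
  also have "\<dots> \<le> ennroot m (\<integral>\<^sup>+x. ?w x \<partial>lborel) ^ DIM('a)"
    unfolding m_def by (rule nn_integral_prod_line_integral_le[OF w dim])
  also have "\<dots> \<le> ennroot m (ennreal W) ^ DIM('a)"
    using W m by (intro power_mono_ennreal ennroot_mono) auto
  also have "\<dots> = ennreal (W powr (real DIM('a) / real m))"
    by (simp only: ennroot_pow[OF \<open>W \<ge> 0\<close>])
  finally show ?thesis by (simp add: m)
qed

section \<open>The Sobolev inequality on cubes for continuously differentiable functions\<close>

text \<open>Hoelder's inequality in terms of upper bounds for the two integrals. With a zero bound the corresponding
function vanishes almost everywhere, and then so does the product, because \<open>0 powr t = 0\<close> for every
\<open>t\<close>; this covers the exponent \<open>1 - a = 0\<close>.\<close>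

lemma nn_integral_Hoelder:
  fixes f g :: "'x \<Rightarrow> real"
  assumes [measurable]: "f \<in> borel_measurable M" "g \<in> borel_measurable M"
    and nn: "\<And>x. f x \<ge> 0" "\<And>x. g x \<ge> 0" and a: "0 < a" "a \<le> 1"
    and F: "F \<ge> 0" "(\<integral>\<^sup>+x. ennreal (f x) \<partial>M) \<le> ennreal F"
    and K: "K \<ge> 0" "(\<integral>\<^sup>+x. ennreal (g x) \<partial>M) \<le> ennreal K"
  shows "(\<integral>\<^sup>+x. ennreal (f x powr a * g x powr (1 - a)) \<partial>M) \<le> ennreal (F powr a * K powr (1 - a))"
proof (cases "F = 0 \<or> K = 0")
  case True
  then have "(AE x in M. ennreal (f x) = 0) \<or> (AE x in M. ennreal (g x) = 0)"
    using F(2) K(2) by (auto simp: nn_integral_0_iff_AE)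
  moreover have "ennreal (f x) = 0 \<longleftrightarrow> f x = 0" "ennreal (g x) = 0 \<longleftrightarrow> g x = 0" for x
    using nn by (auto simp: ennreal_eq_0_iff antisym_conv)
  ultimately have "AE x in M. ennreal (f x powr a * g x powr (1 - a)) = 0"
    by (auto elim!: eventually_mono)
  then have "(\<integral>\<^sup>+x. ennreal (f x powr a * g x powr (1 - a)) \<partial>M) = (\<integral>\<^sup>+x. 0 \<partial>M)"
    by (rule nn_integral_cong_AE)
  then show ?thesis by simp
next
  case False
  then have pos: "F > 0" "K > 0" using F K by auto
  \<comment> \<open>Young's inequality is applied to \<open>f / F\<close> and \<open>g / K\<close>, whose integrals are at most \<open>1\<close>.\<close>
  define c where "c = F powr a * K powr (1 - a)"
  have c: "c > 0" using pos by (simp add: c_def)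
  have "(\<integral>\<^sup>+x. ennreal (f x powr a * g x powr (1 - a)) \<partial>M)
     \<le> (\<integral>\<^sup>+x. ennreal (c * a / F) * ennreal (f x) + ennreal (c * (1 - a) / K) * ennreal (g x) \<partial>M)"
  proof (rule nn_integral_mono)
    fix x
    have "f x powr a * g x powr (1 - a) \<le> c * a / F * f x + c * (1 - a) / K * g x"
    proof (cases "f x = 0 \<or> g x = 0")
      case True
      then show ?thesis using nn[of x] pos c a by auto
    next
      case False
      then have "(f x / F) powr a * (g x / K) powr (1 - a) \<le> a * (f x / F) + (1 - a) * (g x / K)"
        using nn[of x] pos a by (intro Youngs_inequality_0) auto
      then have "c * ((f x / F) powr a * (g x / K) powr (1 - a)) \<le> c * (a * (f x / F) + (1 - a) * (g x / K))"
        using c by (intro mult_left_mono) auto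
      also have "c * ((f x / F) powr a * (g x / K) powr (1 - a)) = f x powr a * g x powr (1 - a)"
        using nn[of x] pos by (simp add: c_def powr_divide)
      finally show ?thesis by (simp add: algebra_simps)
    qed
    then have "ennreal (f x powr a * g x powr (1 - a)) \<le> ennreal (c * a / F * f x + c * (1 - a) / K * g x)"
      by (rule ennreal_leI)
    also have "\<dots> = ennreal (c * a / F) * ennreal (f x) + ennreal (c * (1 - a) / K) * ennreal (g x)"
      using nn[of x] pos c a by (simp add: ennreal_mult[symmetric] ennreal_plus[symmetric] del: ennreal_plus)
    finally show "ennreal (f x powr a * g x powr (1 - a))
      \<le> ennreal (c * a / F) * ennreal (f x) + ennreal (c * (1 - a) / K) * ennreal (g x)" .
  qed
  also have "\<dots> = ennreal (c * a / F) * (\<integral>\<^sup>+x. ennreal (f x) \<partial>M) + ennreal (c * (1 - a) / K) * (\<integral>\<^sup>+x. ennreal (g x) \<partial>M)"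
    by (simp add: nn_integral_add nn_integral_cmult)
  also have "\<dots> \<le> ennreal (c * a / F) * ennreal F + ennreal (c * (1 - a) / K) * ennreal K"
    using F K by (intro add_mono mult_left_mono) auto
  also have "\<dots> = ennreal (c * a + c * (1 - a))"
    using pos c a by (simp add: ennreal_mult[symmetric] ennreal_plus[symmetric] del: ennreal_plus)
  also have "c * a + c * (1 - a) = c" by (simp add: algebra_simps)
  finally show ?thesis by (simp add: c_def)
qed

text \<open>The derivative of \<open>|t|\<close> to the power \<open>\<gamma>\<close>, written with positive and negative parts so that its continuity
at \<open>0\<close> is that of a power with positive exponent.\<close>

definition abs_powr_deriv :: "real \<Rightarrow> real \<Rightarrow> real" where
  "abs_powr_deriv \<gamma> t = \<gamma> * (max 0 t powr (\<gamma> - 1) - max 0 (- t) powr (\<gamma> - 1))"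

lemma abs_powr_deriv_abs: "\<gamma> \<ge> 0 \<Longrightarrow> \<bar>abs_powr_deriv \<gamma> t\<bar> = \<gamma> * \<bar>t\<bar> powr (\<gamma> - 1)"
  by (cases "t \<ge> 0") (auto simp: abs_powr_deriv_def abs_mult)

lemma continuous_on_abs_powr_deriv: "\<gamma> > 1 \<Longrightarrow> continuous_on UNIV (abs_powr_deriv \<gamma>)"
  unfolding abs_powr_deriv_def
  by (intro continuous_intros continuous_on_powr') auto

lemma abs_powr_has_derivative:
  fixes \<gamma> t :: real
  assumes "\<gamma> > 1"
  shows "((\<lambda>t. \<bar>t\<bar> powr \<gamma>) has_real_derivative abs_powr_deriv \<gamma> t) (at t)"
proof -
  consider "t > 0" | "t < 0" | "t = 0" by linarith
  then show ?thesis
  proof cases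
    case 1
    then have "((\<lambda>t. t powr \<gamma>) has_real_derivative abs_powr_deriv \<gamma> t) (at t)"
      by (auto intro!: derivative_eq_intros simp: abs_powr_deriv_def)
    then show ?thesis
      by (rule has_field_derivative_transform_within_open[where S = "{0<..}"]) (use 1 in auto)
  next
    case 2
    then have "((\<lambda>t. (-t) powr \<gamma>) has_real_derivative abs_powr_deriv \<gamma> t) (at t)"
      by (auto intro!: derivative_eq_intros simp: abs_powr_deriv_def)
    then show ?thesis
      by (rule has_field_derivative_transform_within_open[where S = "{..<0}"]) (use 2 in auto)
  next
    case 3
    have "((\<lambda>h::real. \<bar>h\<bar> powr (\<gamma> - 1)) \<longlongrightarrow> \<bar>0\<bar> powr (\<gamma> - 1)) (at 0)"
      using assms by (intro tendsto_intros) auto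
    then have "((\<lambda>h::real. \<bar>h\<bar> powr (\<gamma> - 1)) \<longlongrightarrow> 0) (at 0)" by simp
    then have "((\<lambda>h::real. \<bar>h\<bar> powr \<gamma> / h) \<longlongrightarrow> 0) (at 0)"
      by (rule Lim_null_comparison[rotated])
         (auto simp: eventually_at_filter powr_diff abs_mult divide_simps)
    then show ?thesis using 3 assms
      by (simp add: has_field_derivative_iff abs_powr_deriv_def)
  qed
qed

lemma nn_integral_indicator_cube:
  fixes l z :: "'a::euclidean_space"
  assumes "L > 0" and side: "\<And>b. b \<in> Basis \<Longrightarrow> (z - l) \<bullet> b = L"
  shows "(\<integral>\<^sup>+x. ennreal (indicator (cbox l z) x) \<partial>lborel) = ennreal (L powr real DIM('a))"
proof -
  have "l \<bullet> b \<le> z \<bullet> b" if "b \<in> Basis" for b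
    using side[OF that] \<open>L > 0\<close> by (simp add: inner_diff_left)
  then show ?thesis
    using side \<open>L > 0\<close> by (simp add: ennreal_indicator powr_realpow)
qed

lemma powr_add_le:
  fixes a b p :: real
  assumes "a \<ge> 0" "b \<ge> 0" "p \<ge> 0"
  shows "(a + b) powr p \<le> 2 powr p * (a powr p + b powr p)"
proof -
  have "(a + b) powr p \<le> (2 * max a b) powr p"
    using assms by (intro powr_mono2) auto
  also have "\<dots> = 2 powr p * max a b powr p"
    using assms by (simp add: powr_mult)
  also have "\<dots> \<le> 2 powr p * (a powr p + b powr p)"
    by (intro mult_left_mono) (auto simp: max_def)
  finally show ?thesis .
qed

text \<open>The inequality for exponent one is applied to \<open>v = |u| powr \<gamma>\<close>. Its right-hand side is the integral of
\<open>|u| powr (\<gamma> - 1)\<close> times \<open>k = |u| + \<gamma> L |\<nabla>u|\<close>, and Hoelder's inequality bounds it by a power of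
\<open>Y\<close>, the integral of \<open>|u| powr q\<close>, and by the norm of \<open>k\<close> in \<open>L\<^sup>s\<close> with \<open>s = N q / (N + q)\<close>. The power of \<open>Y\<close> is
smaller than the one on the left and can be cancelled, \<open>Y\<close> being finite for a continuous function on a cube.\<close>

lemma cube_sobolev_smooth_aux:
  fixes u :: "'a::euclidean_space \<Rightarrow> real" and g :: "'a \<Rightarrow> 'a"
  defines "N \<equiv> real DIM('a)"
  assumes "L > 0" and side: "\<And>b. b \<in> Basis \<Longrightarrow> (z - l) \<bullet> b = L"
    and D: "\<And>x. x \<in> cbox l z \<Longrightarrow> (u has_derivative (\<lambda>h. g x \<bullet> h)) (at x within cbox l z)"
    and C: "continuous_on (cbox l z) g"
    and dim: "DIM('a) \<ge> 2" and p: "1 \<le> p" and q: "N / (N - 1) \<le> q" "q * (N - p) \<le> N * p"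
    and \<gamma>: "\<gamma> = q * (N - 1) / N"
    and \<kappa>: "\<kappa> \<ge> 0"
      "(\<integral>\<^sup>+x. ennreal (indicator (cbox l z) x * (\<bar>u x\<bar> + \<gamma> * L * norm (g x)) powr p) \<partial>lborel) \<le> ennreal (L powr N * \<kappa>)"
  shows "(\<integral>\<^sup>+x. ennreal (indicator (cbox l z) x * \<bar>u x\<bar> powr q) \<partial>lborel) \<le> ennreal (L powr N * \<kappa> powr (q / p))"
proof -
  let ?Q = "cbox l z"
  have N: "N \<ge> 2" using dim by (simp add: N_def)
  have q0: "q > 0" using q(1) N by (meson divide_pos_pos less_le_trans diff_gt_0_iff_gt less_le_trans[of 1 2 N] one_less_numeral_iff semiring_norm(76) zero_less_numeral)
  have \<gamma>1: "\<gamma> \<ge> 1" using q(1) N by (simp add: \<gamma> field_simps)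
  \<comment> \<open>The exponent conjugate to \<open>q / (\<gamma> - 1)\<close>; it is at most \<open>p\<close> by the upper bound on \<open>q\<close>.\<close>
  define s where "s = N * q / (N + q)"
  have s: "1 \<le> s" "s \<le> p"
    using q N q0 by (auto simp: s_def field_simps)
  have inv_s: "1 / s = (N + q) / (N * q)" using N q0 by (simp add: s_def)
  define k where "k x = \<bar>u x\<bar> + \<gamma> * L * norm (g x)" for x
  have k0: "k x \<ge> 0" for x using \<gamma>1 \<open>L > 0\<close> by (simp add: k_def)
  have Cu: "continuous_on ?Q u" using D by (intro has_derivative_continuous_on) auto
  have Ck: "continuous_on ?Q k" unfolding k_def by (intro continuous_intros C Cu)
  have meas: "(\<lambda>x. indicator ?Q x * f x) \<in> borel_measurable borel" if "continuous_on ?Q f" for f :: "'a \<Rightarrow> real"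
    using borel_measurable_continuous_on_indicator[of ?Q f] that by simp
  have meask [measurable]: "(\<lambda>x. indicator ?Q x * k x powr r) \<in> borel_measurable borel" if "r > 0" for r
    using that by (intro meas continuous_on_powr' Ck continuous_intros) (use k0 in auto)
  have measu [measurable]: "(\<lambda>x. indicator ?Q x * \<bar>u x\<bar> powr r) \<in> borel_measurable borel" if "r > 0" for r
    using that by (intro meas continuous_on_powr' Cu continuous_intros) auto
  have vol: "(\<integral>\<^sup>+x. ennreal (indicator ?Q x) \<partial>lborel) = ennreal (L powr N)"
    unfolding N_def by (rule nn_integral_indicator_cube[OF \<open>L > 0\<close> side])
  have ks: "(\<integral>\<^sup>+x. ennreal (indicator ?Q x * k x powr s) \<partial>lborel) \<le> ennreal (L powr N * \<kappa> powr (s / p))"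
  proof -
    have "(\<integral>\<^sup>+x. ennreal ((indicator ?Q x * k x powr p) powr (s / p) * indicator ?Q x powr (1 - s / p)) \<partial>lborel)
       \<le> ennreal ((L powr N * \<kappa>) powr (s / p) * (L powr N) powr (1 - s / p))"
      using \<kappa>(1) \<kappa>(2)[folded k_def] vol s p \<open>L > 0\<close>
      by (intro nn_integral_Hoelder) (auto simp: measurable_lborel1 intro!: meask)
    also have "(\<lambda>x. (indicator ?Q x * k x powr p) powr (s / p) * indicator ?Q x powr (1 - s / p))
        = (\<lambda>x. indicator ?Q x * k x powr s)"
      using p by (auto simp: fun_eq_iff indicator_def powr_powr)
    also have "(L powr N * \<kappa>) powr (s / p) * (L powr N) powr (1 - s / p) = L powr N * \<kappa> powr (s / p)"
      using \<kappa> \<open>L > 0\<close> by (simp add: powr_mult powr_powr mult.commute mult.left_commute powr_add[symmetric] algebra_simps add_divide_distrib)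
    finally show ?thesis .
  qed
  define Y where "Y = enn2real (\<integral>\<^sup>+x. ennreal (indicator ?Q x * \<bar>u x\<bar> powr q) \<partial>lborel)"
  have Y: "(\<integral>\<^sup>+x. ennreal (indicator ?Q x * \<bar>u x\<bar> powr q) \<partial>lborel) = ennreal Y"
  proof -
    have "integrable lborel (\<lambda>x. indicator ?Q x *\<^sub>R \<bar>u x\<bar> powr q)"
      using q0 by (intro borel_integrable_compact continuous_on_powr' Cu continuous_intros) auto
    then show ?thesis
      by (simp add: Y_def nn_integral_eq_integral)
  qed
  have Y0: "Y \<ge> 0" by (simp add: Y_def)
  show ?thesis
  proof (cases "Y = 0")
    case True
    then show ?thesis by (simp add: Y)
  next
    case False
    then have Ypos: "Y > 0" using Y0 by simp
    define A where "A = (L powr N * \<kappa> powr (s / p)) powr (1 / s)"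
    define W where "W = Y powr ((\<gamma> - 1) / q) * A / L"
    have W0: "W \<ge> 0" using \<open>L > 0\<close> by (simp add: W_def A_def)
    obtain v gv where v: "\<And>x. x \<in> ?Q \<Longrightarrow> (v has_derivative (\<lambda>h. gv x \<bullet> h)) (at x within ?Q)"
        "continuous_on ?Q gv" "\<And>x. \<bar>v x\<bar> = \<bar>u x\<bar> powr \<gamma>"
        "(\<integral>\<^sup>+x. ennreal (indicator ?Q x * (\<bar>v x\<bar> / L + norm (gv x))) \<partial>lborel) \<le> ennreal W"
    \<comment> \<open>For \<open>\<gamma> = 1\<close> the function \<open>|u|\<close> need not be differentiable, and \<open>u\<close> itself is used.\<close>
    proof (cases "\<gamma> = 1")
      case True
      then have "s = 1" using N q0 by (simp add: \<gamma> s_def field_simps)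
      have "(\<integral>\<^sup>+x. ennreal (indicator ?Q x * (\<bar>u x\<bar> / L + norm (g x))) \<partial>lborel)
          = (\<integral>\<^sup>+x. ennreal (1 / L) * ennreal (indicator ?Q x * k x powr s) \<partial>lborel)"
      proof (rule nn_integral_cong)
        fix x
        have "\<bar>u x\<bar> / L + norm (g x) = 1 / L * k x powr s"
          using True \<open>s = 1\<close> \<open>L > 0\<close> k0[of x] by (simp add: k_def field_simps)
        then show "ennreal (indicator ?Q x * (\<bar>u x\<bar> / L + norm (g x))) = ennreal (1 / L) * ennreal (indicator ?Q x * k x powr s)"
          using \<open>L > 0\<close> by (simp add: ennreal_mult[symmetric] indicator_def)
      qed
      also have "\<dots> = ennreal (1 / L) * (\<integral>\<^sup>+x. ennreal (indicator ?Q x * k x powr s) \<partial>lborel)"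
        using meask[of s] s by (intro nn_integral_cmult) auto
      also have "\<dots> \<le> ennreal (1 / L) * ennreal (L powr N * \<kappa> powr (s / p))"
        by (intro mult_left_mono ks) auto
      also have "\<dots> = ennreal W"
        using \<open>L > 0\<close> \<open>s = 1\<close> True Ypos by (simp add: ennreal_mult[symmetric] W_def A_def)
      finally show ?thesis
        using that[of u g] D C True by simp
    next
      case False
      then have \<gamma>2: "\<gamma> > 1" using \<gamma>1 by simp
      define v where "v x = \<bar>u x\<bar> powr \<gamma>" for x
      define gv where "gv x = abs_powr_deriv \<gamma> (u x) *\<^sub>R g x" for x
      have "(v has_derivative (\<lambda>h. gv x \<bullet> h)) (at x within ?Q)" if "x \<in> ?Q" for x
      proof -
        have "((\<lambda>t. \<bar>t\<bar> powr \<gamma>) has_derivative (\<lambda>h. abs_powr_deriv \<gamma> (u x) * h)) (at (u x))"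
          using abs_powr_has_derivative[OF \<gamma>2, of "u x"]
          by (simp add: has_field_derivative_def)
        from has_derivative_compose[OF D[OF that] this]
        show ?thesis by (simp add: v_def[abs_def] gv_def)
      qed
      moreover have "continuous_on ?Q gv"
        unfolding gv_def
        by (intro continuous_on_scaleR C continuous_on_compose2[OF continuous_on_abs_powr_deriv[OF \<gamma>2] Cu]) auto
      moreover have "(\<integral>\<^sup>+x. ennreal (indicator ?Q x * (\<bar>v x\<bar> / L + norm (gv x))) \<partial>lborel) \<le> ennreal W"
      proof -
        define a where "a = (\<gamma> - 1) / q"
        have a: "0 < a" "a \<le> 1" "1 - a = 1 / s"
          using \<gamma>2 q0 N unfolding inv_s by (auto simp: a_def \<gamma> field_simps)
        have "(\<integral>\<^sup>+x. ennreal ((indicator ?Q x * \<bar>u x\<bar> powr q) powr a * (indicator ?Q x * k x powr s) powr (1 - a)) \<partial>lborel)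
          \<le> ennreal (Y powr a * (L powr N * \<kappa> powr (s / p)) powr (1 - a))"
          using ks Y Y0 a(1,2) q0 s \<open>L > 0\<close>
          by (intro nn_integral_Hoelder) (auto simp: measurable_lborel1 intro!: meask measu)
        also have "(\<lambda>x. (indicator ?Q x * \<bar>u x\<bar> powr q) powr a * (indicator ?Q x * k x powr s) powr (1 - a))
          = (\<lambda>x. indicator ?Q x * (\<bar>u x\<bar> powr (\<gamma> - 1) * k x))"
          unfolding a(3) using k0 q0 s by (auto simp: fun_eq_iff indicator_def powr_powr a_def)
        finally have H: "(\<integral>\<^sup>+x. ennreal (indicator ?Q x * (\<bar>u x\<bar> powr (\<gamma> - 1) * k x)) \<partial>lborel) \<le> ennreal (Y powr a * A)"
          unfolding a(3) A_def .
        have "(\<integral>\<^sup>+x. ennreal (indicator ?Q x * (\<bar>v x\<bar> / L + norm (gv x))) \<partial>lborel)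
           = (\<integral>\<^sup>+x. ennreal (1 / L) * ennreal (indicator ?Q x * (\<bar>u x\<bar> powr (\<gamma> - 1) * k x)) \<partial>lborel)"
        proof (rule nn_integral_cong)
          fix x
          have "\<bar>u x\<bar> powr \<gamma> = \<bar>u x\<bar> powr (\<gamma> - 1) * \<bar>u x\<bar>"
            by (cases "u x = 0") (auto simp: powr_mult_base mult.commute)
          then have "\<bar>v x\<bar> / L + norm (gv x) = 1 / L * (\<bar>u x\<bar> powr (\<gamma> - 1) * k x)"
            using \<gamma>2 \<open>L > 0\<close> by (simp add: v_def gv_def abs_powr_deriv_abs k_def field_simps)
          then show "ennreal (indicator ?Q x * (\<bar>v x\<bar> / L + norm (gv x)))
              = ennreal (1 / L) * ennreal (indicator ?Q x * (\<bar>u x\<bar> powr (\<gamma> - 1) * k x))"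
            using \<open>L > 0\<close> k0[of x] by (simp add: ennreal_mult[symmetric] indicator_def)
        qed
        also have "\<dots> = ennreal (1 / L) * (\<integral>\<^sup>+x. ennreal (indicator ?Q x * (\<bar>u x\<bar> powr (\<gamma> - 1) * k x)) \<partial>lborel)"
        proof (rule nn_integral_cmult)
          have "(\<lambda>x. indicator ?Q x * (\<bar>u x\<bar> powr (\<gamma> - 1) * k x)) \<in> borel_measurable borel"
            using \<gamma>2 by (intro meas continuous_on_mult continuous_on_powr' Cu Ck continuous_intros) auto
          then show "(\<lambda>x. ennreal (indicator ?Q x * (\<bar>u x\<bar> powr (\<gamma> - 1) * k x))) \<in> borel_measurable lborel" by simp
        qed
        also have "\<dots> \<le> ennreal (1 / L) * ennreal (Y powr a * A)"
          by (intro mult_left_mono H) auto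
        also have "\<dots> = ennreal W"
          using \<open>L > 0\<close> by (simp add: ennreal_mult[symmetric] W_def a_def A_def)
        finally show ?thesis .
      qed
      ultimately show ?thesis using that[of v gv] by (simp add: v_def)
    qed
    have "(\<integral>\<^sup>+x. ennreal (indicator ?Q x * \<bar>v x\<bar> powr (N / (N - 1))) \<partial>lborel) \<le> ennreal (W powr (N / (N - 1)))"
      unfolding N_def by (rule cube_sobolev_exponent_one[OF \<open>L > 0\<close> side v(1,2) dim W0 v(4)])
    moreover have "\<bar>v x\<bar> powr (N / (N - 1)) = \<bar>u x\<bar> powr q" for x
      using N by (simp add: v(3) powr_powr \<gamma>)
    ultimately have "Y \<le> W powr (N / (N - 1))" by (simp add: Y)
    also have "\<dots> = Y powr (1 - 1 / \<gamma>) * (A / L) powr (q / \<gamma>)"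
    proof -
      \<comment> \<open>The exponent of \<open>Y\<close> is below \<open>1\<close>, which allows the cancellation.\<close>
      have e: "(\<gamma> - 1) / q * (N / (N - 1)) = 1 - 1 / \<gamma>" "N / (N - 1) = q / \<gamma>"
        using N q0 \<gamma>1 by (auto simp: \<gamma> field_simps)
      have "W powr (N / (N - 1)) = (Y powr ((\<gamma> - 1) / q)) powr (N / (N - 1)) * (A / L) powr (N / (N - 1))"
        using \<open>L > 0\<close> by (simp add: W_def powr_mult powr_divide A_def)
      then show ?thesis unfolding powr_powr e(1) unfolding e(2) .
    qed
    finally have "Y powr (1 / \<gamma>) \<le> (A / L) powr (q / \<gamma>)"
      using Ypos by (simp add: powr_diff field_simps)
    then have "(Y powr (1 / \<gamma>)) powr \<gamma> \<le> ((A / L) powr (q / \<gamma>)) powr \<gamma>"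
      using \<gamma>1 by (intro powr_mono2) auto
    then have "Y \<le> (A / L) powr q"
      using \<gamma>1 Ypos by (simp add: powr_powr)
    also have "\<dots> = L powr N * \<kappa> powr (q / p)"
    proof -
      have "A = L powr (N / s) * \<kappa> powr (1 / p)"
        using s p \<kappa> by (simp add: A_def powr_mult powr_powr)
      then have "A / L = L powr (N / s - 1) * \<kappa> powr (1 / p)"
        using \<open>L > 0\<close> by (simp add: powr_diff)
      moreover have "(N / s - 1) * q = N" using N q0 by (simp add: s_def field_simps)
      ultimately show ?thesis by (simp add: powr_mult powr_powr)
    qed
    finally show ?thesis by (simp add: Y ennreal_leI)
  qed
qed

text \<open>For \<open>q\<close> below \<open>N / (N - 1)\<close> the inequality with exponent \<open>N / (N - 1)\<close> is followed by Hoelder's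
inequality on the cube; the maximum in \<open>\<gamma>\<close> covers this case. The bound \<open>\<kappa>\<close> refers to the mean value, which makes
the inequality independent of the side \<open>L\<close>.\<close>

lemma cube_sobolev_smooth:
  fixes u :: "'a::euclidean_space \<Rightarrow> real" and g :: "'a \<Rightarrow> 'a"
  defines "N \<equiv> real DIM('a)"
  assumes "L > 0" and side: "\<And>b. b \<in> Basis \<Longrightarrow> (z - l) \<bullet> b = L"
    and D: "\<And>x. x \<in> cbox l z \<Longrightarrow> (u has_derivative (\<lambda>h. g x \<bullet> h)) (at x within cbox l z)"
    and C: "continuous_on (cbox l z) g"
    and dim: "DIM('a) \<ge> 2" and p: "1 \<le> p" and q: "0 < q" "q * (N - p) \<le> N * p"
    and \<gamma>: "\<gamma> = max 1 (q * (N - 1) / N)"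
    and \<kappa>: "\<kappa> \<ge> 0"
      "(\<integral>\<^sup>+x. ennreal (indicator (cbox l z) x * (\<bar>u x\<bar> powr p + (L * norm (g x)) powr p)) \<partial>lborel) \<le> ennreal (L powr N * \<kappa>)"
  shows "(\<integral>\<^sup>+x. ennreal (indicator (cbox l z) x * \<bar>u x\<bar> powr q) \<partial>lborel)
    \<le> ennreal (L powr N * ((2 * \<gamma>) powr p * \<kappa>) powr (q / p))"
proof -
  let ?Q = "cbox l z"
  have N: "N \<ge> 2" using dim by (simp add: N_def)
  have \<gamma>1: "\<gamma> \<ge> 1" by (simp add: \<gamma>)
  define \<kappa>' where "\<kappa>' = (2 * \<gamma>) powr p * \<kappa>"
  have \<kappa>'0: "\<kappa>' \<ge> 0" using \<kappa>(1) by (simp add: \<kappa>'_def)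
  have Cu: "continuous_on ?Q u" using D by (intro has_derivative_continuous_on) auto
  have meas: "(\<lambda>x. indicator ?Q x * f x) \<in> borel_measurable borel" if "continuous_on ?Q f" for f :: "'a \<Rightarrow> real"
    using borel_measurable_continuous_on_indicator[of ?Q f] that by simp
  have \<kappa>': "(\<integral>\<^sup>+x. ennreal (indicator ?Q x * (\<bar>u x\<bar> + \<gamma> * L * norm (g x)) powr p) \<partial>lborel) \<le> ennreal (L powr N * \<kappa>')"
  proof -
    have pt: "(\<bar>u x\<bar> + \<gamma> * L * norm (g x)) powr p \<le> (2 * \<gamma>) powr p * (\<bar>u x\<bar> powr p + (L * norm (g x)) powr p)" for x
    proof -
      have "\<bar>u x\<bar> + \<gamma> * L * norm (g x) \<le> \<gamma> * (\<bar>u x\<bar> + L * norm (g x))"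
        using \<gamma>1 mult_right_mono[of 1 \<gamma> "\<bar>u x\<bar>"] by (simp add: algebra_simps)
      then have "(\<bar>u x\<bar> + \<gamma> * L * norm (g x)) powr p \<le> (\<gamma> * (\<bar>u x\<bar> + L * norm (g x))) powr p"
        using \<gamma>1 \<open>L > 0\<close> p by (intro powr_mono2) auto
      also have "\<dots> = \<gamma> powr p * (\<bar>u x\<bar> + L * norm (g x)) powr p"
        using \<gamma>1 \<open>L > 0\<close> by (simp add: powr_mult)
      also have "\<dots> \<le> \<gamma> powr p * (2 powr p * (\<bar>u x\<bar> powr p + (L * norm (g x)) powr p))"
        using \<open>L > 0\<close> p by (intro mult_left_mono powr_add_le) auto
      finally show ?thesis using \<gamma>1 by (simp add: powr_mult mult_ac)
    qed
    have "(\<integral>\<^sup>+x. ennreal (indicator ?Q x * (\<bar>u x\<bar> + \<gamma> * L * norm (g x)) powr p) \<partial>lborel)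
       \<le> (\<integral>\<^sup>+x. ennreal ((2 * \<gamma>) powr p) * ennreal (indicator ?Q x * (\<bar>u x\<bar> powr p + (L * norm (g x)) powr p)) \<partial>lborel)"
      using pt by (intro nn_integral_mono) (auto simp: ennreal_mult[symmetric] indicator_def intro!: ennreal_leI)
    also have "\<dots> = ennreal ((2 * \<gamma>) powr p) * (\<integral>\<^sup>+x. ennreal (indicator ?Q x * (\<bar>u x\<bar> powr p + (L * norm (g x)) powr p)) \<partial>lborel)"
    proof (rule nn_integral_cmult)
      have "(\<lambda>x. indicator ?Q x * (\<bar>u x\<bar> powr p + (L * norm (g x)) powr p)) \<in> borel_measurable borel"
        using p \<open>L > 0\<close> by (intro meas continuous_on_add continuous_on_powr' Cu C continuous_intros) auto
      then show "(\<lambda>x. ennreal (indicator ?Q x * (\<bar>u x\<bar> powr p + (L * norm (g x)) powr p))) \<in> borel_measurable lborel"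
        by simp
    qed
    also have "\<dots> \<le> ennreal ((2 * \<gamma>) powr p) * ennreal (L powr N * \<kappa>)"
      by (intro mult_left_mono \<kappa>) auto
    also have "\<dots> = ennreal (L powr N * \<kappa>')"
      using \<kappa>(1) by (simp add: ennreal_mult[symmetric] \<kappa>'_def mult_ac)
    finally show ?thesis .
  qed
  show ?thesis unfolding \<kappa>'_def[symmetric]
  proof (cases "N / (N - 1) \<le> q")
    case True
    then have "\<gamma> = q * (N - 1) / N"
      using N by (simp add: \<gamma> field_simps max_def)
    then show "(\<integral>\<^sup>+x. ennreal (indicator ?Q x * \<bar>u x\<bar> powr q) \<partial>lborel) \<le> ennreal (L powr N * \<kappa>' powr (q / p))"
      using cube_sobolev_smooth_aux[OF \<open>L > 0\<close> side D C dim p, of q \<gamma> \<kappa>'] True q(2) \<kappa>'0 \<kappa>'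
      unfolding N_def by auto
  next
    case False
    define r where "r = N / (N - 1)"
    have r: "q < r" "r > 0" using False N by (auto simp: r_def)
    have "\<gamma> = 1" "r * (N - 1) / N = 1" using False N by (auto simp: \<gamma> r_def field_simps max_def)
    have "N * 1 \<le> N * p" using N p by (intro mult_left_mono) auto
    then have "r * (N - p) \<le> N * p" using N by (simp add: r_def field_simps)
    then have r': "(\<integral>\<^sup>+x. ennreal (indicator ?Q x * \<bar>u x\<bar> powr r) \<partial>lborel) \<le> ennreal (L powr N * \<kappa>' powr (r / p))"
      using cube_sobolev_smooth_aux[OF \<open>L > 0\<close> side D C dim p, of r \<gamma> \<kappa>'] \<kappa>'0 \<kappa>' \<open>\<gamma> = 1\<close> \<open>r * (N - 1) / N = 1\<close>
      unfolding N_def r_def by auto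
    have "(\<integral>\<^sup>+x. ennreal ((indicator ?Q x * \<bar>u x\<bar> powr r) powr (q / r) * indicator ?Q x powr (1 - q / r)) \<partial>lborel)
       \<le> ennreal ((L powr N * \<kappa>' powr (r / p)) powr (q / r) * (L powr N) powr (1 - q / r))"
    proof (rule nn_integral_Hoelder)
      show "(\<lambda>x. indicator ?Q x * \<bar>u x\<bar> powr r) \<in> borel_measurable lborel"
        using r by (simp, intro meas continuous_on_powr' Cu continuous_intros) auto
    qed (use r' r q nn_integral_indicator_cube[OF \<open>L > 0\<close> side] in \<open>auto simp: N_def\<close>)
    also have "(\<lambda>x. (indicator ?Q x * \<bar>u x\<bar> powr r) powr (q / r) * indicator ?Q x powr (1 - q / r))
        = (\<lambda>x. indicator ?Q x * \<bar>u x\<bar> powr q)"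
      using r by (auto simp: fun_eq_iff indicator_def powr_powr)
    also have "(L powr N * \<kappa>' powr (r / p)) powr (q / r) * (L powr N) powr (1 - q / r) = L powr N * \<kappa>' powr (q / p)"
    proof -
      have "(L powr N) powr (q / r) * (L powr N) powr (1 - q / r) = L powr N"
        using \<open>L > 0\<close> by (simp flip: powr_add)
      then show ?thesis using r by (simp add: powr_mult powr_powr mult_ac)
    qed
    finally show "(\<integral>\<^sup>+x. ennreal (indicator ?Q x * \<bar>u x\<bar> powr q) \<partial>lborel) \<le> ennreal (L powr N * \<kappa>' powr (q / p))" .
  qed
qed

section \<open>Smooth mollifiers\<close>

text \<open>These functions are closed under differentiation. A bump function in several variables is a product of
them, one for each coordinate, and all its partial derivatives are again such products; this
gives smoothness without a rule for higher derivatives of products.\<close>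

definition bump_factor :: "real poly \<Rightarrow> nat \<Rightarrow> real \<Rightarrow> real" where
  "bump_factor P m t = (if \<bar>t\<bar> < 1 then poly P t / (1 - t\<^sup>2) ^ m * exp (- 1 / (1 - t\<^sup>2)) else 0)"

definition bump_deriv_poly :: "real poly \<Rightarrow> nat \<Rightarrow> real poly" where
  "bump_deriv_poly P m = pderiv P * [:1, 0, -1:]\<^sup>2 + smult (2 * real m) ([:0, 1:] * P * [:1, 0, -1:]) - smult 2 ([:0, 1:] * P)"

text \<open>The exponential decay beats every power of \<open>1 - t\<^sup>2\<close>; the second power is what makes the derivative vanish at
the end points.\<close>

lemma bump_factor_bound:
  "\<exists>C. \<forall>t. \<bar>bump_factor P m t\<bar> \<le> C * (1 - t\<^sup>2)\<^sup>2"
proof -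
  have "compact (poly P ` {-1..1})"
    by (intro compact_continuous_image continuous_intros) auto
  then obtain B where B: "\<And>t. t \<in> {-1..1} \<Longrightarrow> \<bar>poly P t\<bar> \<le> B"
    by (force simp: bounded_iff dest: compact_imp_bounded)
  define n where "n = m + 2"
  have "\<bar>bump_factor P m t\<bar> \<le> B * real n ^ n * (1 - t\<^sup>2)\<^sup>2" for t
  proof (cases "\<bar>t\<bar> < 1")
    case True
    define d where "d = 1 - t\<^sup>2"
    have d: "d > 0" using True by (simp add: d_def abs_square_less_1)
    have "(1 / d / real n) ^ n \<le> (1 + (1 / d) / real n) ^ n"
      using d by (intro power_mono) auto
    also have "\<dots> \<le> exp (1 / d)"
      using d by (intro exp_ge_one_plus_x_over_n_power_n) (auto simp: n_def intro: order_trans[of _ 0])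
    finally have le: "(1 / d / real n) ^ n \<le> exp (1 / d)" .
    define c where "c = real n ^ n * d ^ n"
    have c: "c > 0" using d by (simp add: c_def n_def)
    have "(1 / d / real n) ^ n = inverse c"
      by (simp add: c_def power_divide power_mult_distrib divide_inverse power_inverse mult.commute)
    then have "inverse (exp (1 / d)) \<le> inverse (inverse c)"
      using le c by (intro le_imp_inverse_le) auto
    then have "exp (- 1 / d) \<le> c" by (simp add: exp_minus)
    then have "exp (- 1 / d) / d ^ m \<le> c / d ^ m"
      using d by (intro divide_right_mono) auto
    also have "c / d ^ m = real n ^ n * d\<^sup>2"
      using d by (simp add: c_def n_def[symmetric] power_add[of d m 2, folded n_def])
    finally have "exp (- 1 / d) / d ^ m \<le> real n ^ n * d\<^sup>2" .
    have "\<bar>poly P t\<bar> * (exp (- 1 / d) / d ^ m) \<le> B * (real n ^ n * d\<^sup>2)"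
    proof (rule mult_mono)
      show "\<bar>poly P t\<bar> \<le> B" using True by (intro B) auto
      show "0 \<le> B" using B[of 0] by auto
    qed (use d \<open>exp (- 1 / d) / d ^ m \<le> real n ^ n * d\<^sup>2\<close> in auto)
    then show ?thesis using True d by (simp add: bump_factor_def abs_mult mult_ac flip: d_def)
  next
    case False
    then show ?thesis using B[of 0] by (simp add: bump_factor_def)
  qed
  then show ?thesis by blast
qed

lemma bump_factor_has_derivative:
  "(bump_factor P m has_real_derivative bump_factor (bump_deriv_poly P m) (m + 2) t) (at t)"
proof -
  consider "\<bar>t\<bar> < 1" | "\<bar>t\<bar> > 1" | "\<bar>t\<bar> = 1" by linarith
  then show ?thesis
  proof cases
    case 1
    define d where "d = 1 - t\<^sup>2"
    have d: "d > 0" using 1 by (simp add: d_def abs_square_less_1)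
    have E: "((\<lambda>t. exp (- 1 / (1 - t\<^sup>2))) has_real_derivative exp (- 1 / d) * (- (2 * t) / d\<^sup>2)) (at t)"
      using d unfolding d_def
      by (auto intro!: derivative_eq_intros simp: power2_eq_square)
    have I: "((\<lambda>t. 1 / (1 - t\<^sup>2) ^ m) has_real_derivative (2 * real m * t) / d ^ (m + 1)) (at t)"
    proof -
      have "((\<lambda>t. 1 / (1 - t\<^sup>2)) has_real_derivative 2 * t / d\<^sup>2) (at t)"
        using d unfolding d_def by (auto intro!: derivative_eq_intros simp: power2_eq_square)
      from DERIV_power[OF this, of m]
      have "((\<lambda>t. 1 / (1 - t\<^sup>2) ^ m) has_real_derivative real m * (2 * t / d\<^sup>2 * (1 / d) ^ (m - Suc 0))) (at t)"
        by (simp add: power_divide d_def)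
      also have "real m * (2 * t / d\<^sup>2 * (1 / d) ^ (m - Suc 0)) = (2 * real m * t) / d ^ (m + 1)"
        by (cases m) (simp_all add: power2_eq_square power_divide field_simps)
      finally show ?thesis .
    qed
    have "((\<lambda>t. poly P t * (1 / (1 - t\<^sup>2) ^ m) * exp (- 1 / (1 - t\<^sup>2))) has_real_derivative
        (poly (pderiv P) t * (1 / d ^ m) + (2 * real m * t) / d ^ (m + 1) * poly P t) * exp (- 1 / d)
         + exp (- 1 / d) * (- (2 * t) / d\<^sup>2) * (poly P t * (1 / d ^ m))) (at t)"
      using DERIV_mult[OF DERIV_mult[OF poly_DERIV[of P t] I] E] unfolding d_def .
    also have "(poly (pderiv P) t * (1 / d ^ m) + (2 * real m * t) / d ^ (m + 1) * poly P t) * exp (- 1 / d)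
         + exp (- 1 / d) * (- (2 * t) / d\<^sup>2) * (poly P t * (1 / d ^ m))
      = (poly (pderiv P) t * d\<^sup>2 + 2 * real m * t * poly P t * d - 2 * t * poly P t) / d ^ (m + 2) * exp (- 1 / d)"
      using d by (simp add: power_add power2_eq_square field_simps)
    also have "poly (pderiv P) t * d\<^sup>2 + 2 * real m * t * poly P t * d - 2 * t * poly P t = poly (bump_deriv_poly P m) t"
      by (simp add: bump_deriv_poly_def d_def power2_eq_square algebra_simps)
    also have "poly (bump_deriv_poly P m) t / d ^ (m + 2) * exp (- 1 / d) = bump_factor (bump_deriv_poly P m) (m + 2) t"
      using 1 by (simp add: bump_factor_def d_def)
    finally have "((\<lambda>t. poly P t * (1 / (1 - t\<^sup>2) ^ m) * exp (- 1 / (1 - t\<^sup>2))) has_real_derivative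
        bump_factor (bump_deriv_poly P m) (m + 2) t) (at t)" .
    then show ?thesis
      by (rule has_field_derivative_transform_within_open[where S = "{-1<..<1}"])
         (use 1 in \<open>auto simp: bump_factor_def\<close>)
  next
    case 2
    have "((\<lambda>t. 0) has_real_derivative bump_factor (bump_deriv_poly P m) (m + 2) t) (at t)"
      using 2 by (simp add: bump_factor_def)
    then show ?thesis
      by (rule has_field_derivative_transform_within_open[where S = "- {-1..1}"])
         (use 2 in \<open>auto simp: bump_factor_def\<close>)
  next
    case 3
    obtain C where C: "\<And>t. \<bar>bump_factor P m t\<bar> \<le> C * (1 - t\<^sup>2)\<^sup>2"
      using bump_factor_bound by blast
    have lim: "((\<lambda>y. \<bar>C * (y - t) * (y + t)\<^sup>2\<bar>) \<longlongrightarrow> \<bar>C * (t - t) * (t + t)\<^sup>2\<bar>) (at t)"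
      by (intro tendsto_intros)
    have "((\<lambda>y. bump_factor P m y / (y - t)) \<longlongrightarrow> 0) (at t)"
    proof (rule Lim_null_comparison)
      show "((\<lambda>y. \<bar>C * (y - t) * (y + t)\<^sup>2\<bar>) \<longlongrightarrow> 0) (at t)" using lim by simp
      show "\<forall>\<^sub>F y in at t. norm (bump_factor P m y / (y - t)) \<le> \<bar>C * (y - t) * (y + t)\<^sup>2\<bar>"
      proof (rule eventually_mono[OF eventually_at_ball'[of 1]])
        fix y assume y: "y \<in> ball t 1 \<and> y \<noteq> t \<and> y \<in> UNIV"
        have "t\<^sup>2 = 1" using 3 by (simp add: power2_eq_1_iff abs_if split: if_splits)
        then have e: "(1 - y\<^sup>2)\<^sup>2 = (y - t)\<^sup>2 * (y + t)\<^sup>2"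
          by (simp add: power2_eq_square algebra_simps)
        have "\<bar>bump_factor P m y\<bar> \<le> \<bar>C\<bar> * ((y - t)\<^sup>2 * (y + t)\<^sup>2)"
          using C[of y] unfolding e by (smt (verit) mult_right_mono zero_le_mult_iff zero_le_power2)
        also have "\<dots> = \<bar>C * (y - t) * (y + t)\<^sup>2\<bar> * \<bar>y - t\<bar>"
          by (simp add: abs_mult power2_eq_square)
        finally show "norm (bump_factor P m y / (y - t)) \<le> \<bar>C * (y - t) * (y + t)\<^sup>2\<bar>"
          using y by (simp add: divide_le_eq)
      qed simp
    qed
    moreover have "bump_factor P' k t = 0" for P' k using 3 by (simp add: bump_factor_def)
    ultimately show ?thesis by (simp add: has_field_derivative_iff)
  qed
qed

lemma frechet_derivative_eqI: "(f has_derivative f') (at x) \<Longrightarrow> frechet_derivative f (at x) = f'"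
  by (rule frechet_derivative_at[symmetric])

lemma bump_prod_has_derivative:
  fixes x :: "real^'n"
  shows "((\<lambda>x. \<Prod>i\<in>UNIV. bump_factor (P i) (m i) (x $ i)) has_derivative
    (\<lambda>h. \<Sum>i\<in>UNIV. bump_factor (bump_deriv_poly (P i) (m i)) (m i + 2) (x $ i) * h $ i *
       (\<Prod>j\<in>UNIV - {i}. bump_factor (P j) (m j) (x $ j)))) (at x)"
proof (rule has_derivative_prod)
  fix i :: 'n
  have "((\<lambda>x::real^'n. x $ i) has_derivative (\<lambda>h. h $ i)) (at x)"
    by (rule bounded_linear_imp_has_derivative[OF bounded_linear_vec_nth])
  from has_derivative_compose[OF this bump_factor_has_derivative[of "P i" "m i", THEN has_field_derivative_imp_has_derivative]]
  show "((\<lambda>x. bump_factor (P i) (m i) (x $ i)) has_derivative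
    (\<lambda>h. bump_factor (bump_deriv_poly (P i) (m i)) (m i + 2) (x $ i) * h $ i)) (at x)"
    by (simp add: mult.commute)
qed

lemma partial_deriv_bump_prod:
  fixes P :: "'n::finite \<Rightarrow> real poly"
  shows "partial_deriv k (\<lambda>x. \<Prod>i\<in>UNIV. bump_factor (P i) (m i) (x $ i)) =
    (\<lambda>x. \<Prod>i\<in>UNIV. bump_factor ((P(k := bump_deriv_poly (P k) (m k))) i) ((m(k := m k + 2)) i) (x $ i))"
proof
  fix x :: "real^'n"
  have "partial_deriv k (\<lambda>x. \<Prod>i\<in>UNIV. bump_factor (P i) (m i) (x $ i)) x
     = (\<Sum>i\<in>UNIV. bump_factor (bump_deriv_poly (P i) (m i)) (m i + 2) (x $ i) * axis k 1 $ i *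
       (\<Prod>j\<in>UNIV - {i}. bump_factor (P j) (m j) (x $ j)))"
    unfolding partial_deriv_def frechet_derivative_eqI[OF bump_prod_has_derivative] ..
  also have "\<dots> = (\<Sum>i\<in>UNIV. if i = k then bump_factor (bump_deriv_poly (P k) (m k)) (m k + 2) (x $ k) *
       (\<Prod>j\<in>UNIV - {k}. bump_factor (P j) (m j) (x $ j)) else 0)"
    by (intro sum.cong) (auto simp: axis_def)
  also have "\<dots> = bump_factor (bump_deriv_poly (P k) (m k)) (m k + 2) (x $ k) *
       (\<Prod>j\<in>UNIV - {k}. bump_factor (P j) (m j) (x $ j))" by simp
  also have "\<dots> = (\<Prod>i\<in>UNIV. bump_factor ((P(k := bump_deriv_poly (P k) (m k))) i) ((m(k := m k + 2)) i) (x $ i))"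
    by (subst (2) prod.remove[of _ k]) auto
  finally show "partial_deriv k (\<lambda>x. \<Prod>i\<in>UNIV. bump_factor (P i) (m i) (x $ i)) x =
     (\<Prod>i\<in>UNIV. bump_factor ((P(k := bump_deriv_poly (P k) (m k))) i) ((m(k := m k + 2)) i) (x $ i))" .
qed

lemma Ck_bump_prod:
  fixes P :: "'n::finite \<Rightarrow> real poly"
  shows "Ck k (\<lambda>x. \<Prod>i\<in>UNIV. bump_factor (P i) (m i) (x $ i))"
proof (induction k arbitrary: P m)
  case 0
  show ?case
    by (auto simp: continuous_on_eq_continuous_at intro: has_derivative_continuous[OF bump_prod_has_derivative])
next
  case (Suc k)
  show ?case
    unfolding Ck.simps partial_deriv_bump_prod
    by (intro conjI allI Suc.IH differentiableI[OF bump_prod_has_derivative])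
qed

lemma partial_deriv_affine:
  assumes "\<And>x. f differentiable (at x)"
  shows "partial_deriv i (\<lambda>y. c * f (a *\<^sub>R y + b)) = (\<lambda>y. (c * a) * partial_deriv i f (a *\<^sub>R y + b))"
proof
  fix y
  let ?D = "frechet_derivative f (at (a *\<^sub>R y + b))"
  have D: "(f has_derivative ?D) (at (a *\<^sub>R y + b))"
    using assms by (simp add: frechet_derivative_works)
  have "((\<lambda>y. a *\<^sub>R y + b) has_derivative (\<lambda>h. a *\<^sub>R h)) (at y)"
    by (auto intro!: derivative_eq_intros)
  from has_derivative_mult_right[OF has_derivative_compose[OF this D], of c]
  have "partial_deriv i (\<lambda>y. c * f (a *\<^sub>R y + b)) y = c * ?D (a *\<^sub>R axis i 1)"
    unfolding partial_deriv_def by (subst frechet_derivative_eqI) auto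
  also have "?D (a *\<^sub>R axis i 1) = a * ?D (axis i 1)"
    using linear_scale[OF has_derivative_linear[OF D]] by simp
  finally show "partial_deriv i (\<lambda>y. c * f (a *\<^sub>R y + b)) y = (c * a) * partial_deriv i f (a *\<^sub>R y + b)"
    by (simp add: partial_deriv_def)
qed

lemma Ck_affine: "Ck k f \<Longrightarrow> Ck k (\<lambda>y. c * f (a *\<^sub>R y + b))"
proof (induction k arbitrary: f c)
  case 0
  then have "continuous_on UNIV f" by simp
  then have "continuous_on UNIV (\<lambda>y. f (a *\<^sub>R y + b))"
    by (rule continuous_on_compose2) (auto intro!: continuous_on_add continuous_on_scaleR continuous_on_const continuous_on_id)
  then show ?case by (simp add: continuous_on_mult_left)
next
  case (Suc k)
  have f: "\<And>x. f differentiable (at x)" "\<And>i. Ck k (partial_deriv i f)" using Suc.prems by auto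
  have "(\<lambda>y. c * f (a *\<^sub>R y + b)) differentiable (at x)" for x
  proof -
    have "((\<lambda>y. a *\<^sub>R y + b) has_derivative (\<lambda>h. a *\<^sub>R h)) (at x)"
      by (auto intro!: derivative_eq_intros)
    from has_derivative_mult_right[OF has_derivative_compose[OF this]] show ?thesis
      using f(1)[of "a *\<^sub>R x + b"] unfolding differentiable_def by blast
  qed
  moreover have "Ck k (partial_deriv i (\<lambda>y. c * f (a *\<^sub>R y + b)))" for i
    unfolding partial_deriv_affine[OF f(1)] by (rule Suc.IH[OF f(2)])
  ultimately show ?case by simp
qed

lemma has_derivative_partial_deriv:
  assumes "f differentiable (at x)"
  shows "(f has_derivative (\<lambda>h. (\<chi> i. partial_deriv i f x) \<bullet> h)) (at x)"
proof -
  let ?D = "frechet_derivative f (at x)"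
  have D: "(f has_derivative ?D) (at x)"
    using assms by (simp add: frechet_derivative_works)
  have "?D h = (\<chi> i. partial_deriv i f x) \<bullet> h" for h
  proof -
    have "?D h = ?D (\<Sum>i\<in>UNIV. h $ i *\<^sub>R axis i 1)"
      by (simp add: basis_expansion flip: scalar_mult_eq_scaleR)
    also have "\<dots> = (\<Sum>i\<in>UNIV. h $ i *\<^sub>R ?D (axis i 1))"
      by (simp add: linear_sum[OF has_derivative_linear[OF D]] linear_scale[OF has_derivative_linear[OF D]])
    finally show ?thesis by (simp add: inner_vec_def partial_deriv_def mult.commute)
  qed
  then have "?D = (\<lambda>h. (\<chi> i. partial_deriv i f x) \<bullet> h)" by blast
  then show ?thesis using D by simp
qed

text \<open>The support condition uses the coordinates because the bump functions are supported in cubes.\<close>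

definition mollifier :: "real \<Rightarrow> (real^'n::finite \<Rightarrow> real) \<Rightarrow> bool" where
  "mollifier \<epsilon> \<rho> \<longleftrightarrow> (\<forall>k. Ck k \<rho>) \<and> (\<forall>z. \<rho> z \<ge> 0) \<and> (\<forall>z i. \<bar>z $ i\<bar> \<ge> \<epsilon> \<longrightarrow> \<rho> z = 0) \<and>
     integrable lborel \<rho> \<and> (LINT z|lborel. \<rho> z) = 1"

text \<open>A rescaled product of bump functions, divided by its integral.\<close>

lemma mollifier_exists:
  assumes "\<epsilon> > 0"
  shows "\<exists>\<rho> :: real^'n::finite \<Rightarrow> real. mollifier \<epsilon> \<rho>"
proof -
  define \<eta> :: "real^'n \<Rightarrow> real" where "\<eta> = (\<lambda>z. \<Prod>i\<in>UNIV. bump_factor 1 0 (z $ i))"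
  define \<sigma> where "\<sigma> z = 1 * \<eta> ((1 / \<epsilon>) *\<^sub>R z + 0)" for z
  have Ck\<sigma>: "Ck k \<sigma>" for k
    unfolding \<sigma>_def by (rule Ck_affine) (simp add: \<eta>_def Ck_bump_prod)
  have cont: "continuous_on UNIV \<sigma>" using Ck\<sigma>[of 0] by simp
  have nn: "\<sigma> z \<ge> 0" for z
    by (auto simp: \<sigma>_def \<eta>_def bump_factor_def intro!: prod_nonneg)
  have supp: "\<sigma> z = 0" if "\<bar>z $ i\<bar> \<ge> \<epsilon>" for z i
  proof -
    have "bump_factor 1 0 (((1 / \<epsilon>) *\<^sub>R z + 0) $ i) = 0"
      using that assms by (simp add: bump_factor_def abs_mult divide_less_eq)
    then have "\<eta> ((1 / \<epsilon>) *\<^sub>R z + 0) = 0"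
      unfolding \<eta>_def by (intro prod_zero bexI[of _ i]) auto
    then show ?thesis by (simp only: \<sigma>_def mult_zero_right)
  qed
  have "\<sigma> 0 > 0" by (simp add: \<sigma>_def \<eta>_def bump_factor_def prod_pos)
  have ind: "\<sigma> = (\<lambda>z. indicator (cbox (- vec \<epsilon>) (vec \<epsilon>)) z *\<^sub>R \<sigma> z)"
  proof
    fix z
    show "\<sigma> z = indicator (cbox (- vec \<epsilon>) (vec \<epsilon>)) z *\<^sub>R \<sigma> z"
    proof (cases "z \<in> cbox (- vec \<epsilon>) (vec \<epsilon>)")
      case False
      then obtain i where "\<not> (- \<epsilon> \<le> z $ i \<and> z $ i \<le> \<epsilon>)" by (auto simp: mem_box_cart)
      then have "\<sigma> z = 0" by (intro supp[of z i]) linarith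
      then show ?thesis by simp
    qed simp
  qed
  have int: "integrable lborel \<sigma>"
    by (subst ind) (intro borel_integrable_compact compact_cbox continuous_on_subset[OF cont] subset_UNIV)
  have pos: "(LINT z|lborel. \<sigma> z) > 0"
  proof -
    have "\<sigma> 0 / 2 > 0" using \<open>\<sigma> 0 > 0\<close> by simp
    then obtain d where d: "d > 0" "\<And>z. dist z 0 < d \<Longrightarrow> dist (\<sigma> z) (\<sigma> 0) < \<sigma> 0 / 2"
      using cont unfolding continuous_on_iff by (meson UNIV_I)
    have "0 < \<sigma> 0 / 2 * measure lborel (ball (0::real^'n) d)"
      using \<open>\<sigma> 0 > 0\<close> d(1) by (simp add: content_ball_pos)
    also have "\<dots> = (LINT z|lborel. indicator (ball (0::real^'n) d) z * (\<sigma> 0 / 2))" by simp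
    also have "\<dots> \<le> (LINT z|lborel. \<sigma> z)"
    proof (rule integral_mono)
      fix z
      show "indicator (ball 0 d) z * (\<sigma> 0 / 2) \<le> \<sigma> z"
        using d(2)[of z] nn[of z] by (auto simp: indicator_def dist_commute dist_real_def abs_if split: if_splits)
    next
      have "integrable lborel (indicator (ball (0::real^'n) d) :: _ \<Rightarrow> real)"
        by (intro integrable_real_indicator emeasure_bounded_finite) auto
      then show "integrable lborel (\<lambda>z. indicator (ball (0::real^'n) d) z * (\<sigma> 0 / 2))"
        by (rule integrable_mult_left)
    qed (rule int)
    finally show ?thesis .
  qed
  define c where "c = 1 / (LINT z|lborel. \<sigma> z)"
  have "mollifier \<epsilon> (\<lambda>z. c * \<sigma> (1 *\<^sub>R z + 0))"
    unfolding mollifier_def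
    using Ck_affine[OF Ck\<sigma>, of _ c 1 0] nn supp int pos by (auto simp: c_def)
  then show ?thesis by blast
qed

section \<open>Mollification of integrable functions\<close>

text \<open>The function \<open>U\<close> may be vector valued, so that a function and its gradient are mollified by the same operation.\<close>

definition conv :: "('a::euclidean_space \<Rightarrow> 'b::euclidean_space) \<Rightarrow> ('a \<Rightarrow> real) \<Rightarrow> 'a \<Rightarrow> 'b" where
  "conv U K x = (LINT y|lborel. K (x - y) *\<^sub>R U y)"

lemma integrable_conv:
  fixes U :: "'a::euclidean_space \<Rightarrow> 'b::euclidean_space" and K :: "'a \<Rightarrow> real"
  assumes U: "integrable lborel U" and supp: "\<And>y. y \<notin> cball 0 R \<Longrightarrow> U y = 0"
    and K: "continuous_on UNIV K"
  shows "integrable lborel (\<lambda>y. K (x - y) *\<^sub>R U y)"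
proof -
  have "compact (K ` cball 0 (norm x + R))"
    by (intro compact_continuous_image continuous_on_subset[OF K]) auto
  then obtain B where B: "\<And>z. z \<in> cball 0 (norm x + R) \<Longrightarrow> \<bar>K z\<bar> \<le> B"
    by (force simp: bounded_iff dest: compact_imp_bounded)
  have [measurable]: "K \<in> borel_measurable borel" using K by (rule borel_measurable_continuous_onI)
  have [measurable]: "U \<in> borel_measurable borel" using U by auto
  show ?thesis
  proof (rule Bochner_Integration.integrable_bound)
    show "integrable lborel (\<lambda>y. B * norm (U y))" using U by (intro integrable_mult_right integrable_norm)
    show "AE y in lborel. norm (K (x - y) *\<^sub>R U y) \<le> norm (B * norm (U y))"
    proof (intro AE_I2)
      fix y
      show "norm (K (x - y) *\<^sub>R U y) \<le> norm (B * norm (U y))"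
      proof (cases "y \<in> cball 0 R")
        case True
        then have "\<bar>K (x - y)\<bar> \<le> B" by (intro B) (use norm_triangle_ineq4[of x y] in auto)
        then have "\<bar>K (x - y)\<bar> \<le> \<bar>B\<bar>" by linarith
        then show ?thesis by (simp add: abs_mult mult_right_mono)
      qed (simp add: supp)
    qed
  qed measurable
qed

text \<open>Differentiation under the integral sign. As \<open>U\<close> has bounded support, only arguments of \<open>K'\<close> in a
compact set matter as long as \<open>x\<close> varies in a bounded set, and there \<open>K'\<close> is uniformly continuous.\<close>

lemma conv_has_derivative:
  fixes U :: "'a::euclidean_space \<Rightarrow> real" and K :: "'a \<Rightarrow> real" and K' :: "'a \<Rightarrow> 'a"
  assumes U: "integrable lborel U" and supp: "\<And>y. y \<notin> cball 0 R \<Longrightarrow> U y = 0"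
    and D: "\<And>z. (K has_derivative (\<lambda>h. K' z \<bullet> h)) (at z)" and C: "continuous_on UNIV K'"
  defines "g \<equiv> \<lambda>x. LINT y|lborel. U y *\<^sub>R K' (x - y)"
  shows "(conv U K has_derivative (\<lambda>h. g x \<bullet> h)) (at x)" and "isCont g x"
    and "\<And>b. g x \<bullet> b = conv U (\<lambda>z. K' z \<bullet> b) x"
proof -
  have CK: "continuous_on UNIV K"
    using D by (auto simp: continuous_on_eq_continuous_at intro: has_derivative_continuous)
  have iK: "integrable lborel (\<lambda>y. K (x - y) *\<^sub>R U y)" for x
    by (rule integrable_conv[OF U supp CK])
  have iKb: "integrable lborel (\<lambda>y. (K' (x - y) \<bullet> b) *\<^sub>R U y)" for x b
    by (rule integrable_conv[OF U supp]) (auto intro!: continuous_intros C)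
  have iK': "integrable lborel (\<lambda>y. U y *\<^sub>R K' (x - y))" for x
  proof -
    have "integrable lborel (\<lambda>y. \<Sum>b\<in>Basis. ((K' (x - y) \<bullet> b) *\<^sub>R U y) *\<^sub>R b)"
      by (intro Bochner_Integration.integrable_sum integrable_scaleR_left impI iKb)
    also have "(\<lambda>y. \<Sum>b\<in>Basis. ((K' (x - y) \<bullet> b) *\<^sub>R U y) *\<^sub>R b) = (\<lambda>y. U y *\<^sub>R K' (x - y))"
    proof
      fix y
      have "(\<Sum>b\<in>Basis. ((K' (x - y) \<bullet> b) *\<^sub>R U y) *\<^sub>R b) = U y *\<^sub>R (\<Sum>b\<in>Basis. (K' (x - y) \<bullet> b) *\<^sub>R b)"
        by (simp add: scaleR_sum_right mult.commute)
      then show "(\<Sum>b\<in>Basis. ((K' (x - y) \<bullet> b) *\<^sub>R U y) *\<^sub>R b) = U y *\<^sub>R K' (x - y)"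
        by (simp add: euclidean_representation)
    qed
    finally show ?thesis .
  qed
  show gb: "g x \<bullet> b = conv U (\<lambda>z. K' z \<bullet> b) x" for x b
    using integral_inner_left[of b lborel "\<lambda>y. U y *\<^sub>R K' (x - y)"] iK'
    by (simp add: g_def conv_def mult.commute)
  \<comment> \<open>The summand \<open>1\<close> keeps \<open>M\<close> positive when \<open>U\<close> vanishes.\<close>
  define M where "M = (LINT y|lborel. norm (U y)) + 1"
  have M: "M > 0" by (simp add: M_def add_nonneg_pos)
  have unif: "\<exists>d>0. \<forall>x'. dist x' x < d \<longrightarrow> (\<forall>y\<in>cball (0::'a) R. norm (K' (x' - y) - K' (x - y)) \<le> e)" if "e > 0" for e
  proof -
    have "uniformly_continuous_on (cball 0 (norm x + R + 1)) K'"
      by (intro compact_uniformly_continuous continuous_on_subset[OF C]) auto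
    then have "\<exists>d>0. \<forall>z\<in>cball 0 (norm x + R + 1). \<forall>z'\<in>cball 0 (norm x + R + 1). dist z' z < d \<longrightarrow> dist (K' z') (K' z) < e"
      using that unfolding uniformly_continuous_on_def by blast
    then obtain d where d: "d > 0" "\<And>z z'. z \<in> cball 0 (norm x + R + 1) \<Longrightarrow> z' \<in> cball 0 (norm x + R + 1)
        \<Longrightarrow> dist z' z < d \<Longrightarrow> dist (K' z') (K' z) < e"
      by blast
    show ?thesis
    proof (intro exI[of _ "min d 1"] conjI allI impI ballI)
      fix x' y :: 'a assume x': "dist x' x < min d 1" and y: "y \<in> cball 0 R"
      have "norm x' < norm x + 1" using x' norm_triangle_sub[of x' x] by (simp add: dist_norm)
      then have "dist (K' (x' - y)) (K' (x - y)) < e"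
        using x' y norm_triangle_ineq4[of x' y] norm_triangle_ineq4[of x y]
        by (intro d) (auto simp: dist_norm norm_minus_commute[of y])
      then show "norm (K' (x' - y) - K' (x - y)) \<le> e" by (simp add: dist_norm)
    qed (use d in auto)
  qed
  show "isCont g x"
    unfolding continuous_at_eps_delta dist_norm
  proof (intro allI impI)
    fix e :: real assume "e > 0"
    then obtain d where d: "d > 0" "\<And>x' y. dist x' x < d \<Longrightarrow> y \<in> cball 0 R \<Longrightarrow> norm (K' (x' - y) - K' (x - y)) \<le> e / M"
      using unif[of "e / M"] M by auto
    show "\<exists>d>0. \<forall>x'. norm (x' - x) < d \<longrightarrow> norm (g x' - g x) < e"
    proof (intro exI[of _ d] conjI d(1) allI impI)
      fix x' assume x': "norm (x' - x) < d"
      have "norm (g x' - g x) = norm (LINT y|lborel. U y *\<^sub>R (K' (x' - y) - K' (x - y)))"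
        using iK' by (simp add: g_def scaleR_diff_right)
      also have "\<dots> \<le> (LINT y|lborel. norm (U y *\<^sub>R (K' (x' - y) - K' (x - y))))"
        by (rule integral_norm_bound)
      also have "\<dots> \<le> (LINT y|lborel. norm (U y) * (e / M))"
      proof (rule integral_mono)
        show "integrable lborel (\<lambda>y. norm (U y *\<^sub>R (K' (x' - y) - K' (x - y))))"
          unfolding scaleR_diff_right using iK' by (intro integrable_norm Bochner_Integration.integrable_diff)
        show "integrable lborel (\<lambda>y. norm (U y) * (e / M))" using U by auto
        fix y
        show "norm (U y *\<^sub>R (K' (x' - y) - K' (x - y))) \<le> norm (U y) * (e / M)"
        proof (cases "y \<in> cball 0 R")
          case True
          then have "norm (K' (x' - y) - K' (x - y)) \<le> e / M" using x' by (intro d) (auto simp: dist_norm)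
          then show ?thesis unfolding norm_scaleR real_norm_def by (rule mult_left_mono) simp
        qed (simp add: supp)
      qed
      also have "\<dots> = (M - 1) * (e / M)" by (simp add: M_def)
      also have "\<dots> < e" using \<open>e > 0\<close> M by (simp add: field_simps)
      finally show "norm (g x' - g x) < e" .
    qed
  qed
  show "(conv U K has_derivative (\<lambda>h. g x \<bullet> h)) (at x)"
    unfolding has_derivative_at_alt
  proof (intro conjI allI impI)
    show "bounded_linear ((\<bullet>) (g x))" by (rule bounded_linear_inner_right)
    fix e :: real assume "e > 0"
    then obtain d where d: "d > 0" "\<And>x' y. dist x' x < d \<Longrightarrow> y \<in> cball 0 R \<Longrightarrow> norm (K' (x' - y) - K' (x - y)) \<le> e / M"
      using unif[of "e / M"] M by auto
    show "\<exists>d>0. \<forall>x'. norm (x' - x) < d \<longrightarrow> norm (conv U K x' - conv U K x - g x \<bullet> (x' - x)) \<le> e * norm (x' - x)"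
    proof (intro exI[of _ d] conjI d(1) allI impI)
      fix x' assume x': "norm (x' - x) < d"
      define h where "h = x' - x"
      define E where "E y = K (x' - y) - K (x - y) - K' (x - y) \<bullet> h" for y
      have E: "\<bar>E y\<bar> \<le> e / M * norm h" if y: "y \<in> cball 0 R" for y
      proof -
        have "\<exists>t\<in>{0<..<1}. K (x - y + 1 *\<^sub>R h) - K (x - y + 0 *\<^sub>R h) = (\<lambda>s. K' (x - y + t *\<^sub>R h) \<bullet> (s *\<^sub>R h)) (1 - 0)"
        proof (rule mvt_simple)
          fix t :: real
          have "((\<lambda>t. x - y + t *\<^sub>R h) has_derivative (\<lambda>s. s *\<^sub>R h)) (at t within {0..1})"
            by (auto intro!: derivative_eq_intros)
          from has_derivative_compose[OF this D]
          show "((\<lambda>t. K (x - y + t *\<^sub>R h)) has_derivative (\<lambda>s. K' (x - y + t *\<^sub>R h) \<bullet> (s *\<^sub>R h))) (at t within {0..1})" .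
        qed auto
        then obtain t where t: "t \<in> {0<..<1}" "K (x' - y) - K (x - y) = K' (x + t *\<^sub>R h - y) \<bullet> h"
          by (auto simp: h_def algebra_simps)
        have "dist (x + t *\<^sub>R h) x < d"
          using t(1) x' mult_right_mono[of t 1 "norm h"] by (auto simp: dist_norm h_def)
        then have "norm (K' (x + t *\<^sub>R h - y) - K' (x - y)) \<le> e / M" using y by (rule d(2))
        moreover have "E y = (K' (x + t *\<^sub>R h - y) - K' (x - y)) \<bullet> h"
          by (simp add: E_def t inner_diff_left)
        ultimately show ?thesis
          using Cauchy_Schwarz_ineq2[of "K' (x + t *\<^sub>R h - y) - K' (x - y)" h]
          by (smt (verit) mult_right_mono norm_ge_zero)
      qed
      have iE: "integrable lborel (\<lambda>y. E y *\<^sub>R U y)"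
        unfolding E_def scaleR_diff_left using iK iKb by (intro Bochner_Integration.integrable_diff)
      have "conv U K x' - conv U K x - g x \<bullet> h = (LINT y|lborel. E y *\<^sub>R U y)"
        unfolding gb unfolding E_def scaleR_diff_left conv_def
        using iK iKb by (simp add: Bochner_Integration.integrable_diff)
      then have "norm (conv U K x' - conv U K x - g x \<bullet> h) \<le> (LINT y|lborel. norm (E y *\<^sub>R U y))"
        by (simp only: integral_norm_bound)
      also have "\<dots> \<le> (LINT y|lborel. e / M * norm h * norm (U y))"
      proof (rule integral_mono)
        fix y
        show "norm (E y *\<^sub>R U y) \<le> e / M * norm h * norm (U y)"
        proof (cases "y \<in> cball 0 R")
          case True
          from E[OF this] show ?thesis unfolding real_scaleR_def real_norm_def abs_mult by (rule mult_right_mono) simp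
        qed (simp add: supp)
      qed (use iE U in \<open>auto intro!: integrable_norm\<close>)
      also have "\<dots> = (M - 1) * (e / M) * norm h" by (simp add: M_def)
      also have "\<dots> \<le> e * norm h" using \<open>e > 0\<close> M by (intro mult_right_mono) (auto simp: field_simps)
      finally show "norm (conv U K x' - conv U K x - g x \<bullet> (x' - x)) \<le> e * norm (x' - x)"
        by (simp add: h_def)
    qed
  qed
qed

text \<open>Jensen's inequality for the power \<open>p\<close> and a weight \<open>r\<close> of total mass at most one: the tangent of \<open>t powr p\<close> at the
mean \<open>a\<close> lies below the graph, and this inequality is integrated.\<close>

lemma Jensen_powr:
  fixes f r :: "'x \<Rightarrow> real"
  assumes i: "integrable M (\<lambda>x. r x * f x)" and [measurable]: "f \<in> borel_measurable M" "r \<in> borel_measurable M"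
    and nn: "\<And>x. f x \<ge> 0" "\<And>x. r x \<ge> 0" and r: "(\<integral>\<^sup>+x. ennreal (r x) \<partial>M) \<le> 1" and p: "p \<ge> 1"
  shows "ennreal ((LINT x|M. r x * f x) powr p) \<le> (\<integral>\<^sup>+x. ennreal (r x * f x powr p) \<partial>M)"
proof -
  define a where "a = (LINT x|M. r x * f x)"
  have a0: "a \<ge> 0" unfolding a_def by (intro integral_nonneg_AE AE_I2 mult_nonneg_nonneg nn)
  show ?thesis
  proof (cases "a = 0 \<or> (\<integral>\<^sup>+x. ennreal (r x * f x powr p) \<partial>M) = top")
    case True
    then show ?thesis by (auto simp flip: a_def)
  next
    case False
    then obtain X where X: "X \<ge> 0" "(\<integral>\<^sup>+x. ennreal (r x * f x powr p) \<partial>M) = ennreal X"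
      by (metis ennreal_cases)
    have a: "a > 0" using False a0 by auto
    define b where "b = a powr (p - 1)"
    have b: "b > 0" "a powr p = b * a" using a by (auto simp: b_def powr_mult_base mult.commute)
    have young: "p * b * t \<le> t powr p + (p - 1) * (b * a)" if "t \<ge> 0" for t
    proof (cases "t = 0")
      case True
      then show ?thesis using p b a by simp
    next
      case False
      then have "(t powr p) powr (1 / p) * (a powr p) powr (1 - 1 / p) \<le> 1 / p * t powr p + (1 - 1 / p) * a powr p"
        using that p a by (intro Youngs_inequality_0) auto
      moreover have "(t powr p) powr (1 / p) = t" "(a powr p) powr (1 - 1 / p) = b"
        using p that by (auto simp: powr_powr b_def algebra_simps)
      ultimately have "p * (t * b) \<le> p * (1 / p * t powr p + (1 - 1 / p) * a powr p)"
        using p by (intro mult_left_mono) auto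
      also have "\<dots> = t powr p + (p - 1) * a powr p" using p by (simp add: field_simps)
      finally show ?thesis by (simp add: b(2) mult_ac)
    qed
    have "ennreal (p * b * a) = ennreal (p * b) * (\<integral>\<^sup>+x. ennreal (r x * f x) \<partial>M)"
      using i nn p b a by (subst nn_integral_eq_integral) (auto simp: a_def[symmetric] ennreal_mult[symmetric])
    also have "\<dots> = (\<integral>\<^sup>+x. ennreal (p * b) * ennreal (r x * f x) \<partial>M)"
      by (rule nn_integral_cmult[symmetric]) measurable
    also have "\<dots> \<le> (\<integral>\<^sup>+x. ennreal (r x * f x powr p) + ennreal ((p - 1) * (b * a)) * ennreal (r x) \<partial>M)"
    proof (rule nn_integral_mono)
      fix x
      have "r x * (p * b * f x) \<le> r x * (f x powr p + (p - 1) * (b * a))"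
        by (intro mult_left_mono young nn)
      then have "p * b * (r x * f x) \<le> r x * f x powr p + (p - 1) * (b * a) * r x"
        by (simp add: algebra_simps)
      then show "ennreal (p * b) * ennreal (r x * f x) \<le> ennreal (r x * f x powr p) + ennreal ((p - 1) * (b * a)) * ennreal (r x)"
        using nn[of x] p b(1) a by (simp add: ennreal_mult[symmetric] ennreal_plus[symmetric] ennreal_leI del: ennreal_plus)
    qed
    also have "\<dots> = ennreal X + ennreal ((p - 1) * (b * a)) * (\<integral>\<^sup>+x. ennreal (r x) \<partial>M)"
      by (simp add: nn_integral_add nn_integral_cmult X)
    also have "\<dots> \<le> ennreal X + ennreal ((p - 1) * (b * a)) * 1"
      by (intro add_mono mult_left_mono r) auto
    also have "\<dots> = ennreal (X + (p - 1) * (b * a))"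
      using X(1) p b(1) a by (simp add: ennreal_plus[symmetric] del: ennreal_plus)
    finally have "p * b * a \<le> X + (p - 1) * (b * a)"
      using X(1) p b(1) a by (subst (asm) ennreal_le_iff) auto
    then have "a powr p \<le> X" by (simp add: b(2) algebra_simps)
    then show ?thesis by (simp add: X(2) ennreal_leI flip: a_def)
  qed
qed

lemma nn_integral_lborel_reflect:
  fixes f :: "'a::euclidean_space \<Rightarrow> ennreal"
  assumes [measurable]: "f \<in> borel_measurable borel"
  shows "(\<integral>\<^sup>+y. f (x - y) \<partial>lborel) = (\<integral>\<^sup>+y. f y \<partial>lborel)"
proof -
  have "(\<integral>\<^sup>+y. f y \<partial>lborel) = (\<integral>\<^sup>+y. f y \<partial>(density (distr lborel borel (\<lambda>y. x + (-1) *\<^sub>R y)) (\<lambda>_. 1)))"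
    using lborel_affine[of "-1" x] by simp
  then show ?thesis by (simp add: density_1 nn_integral_distr)
qed

lemma nn_integral_lborel_shift:
  fixes f :: "'a::euclidean_space \<Rightarrow> ennreal"
  assumes [measurable]: "f \<in> borel_measurable borel"
  shows "(\<integral>\<^sup>+x. f (x - y) \<partial>lborel) = (\<integral>\<^sup>+x. f x \<partial>lborel)"
proof -
  have "(\<integral>\<^sup>+x. f x \<partial>lborel) = (\<integral>\<^sup>+x. f x \<partial>distr lborel borel ((+) (- y)))"
    by (simp add: lborel_distr_plus)
  then show ?thesis by (simp add: nn_integral_distr)
qed

text \<open>Convolution with a kernel of mass at most one does not increase the \<open>L\<^sup>p\<close> norm: Jensen's inequality at each
point, then Fubini's theorem.\<close>

lemma nn_integral_conv_powr_le:
  fixes U :: "'a::euclidean_space \<Rightarrow> 'b::euclidean_space" and K :: "'a \<Rightarrow> real"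
  assumes U: "integrable lborel U" and supp: "\<And>y. y \<notin> cball 0 R \<Longrightarrow> U y = 0"
    and K: "continuous_on UNIV K" "\<And>z. K z \<ge> 0" "(\<integral>\<^sup>+z. ennreal (K z) \<partial>lborel) \<le> 1" and p: "p \<ge> 1"
  shows "(\<integral>\<^sup>+x. ennreal (norm (conv U K x) powr p) \<partial>lborel) \<le> (\<integral>\<^sup>+y. ennreal (norm (U y) powr p) \<partial>lborel)"
proof -
  have [measurable]: "U \<in> borel_measurable borel" using U by auto
  have [measurable]: "K \<in> borel_measurable borel" using K(1) by (rule borel_measurable_continuous_onI)
  have "ennreal (norm (conv U K x) powr p) \<le> (\<integral>\<^sup>+y. ennreal (K (x - y) * norm (U y) powr p) \<partial>lborel)" for x
  proof -
    have "norm (conv U K x) \<le> (LINT y|lborel. norm (K (x - y) *\<^sub>R U y))"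
      unfolding conv_def by (rule integral_norm_bound)
    also have "\<dots> = (LINT y|lborel. K (x - y) * norm (U y))" using K(2) by simp
    finally have "ennreal (norm (conv U K x) powr p) \<le> ennreal ((LINT y|lborel. K (x - y) * norm (U y)) powr p)"
      using p by (intro ennreal_leI powr_mono2) auto
    also have "\<dots> \<le> (\<integral>\<^sup>+y. ennreal (K (x - y) * norm (U y) powr p) \<partial>lborel)"
    proof (rule Jensen_powr)
      show "integrable lborel (\<lambda>y. K (x - y) * norm (U y))"
        using integrable_norm[OF integrable_conv[OF U supp K(1)]] K(2) by simp
      show "(\<integral>\<^sup>+y. ennreal (K (x - y)) \<partial>lborel) \<le> 1"
        using K(3) by (simp add: nn_integral_lborel_reflect[where f = "\<lambda>z. ennreal (K z)"])
    qed (use K p in auto)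
    finally show ?thesis .
  qed
  then have "(\<integral>\<^sup>+x. ennreal (norm (conv U K x) powr p) \<partial>lborel)
     \<le> (\<integral>\<^sup>+x. (\<integral>\<^sup>+y. ennreal (K (x - y) * norm (U y) powr p) \<partial>lborel) \<partial>lborel)"
    by (intro nn_integral_mono)
  also have "\<dots> = (\<integral>\<^sup>+y. (\<integral>\<^sup>+x. ennreal (K (x - y) * norm (U y) powr p) \<partial>lborel) \<partial>lborel)"
    by (rule lborel_pair.Fubini') measurable
  also have "\<dots> = (\<integral>\<^sup>+y. (\<integral>\<^sup>+x. ennreal (K (x - y)) \<partial>lborel) * ennreal (norm (U y) powr p) \<partial>lborel)"
    using K(2) by (simp add: ennreal_mult nn_integral_multc)
  also have "\<dots> \<le> (\<integral>\<^sup>+y. 1 * ennreal (norm (U y) powr p) \<partial>lborel)"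
    using K(3) by (intro nn_integral_mono mult_right_mono) (auto simp: nn_integral_lborel_shift[where f = "\<lambda>z. ennreal (K z)"])
  finally show ?thesis by simp
qed

text \<open>Continuous functions are dense in \<open>L\<^sup>1\<close> of a compact set. A measurable function is almost everywhere a limit
of continuous functions; after truncation at height \<open>M\<close> dominated convergence applies.\<close>

lemma integrable_approx_continuous:
  fixes U :: "'a::euclidean_space \<Rightarrow> real"
  assumes U: "integrable lborel U" and S: "compact S" and "e > 0"
  shows "\<exists>h. continuous_on UNIV h \<and> (\<integral>\<^sup>+x. ennreal (indicator S x * \<bar>U x - h x\<bar>) \<partial>lborel) \<le> ennreal e"
proof -
  have [measurable]: "U \<in> borel_measurable borel" using U by auto
  have [measurable]: "S \<in> sets borel" using S by (simp add: borel_compact)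
  have emS: "emeasure lborel S < \<infinity>" using S by (intro emeasure_bounded_finite compact_imp_bounded)
  define clip where "clip M t = max (- M) (min M t)" for M t :: real
  have "(\<lambda>n. LINT x|lborel. \<bar>U x - clip (real n) (U x)\<bar>) \<longlonglongrightarrow> (LINT x|(lborel :: 'a measure). 0)"
  proof (rule integral_dominated_convergence[where w = "\<lambda>x. \<bar>U x\<bar>"])
    show "AE x in lborel. (\<lambda>n. \<bar>U x - clip (real n) (U x)\<bar>) \<longlonglongrightarrow> 0"
    proof (rule AE_I2)
      fix x
      have "\<forall>\<^sub>F n in sequentially. \<bar>U x - clip (real n) (U x)\<bar> = 0"
        using eventually_ge_at_top[of "nat \<lceil>\<bar>U x\<bar>\<rceil>"]
      proof eventually_elim
        case (elim n)
        then have "\<bar>U x\<bar> \<le> real n" by linarith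
        then show ?case by (auto simp: clip_def)
      qed
      then show "(\<lambda>n. \<bar>U x - clip (real n) (U x)\<bar>) \<longlonglongrightarrow> 0"
        by (rule tendsto_eventually)
    qed
    show "AE x in lborel. norm \<bar>U x - clip (real n) (U x)\<bar> \<le> \<bar>U x\<bar>" for n
      by (rule AE_I2) (auto simp: clip_def)
  qed (use U in \<open>auto simp: clip_def\<close>)
  then have "\<forall>\<^sub>F n in sequentially. (LINT x|lborel. \<bar>U x - clip (real n) (U x)\<bar>) < e / 2"
    using \<open>e > 0\<close> by (intro order_tendstoD) auto
  then obtain n where n: "(LINT x|lborel. \<bar>U x - clip (real n) (U x)\<bar>) < e / 2"
    by (auto simp: eventually_sequentially)
  define M where "M = real n"
  have clipM: "\<bar>clip M t\<bar> \<le> M" for t by (simp add: clip_def M_def)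
  have iclip: "integrable lborel (\<lambda>x. \<bar>U x - clip M (U x)\<bar>)"
    by (rule Bochner_Integration.integrable_bound[OF U]) (auto simp: clip_def M_def)
  have "U \<in> borel_measurable lebesgue" by (rule measurable_completion) simp
  then have "U measurable_on UNIV"
    by (rule lebesgue_measurable_imp_measurable_on) auto
  then obtain N g where N: "negligible N" and g: "\<And>n. continuous_on UNIV (g n)"
      and lim: "\<And>x. x \<notin> N \<Longrightarrow> (\<lambda>n. g n x) \<longlonglongrightarrow> U x"
    unfolding measurable_on_def by auto
  have gm [measurable]: "g n \<in> borel_measurable borel" for n using g by (rule borel_measurable_continuous_onI)
  have "AE x in lebesgue. x \<notin> N" using N by (intro AE_not_in) (simp add: negligible_iff_null_sets)
  then have AEN: "AE x in lborel. x \<notin> N" by (simp add: AE_completion_iff)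
  have "(\<lambda>n. LINT x|lborel. indicator S x * \<bar>clip M (U x) - clip M (g n x)\<bar>) \<longlonglongrightarrow> (LINT x|(lborel :: 'a measure). 0)"
  proof (rule integral_dominated_convergence[where w = "\<lambda>x. indicator S x * (2 * M)"])
    show "AE x in lborel. (\<lambda>n. indicator S x * \<bar>clip M (U x) - clip M (g n x)\<bar>) \<longlonglongrightarrow> 0"
      using AEN
    proof eventually_elim
      case (elim x)
      have "(\<lambda>n. indicator S x * \<bar>clip M (U x) - clip M (g n x)\<bar>) \<longlonglongrightarrow> indicator S x * \<bar>clip M (U x) - clip M (U x)\<bar>"
        unfolding clip_def by (intro tendsto_intros lim elim)
      then show ?case by simp
    qed
    show "AE x in lborel. norm (indicator S x * \<bar>clip M (U x) - clip M (g n x)\<bar>) \<le> indicator S x * (2 * M)" for n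
    proof (rule AE_I2)
      fix x
      show "norm (indicator S x * \<bar>clip M (U x) - clip M (g n x)\<bar>) \<le> indicator S x * (2 * M)"
        using clipM[of "U x"] clipM[of "g n x"] by (auto simp: indicator_def)
    qed
    have "integrable lborel (indicator S :: _ \<Rightarrow> real)" using emS by (intro integrable_real_indicator) auto
    then show "integrable lborel (\<lambda>x. indicator S x * (2 * M))" by (rule integrable_mult_left)
  qed (auto simp: clip_def)
  then have "\<forall>\<^sub>F n in sequentially. (LINT x|lborel. indicator S x * \<bar>clip M (U x) - clip M (g n x)\<bar>) < e / 2"
    using \<open>e > 0\<close> by (intro order_tendstoD) auto
  then obtain k where k: "(LINT x|lborel. indicator S x * \<bar>clip M (U x) - clip M (g k x)\<bar>) < e / 2"
    by (auto simp: eventually_sequentially)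
  have ik: "integrable lborel (\<lambda>x. indicator S x * \<bar>clip M (U x) - clip M (g k x)\<bar>)"
  proof (rule Bochner_Integration.integrable_bound)
    have "integrable lborel (indicator S :: _ \<Rightarrow> real)" using emS by (intro integrable_real_indicator) auto
    then show "integrable lborel (\<lambda>x. indicator S x * (2 * M))" by (rule integrable_mult_left)
    show "AE x in lborel. norm (indicator S x * \<bar>clip M (U x) - clip M (g k x)\<bar>) \<le> norm (indicator S x * (2 * M))"
    proof (rule AE_I2)
      fix x
      show "norm (indicator S x * \<bar>clip M (U x) - clip M (g k x)\<bar>) \<le> norm (indicator S x * (2 * M))"
        using clipM[of "U x"] clipM[of "g k x"] by (auto simp: indicator_def)
    qed
  qed (auto simp: clip_def)
  have "(\<integral>\<^sup>+x. ennreal (indicator S x * \<bar>U x - clip M (g k x)\<bar>) \<partial>lborel)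
     \<le> (\<integral>\<^sup>+x. ennreal (\<bar>U x - clip M (U x)\<bar> + indicator S x * \<bar>clip M (U x) - clip M (g k x)\<bar>) \<partial>lborel)"
    by (intro nn_integral_mono ennreal_leI) (auto simp: indicator_def)
  also have "\<dots> = ennreal (LINT x|lborel. \<bar>U x - clip M (U x)\<bar> + indicator S x * \<bar>clip M (U x) - clip M (g k x)\<bar>)"
    by (intro nn_integral_eq_integral Bochner_Integration.integrable_add iclip ik) auto
  also have "\<dots> \<le> ennreal e"
    using n k by (intro ennreal_leI, subst Bochner_Integration.integral_add[OF iclip ik]) (simp add: M_def)
  finally show ?thesis
    by (intro exI[of _ "\<lambda>x. clip M (g k x)"] conjI) (auto simp: clip_def intro!: continuous_intros g)
qed

text \<open>Convergence in \<open>L\<^sup>1(S)\<close> yields an almost everywhere convergent subsequence. For the former, \<open>U\<close> is replaced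
by a continuous \<open>h\<close> near it in \<open>L\<^sup>1(S')\<close>: the mollification of the difference stays small in \<open>L\<^sup>1\<close>, and the
mollification of \<open>h\<close> converges uniformly. The larger set \<open>S'\<close> contains all points at which \<open>U\<close> is evaluated when
\<open>x\<close> is in \<open>S\<close>.\<close>

lemma conv_AE_subseq:
  fixes U :: "'a::euclidean_space \<Rightarrow> real" and K :: "nat \<Rightarrow> 'a \<Rightarrow> real"
  assumes U: "integrable lborel U" and S': "compact S'" "\<And>y. y \<notin> S' \<Longrightarrow> U y = 0" and S: "compact S" "S \<subseteq> S'"
    and K: "\<And>n. continuous_on UNIV (K n)" "\<And>n z. K n z \<ge> 0" "\<And>n. integrable lborel (K n)" "\<And>n. (LINT z|lborel. K n z) = 1"
    and Ksupp: "\<And>n x y. x \<in> S \<Longrightarrow> K n (x - y) \<noteq> 0 \<Longrightarrow> y \<in> S' \<and> norm (x - y) < \<epsilon> n" and \<epsilon>: "\<epsilon> \<longlonglongrightarrow> 0"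
  shows "\<exists>r. strict_mono r \<and> (AE x in lborel. x \<in> S \<longrightarrow> (\<lambda>n. conv U (K (r n)) x) \<longlonglongrightarrow> U x)"
proof -
  have [measurable]: "U \<in> borel_measurable borel" using U by auto
  have [measurable]: "K n \<in> borel_measurable borel" for n using K(1) by (rule borel_measurable_continuous_onI)
  have [measurable]: "S \<in> sets borel" "S' \<in> sets borel" using S S' by (auto simp: borel_compact)
  obtain R where R: "S' \<subseteq> cball 0 R" using compact_imp_bounded[OF S'(1)] by (auto simp: bounded_iff subset_iff)
  have K1: "(\<integral>\<^sup>+z. ennreal (K n z) \<partial>lborel) = 1" for n
    using K by (subst nn_integral_eq_integral) auto
  have bound: "(\<integral>\<^sup>+x. ennreal \<bar>conv V (K n) x\<bar> \<partial>lborel) \<le> (\<integral>\<^sup>+y. ennreal \<bar>V y\<bar> \<partial>lborel)"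
    if "integrable lborel V" "\<And>y. y \<notin> S' \<Longrightarrow> V y = 0" for V :: "'a \<Rightarrow> real" and n
  proof -
    have "V y = 0" if "y \<notin> cball 0 R" for y using that R \<open>\<And>y. y \<notin> S' \<Longrightarrow> V y = 0\<close> by blast
    from nn_integral_conv_powr_le[OF that(1) this K(1)[of n] K(2)[of n], of R 1] K1[of n] show ?thesis by simp
  qed
  have convm [measurable]: "conv V (K n) \<in> borel_measurable borel" if [measurable]: "V \<in> borel_measurable borel" for V :: "'a \<Rightarrow> real" and n
    unfolding conv_def by measurable
  have iconv: "integrable lborel (conv V (K n))"
    if "integrable lborel V" "\<And>y. y \<notin> S' \<Longrightarrow> V y = 0" for V :: "'a \<Rightarrow> real" and n
  proof (rule integrableI_bounded)
    have [measurable]: "V \<in> borel_measurable borel" using that by auto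
    show "conv V (K n) \<in> borel_measurable lborel" by measurable
    have "(\<integral>\<^sup>+y. ennreal \<bar>V y\<bar> \<partial>lborel) < \<infinity>" using that(1) by (simp add: integrable_iff_bounded)
    then show "(\<integral>\<^sup>+x. ennreal (norm (conv V (K n) x)) \<partial>lborel) < \<infinity>"
      using le_less_trans[OF bound[OF that]] by simp
  qed
  have inS: "integrable lborel (\<lambda>x. indicator S x * (conv U (K n) x - U x))" for n
  proof (rule Bochner_Integration.integrable_bound)
    show "integrable lborel (\<lambda>x. conv U (K n) x - U x)"
      by (intro Bochner_Integration.integrable_diff iconv U S')
  qed (auto simp: indicator_def)
  have "(\<lambda>n. LINT x|lborel. norm (indicator S x * (conv U (K n) x - U x))) \<longlonglongrightarrow> 0"
  proof (rule LIMSEQ_I)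
    fix e :: real assume "e > 0"
    define m where "m = measure lborel S"
    have m: "m \<ge> 0" "emeasure lborel S = ennreal m"
      using emeasure_bounded_finite[OF compact_imp_bounded[OF S(1)]]
      by (auto simp: m_def intro!: emeasure_eq_ennreal_measure)
    \<comment> \<open>The allowed oscillation of \<open>h\<close>, chosen so that it contributes less than \<open>e / 3\<close> over \<open>S\<close>.\<close>
    define w where "w = e / (4 * (m + 1))"
    have w: "w > 0" "w * m < e / 3" using \<open>e > 0\<close> m by (auto simp: w_def field_simps add_nonneg_pos)
    obtain h where h: "continuous_on UNIV h" "(\<integral>\<^sup>+x. ennreal (indicator S' x * \<bar>U x - h x\<bar>) \<partial>lborel) \<le> ennreal (e / 4)"
      using integrable_approx_continuous[OF U S'(1), of "e / 4"] \<open>e > 0\<close> by auto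
    have [measurable]: "h \<in> borel_measurable borel" using h(1) by (rule borel_measurable_continuous_onI)
    define V where "V x = indicator S' x * h x" for x
    have V: "integrable lborel V" "\<And>y. y \<notin> S' \<Longrightarrow> V y = 0"
      using borel_integrable_compact[OF S'(1) continuous_on_subset[OF h(1) subset_UNIV]] by (auto simp: V_def[abs_def])
    have UV: "\<bar>U x - V x\<bar> = indicator S' x * \<bar>U x - h x\<bar>" for x
      using S'(2)[of x] by (auto simp: V_def indicator_def)
    have "uniformly_continuous_on S' h"
      by (intro compact_uniformly_continuous continuous_on_subset[OF h(1)] S') auto
    then have "\<exists>d>0. \<forall>x\<in>S'. \<forall>x'\<in>S'. dist x' x < d \<longrightarrow> dist (h x') (h x) < w"
      using w(1) unfolding uniformly_continuous_on_def by blast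
    then obtain d where d: "d > 0" "\<And>x x'. x \<in> S' \<Longrightarrow> x' \<in> S' \<Longrightarrow> dist x' x < d \<Longrightarrow> dist (h x') (h x) < w"
      by blast
    obtain n0 where n0: "\<And>n. n \<ge> n0 \<Longrightarrow> \<epsilon> n < d"
      using order_tendstoD(2)[OF \<epsilon> d(1)] by (auto simp: eventually_sequentially)
    have "norm ((LINT x|lborel. norm (indicator S x * (conv U (K n) x - U x))) - 0) < e" if n: "n \<ge> n0" for n
    proof -
      have mid: "\<bar>conv V (K n) x - h x\<bar> \<le> w" if x: "x \<in> S" for x
      proof -
        have iVx: "integrable lborel (\<lambda>y. K n (x - y) *\<^sub>R V y)"
          by (rule integrable_conv[OF V(1) _ K(1), of R]) (use V(2) R in blast)
        have iKx: "integrable lborel (\<lambda>y. K n (x - y))" and Kx1: "(LINT y|lborel. K n (x - y)) = 1"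
        proof -
          have nn: "(\<integral>\<^sup>+y. ennreal (K n (x - y)) \<partial>lborel) = ennreal 1"
            using K1[of n] by (simp add: nn_integral_lborel_reflect[where f = "\<lambda>z. ennreal (K n z)"])
          show "integrable lborel (\<lambda>y. K n (x - y))"
            using nn K(2) by (intro integrableI_nonneg) auto
          show "(LINT y|lborel. K n (x - y)) = 1"
            using nn K(2) by (intro integral_eq_nn_integral[THEN trans]) auto
        qed
        have "conv V (K n) x - h x = (LINT y|lborel. K n (x - y) * V y - K n (x - y) * h x)"
          using iVx iKx Kx1 by (simp add: conv_def)
        also have "\<bar>\<dots>\<bar> \<le> (LINT y|lborel. \<bar>K n (x - y) * V y - K n (x - y) * h x\<bar>)"
          by (rule integral_abs_bound)
        also have "\<dots> \<le> (LINT y|lborel. K n (x - y) * w)"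
        proof (rule integral_mono)
          fix y
          show "\<bar>K n (x - y) * V y - K n (x - y) * h x\<bar> \<le> K n (x - y) * w"
          proof (cases "K n (x - y) = 0")
            case False
            then have y: "y \<in> S'" "norm (x - y) < d" using Ksupp[OF x, of n y] n0[OF n] by auto
            then have "\<bar>V y - h x\<bar> \<le> w"
              using d(2)[of x y] x S(2) by (auto simp: V_def dist_norm norm_minus_commute)
            then have "K n (x - y) * \<bar>V y - h x\<bar> \<le> K n (x - y) * w" by (intro mult_left_mono K)
            then show ?thesis using K(2)[of n "x - y"] by (simp add: abs_mult flip: right_diff_distrib)
          qed simp
        qed (use iVx iKx in auto)
        also have "\<dots> = w" using Kx1 by simp
        finally show ?thesis .
      qed
      have split: "conv U (K n) x = conv (\<lambda>y. U y - V y) (K n) x + conv V (K n) x" for x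
      proof -
        have "integrable lborel (\<lambda>y. K n (x - y) *\<^sub>R V y)" "integrable lborel (\<lambda>y. K n (x - y) *\<^sub>R U y)"
          by (rule integrable_conv[OF V(1) _ K(1), of R], use V(2) R in blast)
             (rule integrable_conv[OF U _ K(1), of R], use S'(2) R in blast)
        then show ?thesis by (simp add: conv_def right_diff_distrib)
      qed
      have "(\<integral>\<^sup>+x. ennreal (norm (indicator S x * (conv U (K n) x - U x))) \<partial>lborel)
         \<le> (\<integral>\<^sup>+x. ennreal \<bar>conv (\<lambda>y. U y - V y) (K n) x\<bar> + (ennreal w * indicator S x + ennreal \<bar>U x - V x\<bar>) \<partial>lborel)"
      proof (rule nn_integral_mono)
        fix x
        have "norm (indicator S x * (conv U (K n) x - U x)) \<le> \<bar>conv (\<lambda>y. U y - V y) (K n) x\<bar> + (w * indicator S x + \<bar>U x - V x\<bar>)"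
          using mid[of x] S(2) by (auto simp: indicator_def split UV)
        then show "ennreal (norm (indicator S x * (conv U (K n) x - U x)))
          \<le> ennreal \<bar>conv (\<lambda>y. U y - V y) (K n) x\<bar> + (ennreal w * indicator S x + ennreal \<bar>U x - V x\<bar>)"
          using w(1) by (auto simp: ennreal_plus[symmetric] ennreal_indicator[symmetric] ennreal_mult[symmetric] ennreal_leI
              simp del: ennreal_plus)
      qed
      also have "\<dots> = (\<integral>\<^sup>+x. ennreal \<bar>conv (\<lambda>y. U y - V y) (K n) x\<bar> \<partial>lborel) + (ennreal w * ennreal m + (\<integral>\<^sup>+x. ennreal \<bar>U x - V x\<bar> \<partial>lborel))"
      proof -
        have [measurable]: "V \<in> borel_measurable borel" using V by auto
        show ?thesis by (simp add: nn_integral_add nn_integral_cmult m)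
      qed
      also have "\<dots> \<le> ennreal (e / 4) + (ennreal w * ennreal m + ennreal (e / 4))"
      proof (intro add_mono order_refl)
        show b2: "(\<integral>\<^sup>+x. ennreal \<bar>U x - V x\<bar> \<partial>lborel) \<le> ennreal (e / 4)" using h(2) by (simp add: UV)
        have "(\<integral>\<^sup>+x. ennreal \<bar>conv (\<lambda>y. U y - V y) (K n) x\<bar> \<partial>lborel) \<le> (\<integral>\<^sup>+x. ennreal \<bar>U x - V x\<bar> \<partial>lborel)"
          using U V S'(2) by (intro bound) auto
        then show "(\<integral>\<^sup>+x. ennreal \<bar>conv (\<lambda>y. U y - V y) (K n) x\<bar> \<partial>lborel) \<le> ennreal (e / 4)" using b2 by (rule order_trans)
      qed
      also have "\<dots> = ennreal (e / 2 + w * m)"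
        using \<open>e > 0\<close> w m by (simp add: ennreal_mult[symmetric] ennreal_plus[symmetric] del: ennreal_plus)
      finally have "ennreal (LINT x|lborel. norm (indicator S x * (conv U (K n) x - U x))) \<le> ennreal (e / 2 + w * m)"
        using inS[of n] by (subst (asm) nn_integral_eq_integral) auto
      then have "(LINT x|lborel. norm (indicator S x * (conv U (K n) x - U x))) \<le> e / 2 + w * m"
        using \<open>e > 0\<close> w(1) m(1) by (subst (asm) ennreal_le_iff) auto
      then show ?thesis using w \<open>e > 0\<close> by (simp add: integral_nonneg_AE)
    qed
    then show "\<exists>n0. \<forall>n\<ge>n0. norm ((LINT x|lborel. norm (indicator S x * (conv U (K n) x - U x))) - 0) < e" by blast
  qed
  from tendsto_L1_AE_subseq[OF inS this] obtain r where r: "strict_mono r"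
      "AE x in lborel. (\<lambda>n. indicator S x * (conv U (K (r n)) x - U x)) \<longlonglongrightarrow> 0" by auto
  from r(2) have "AE x in lborel. x \<in> S \<longrightarrow> (\<lambda>n. conv U (K (r n)) x) \<longlonglongrightarrow> U x"
    by eventually_elim (auto intro: LIM_zero_cancel)
  with r(1) show ?thesis by blast
qed

section \<open>The Sobolev inequality on cubes for weak gradients\<close>

definition cube :: "real^'n::finite \<Rightarrow> real \<Rightarrow> (real^'n) set" where
  "cube x r = cbox (x - vec r) (x + vec r)"

lemma mem_cube: "y \<in> cube x r \<longleftrightarrow> (\<forall>i. \<bar>y $ i - x $ i\<bar> \<le> r)"
  by (auto simp: cube_def mem_box_cart abs_le_iff algebra_simps)

lemma compact_cube: "compact (cube x r)"
  by (simp add: cube_def)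

lemma mollifier_zero: "mollifier \<epsilon> \<rho> \<Longrightarrow> z \<notin> cube 0 \<epsilon> \<Longrightarrow> \<rho> z = 0"
  unfolding mollifier_def mem_cube by (metis diff_zero nle_le zero_index)

text \<open>The complement of the closed cube is open, so the derivatives vanish there along with the function.\<close>

lemma mollifier_partial_deriv_zero:
  assumes "mollifier \<epsilon> \<rho>" "z \<notin> cube 0 \<epsilon>"
  shows "partial_deriv i \<rho> z = 0"
proof -
  have "((\<lambda>z. 0) has_derivative (\<lambda>h. 0)) (at z)" by simp
  then have "(\<rho> has_derivative (\<lambda>h. 0)) (at z)"
    by (rule has_derivative_transform_within_open[where s = "- cube 0 \<epsilon>"])
       (use assms mollifier_zero[OF assms(1)] compact_imp_closed[OF compact_cube] in \<open>auto intro!: open_Compl\<close>)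
  then show ?thesis by (simp add: partial_deriv_def frechet_derivative_eqI)
qed

text \<open>A reflected and translated mollifier is the test function whose insertion into the definition of the
weak gradient shows that mollification turns the weak gradient into the gradient.\<close>

lemma mollifier_test_fun:
  assumes \<rho>: "mollifier \<epsilon> \<rho>" and \<Omega>: "cube x \<epsilon> \<subseteq> \<Omega>"
  shows "(\<lambda>y. \<rho> (x - y)) \<in> test_fun \<Omega>"
    and "partial_deriv i (\<lambda>y. \<rho> (x - y)) y = - partial_deriv i \<rho> (x - y)"
proof -
  have eq: "(\<lambda>y. \<rho> (x - y)) = (\<lambda>y. 1 * \<rho> ((-1) *\<^sub>R y + x))" by simp
  have Ck: "Ck k \<rho>" for k using \<rho> by (simp add: mollifier_def)
  have "Ck k (\<lambda>y. \<rho> (x - y))" for k unfolding eq by (rule Ck_affine[OF Ck])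
  moreover have sub: "{y. \<rho> (x - y) \<noteq> 0} \<subseteq> cube x \<epsilon>"
  proof
    fix y assume "y \<in> {y. \<rho> (x - y) \<noteq> 0}"
    then have "x - y \<in> cube 0 \<epsilon>" using mollifier_zero[OF \<rho>] by auto
    then show "y \<in> cube x \<epsilon>" by (simp add: mem_cube abs_minus_commute)
  qed
  moreover have "closure {y. \<rho> (x - y) \<noteq> 0} \<subseteq> cube x \<epsilon>"
    using sub compact_cube by (intro closure_minimal) (auto intro: compact_imp_closed)
  moreover have "compact (closure {y. \<rho> (x - y) \<noteq> 0})"
    using bounded_subset[OF compact_imp_bounded[OF compact_cube] sub] by (simp add: compact_closure)
  ultimately show "(\<lambda>y. \<rho> (x - y)) \<in> test_fun \<Omega>"
    using \<Omega> by (auto simp: test_fun_def)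
  have "\<rho> differentiable (at z)" for z using Ck[of "Suc 0"] by simp
  from partial_deriv_affine[OF this, of i 1 "-1" x]
  show "partial_deriv i (\<lambda>y. \<rho> (x - y)) y = - partial_deriv i \<rho> (x - y)"
    unfolding eq by simp
qed

text \<open>The function is mollified at scales \<open>\<epsilon> n \<le> r / 2\<close>, so that on the cube of half side \<open>r / 2\<close> only values in
the cube of half side \<open>r\<close> enter. This is why the cubes on the two sides differ.\<close>

lemma local_sobolev:
  fixes u :: "real^'n::finite \<Rightarrow> real" and G :: "real^'n \<Rightarrow> real^'n"
  defines "N \<equiv> real CARD('n)"
  assumes dim: "CARD('n) \<ge> 2" and p: "1 \<le> p" and q: "0 < q" "q * (N - p) \<le> N * p"
    and \<gamma>: "\<gamma> = max 1 (q * (N - 1) / N)"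
    and r: "r > 0" "cube x0 r \<subseteq> \<Omega>"
    and weak: "\<And>\<phi> i. \<phi> \<in> test_fun \<Omega> \<Longrightarrow> (LINT y|lborel. indicator \<Omega> y * (u y * partial_deriv i \<phi> y))
        = - (LINT y|lborel. indicator \<Omega> y * (G y $ i * \<phi> y))"
    and iu: "integrable lborel (\<lambda>y. indicator (cube x0 r) y * u y)"
    and iG: "integrable lborel (\<lambda>y. indicator (cube x0 r) y *\<^sub>R G y)"
    and meas [measurable]: "u \<in> borel_measurable borel" "G \<in> borel_measurable borel"
    and K: "K \<ge> 0"
      "(\<integral>\<^sup>+y. ennreal (indicator (cube x0 r) y * (\<bar>u y\<bar> powr p + (r * norm (G y)) powr p)) \<partial>lborel) \<le> ennreal (r powr N * K)"
  shows "(\<integral>\<^sup>+y. ennreal (indicator (cube x0 (r / 2)) y * \<bar>u y\<bar> powr q) \<partial>lborel)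
    \<le> ennreal (r powr N * ((2 * \<gamma>) powr p * K) powr (q / p))"
proof -
  define S' where "S' = cube x0 r"
  define S where "S = cube x0 (r / 2)"
  have cS: "compact S" "compact S'" "S \<subseteq> S'"
  proof -
    show "S \<subseteq> S'"
    proof
      fix x assume "x \<in> S"
      then have "\<bar>x $ i - x0 $ i\<bar> \<le> r / 2" for i by (simp add: S_def mem_cube)
      moreover have "r / 2 \<le> r" using r(1) by simp
      ultimately show "x \<in> S'" unfolding S'_def mem_cube using order_trans by blast
    qed
  qed (simp_all add: S_def S'_def compact_cube)
  have [measurable]: "S \<in> sets borel" "S' \<in> sets borel" using cS by (auto simp: borel_compact)
  define U where "U y = indicator S' y * u y" for y
  define V where "V y = indicator S' y *\<^sub>R G y" for y
  have U: "integrable lborel U" "\<And>y. y \<notin> S' \<Longrightarrow> U y = 0" using iu by (auto simp: U_def[abs_def] S'_def)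
  have V: "integrable lborel V" "\<And>y. y \<notin> S' \<Longrightarrow> V y = 0" using iG by (auto simp: V_def[abs_def] S'_def)
  obtain R where R: "S' \<subseteq> cball 0 R" using compact_imp_bounded[OF cS(2)] by (auto simp: bounded_iff subset_iff)
  have U': "\<And>y. y \<notin> cball 0 R \<Longrightarrow> U y = 0" and V': "\<And>y. y \<notin> cball 0 R \<Longrightarrow> V y = 0" using U(2) V(2) R by blast+
  define \<epsilon> where "\<epsilon> n = r / 2 * (1 / real (Suc n))" for n
  have \<epsilon>: "\<epsilon> n > 0" "\<epsilon> n \<le> r / 2" for n using r(1) by (auto simp: \<epsilon>_def field_simps)
  have \<epsilon>0: "\<epsilon> \<longlonglongrightarrow> 0"
    unfolding \<epsilon>_def using tendsto_mult_left[OF lim_1_over_n[THEN LIMSEQ_Suc], of "r / 2"] by simp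
  have "\<forall>n. \<exists>\<rho> :: real^'n \<Rightarrow> real. mollifier (\<epsilon> n) \<rho>" using mollifier_exists \<epsilon>(1) by blast
  then obtain \<rho> :: "nat \<Rightarrow> real^'n \<Rightarrow> real" where \<rho>: "\<And>n. mollifier (\<epsilon> n) (\<rho> n)" by metis
  have \<rho>Ck: "Ck k (\<rho> n)" and \<rho>0: "\<rho> n z \<ge> 0" and \<rho>i: "integrable lborel (\<rho> n)" and \<rho>1: "(LINT z|lborel. \<rho> n z) = 1" for k n z
    using \<rho>[of n] by (auto simp: mollifier_def)
  have \<rho>c: "continuous_on UNIV (\<rho> n)" for n using \<rho>Ck[of 0 n] by simp
  have \<rho>d: "\<rho> n differentiable (at z)" for n z using \<rho>Ck[of "Suc 0" n] by simp
  have \<rho>pc: "continuous_on UNIV (partial_deriv i (\<rho> n))" for i n using \<rho>Ck[of "Suc 0" n] by simp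
  \<comment> \<open>Points of \<open>S\<close> see only \<open>S'\<close> through the mollifier, so cutting off \<open>u\<close> and \<open>G\<close> outside \<open>S'\<close> is harmless.\<close>
  have near: "y \<in> S'" if "x \<in> S" "x - y \<in> cube 0 (\<epsilon> n)" for x y n
  proof -
    have "\<bar>y $ i - x0 $ i\<bar> \<le> r" for i
    proof -
      have "\<bar>x $ i - x0 $ i\<bar> \<le> r / 2" "\<bar>x $ i - y $ i\<bar> \<le> \<epsilon> n"
        using that by (simp_all add: S_def mem_cube)
      then show ?thesis using \<epsilon>(2)[of n] by linarith
    qed
    then show ?thesis by (simp add: S'_def mem_cube)
  qed
  define f where "f n = conv U (\<rho> n)" for n
  define D where "D n z = (\<chi> i. partial_deriv i (\<rho> n) z)" for n z
  define g where "g n x = (LINT y|lborel. U y *\<^sub>R D n (x - y))" for n x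
  have D: "(\<rho> n has_derivative (\<lambda>h. D n z \<bullet> h)) (at z)" for n z
    unfolding D_def by (rule has_derivative_partial_deriv[OF \<rho>d])
  have Dc: "continuous_on UNIV (D n)" for n
    unfolding D_def by (intro continuous_on_vec_lambda \<rho>pc)
  have fd: "(f n has_derivative (\<lambda>h. g n x \<bullet> h)) (at x)" and gc: "isCont (g n) x"
    and gi: "g n x \<bullet> b = conv U (\<lambda>z. D n z \<bullet> b) x" for n x b
    using conv_has_derivative[OF U(1) U' D Dc, of R] unfolding f_def g_def by blast+
  \<comment> \<open>On \<open>S\<close> the gradient of the mollified function is the mollified weak gradient.\<close>
  have gV: "g n x = conv V (\<rho> n) x" if x: "x \<in> S" for n x
  proof -
    have iV: "integrable lborel (\<lambda>y. \<rho> n (x - y) *\<^sub>R V y)"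
      by (rule integrable_conv[OF V(1) V' \<rho>c])
    have "cube x (\<epsilon> n) \<subseteq> S'"
      using near[OF x] by (auto simp: mem_cube abs_minus_commute)
    then have cx: "cube x (\<epsilon> n) \<subseteq> \<Omega>" using r(2) by (auto simp: S'_def)
    have "g n x $ i = conv V (\<rho> n) x $ i" for i
    proof -
      have "g n x $ i = conv U (\<lambda>z. D n z \<bullet> axis i 1) x"
        using gi[of n x "axis i 1"] by (simp add: inner_axis)
      also have "\<dots> = (LINT y|lborel. - (indicator \<Omega> y * (u y * partial_deriv i (\<lambda>y. \<rho> n (x - y)) y)))"
        unfolding conv_def
      proof (rule Bochner_Integration.integral_cong[OF refl])
        fix y
        have "y \<in> S'" if "partial_deriv i (\<rho> n) (x - y) \<noteq> 0"
          using near[OF x] mollifier_partial_deriv_zero[OF \<rho>] that by blast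
        then show "(D n (x - y) \<bullet> axis i 1) *\<^sub>R U y = - (indicator \<Omega> y * (u y * partial_deriv i (\<lambda>y. \<rho> n (x - y)) y))"
          using r(2) by (auto simp: mollifier_test_fun(2)[OF \<rho> cx] inner_axis D_def U_def indicator_def S'_def)
      qed
      also have "\<dots> = (LINT y|lborel. indicator \<Omega> y * (G y $ i * \<rho> n (x - y)))"
        using weak[OF mollifier_test_fun(1)[OF \<rho> cx], of i] by simp
      also have "\<dots> = (LINT y|lborel. (\<rho> n (x - y) *\<^sub>R V y) \<bullet> axis i 1)"
      proof (rule Bochner_Integration.integral_cong[OF refl])
        fix y
        have "y \<in> S'" if "\<rho> n (x - y) \<noteq> 0"
          using near[OF x] mollifier_zero[OF \<rho>] that by blast
        then show "indicator \<Omega> y * (G y $ i * \<rho> n (x - y)) = (\<rho> n (x - y) *\<^sub>R V y) \<bullet> axis i 1"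
          using r(2) by (auto simp: inner_axis V_def indicator_def S'_def)
      qed
      also have "\<dots> = conv V (\<rho> n) x \<bullet> axis i 1"
        unfolding conv_def by (rule integral_inner_left) (use iV in auto)
      finally show ?thesis by (simp add: inner_axis)
    qed
    then show ?thesis by (simp add: vec_eq_iff)
  qed
  have \<rho>nn: "(\<integral>\<^sup>+z. ennreal (\<rho> n z) \<partial>lborel) \<le> 1" for n
    using \<rho>i \<rho>1 \<rho>0 by (subst nn_integral_eq_integral) auto
  have [measurable]: "U \<in> borel_measurable borel" "V \<in> borel_measurable borel" using U V by auto
  have [measurable]: "\<rho> n \<in> borel_measurable borel" for n using \<rho>c by (rule borel_measurable_continuous_onI)
  have cm [measurable]: "conv U (\<rho> n) \<in> borel_measurable borel" "conv V (\<rho> n) \<in> borel_measurable borel" for n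
    unfolding conv_def by measurable
  have bound: "(\<integral>\<^sup>+x. ennreal (indicator S x * (\<bar>f n x\<bar> powr p + (r * norm (g n x)) powr p)) \<partial>lborel) \<le> ennreal (r powr N * K)" for n
  proof -
    have "(\<integral>\<^sup>+x. ennreal (indicator S x * (\<bar>f n x\<bar> powr p + (r * norm (g n x)) powr p)) \<partial>lborel)
       \<le> (\<integral>\<^sup>+x. ennreal (norm (conv U (\<rho> n) x) powr p) + ennreal (r powr p) * ennreal (norm (conv V (\<rho> n) x) powr p) \<partial>lborel)"
    proof (rule nn_integral_mono)
      fix x
      show "ennreal (indicator S x * (\<bar>f n x\<bar> powr p + (r * norm (g n x)) powr p))
        \<le> ennreal (norm (conv U (\<rho> n) x) powr p) + ennreal (r powr p) * ennreal (norm (conv V (\<rho> n) x) powr p)"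
        using r(1) gV[of x n] by (cases "x \<in> S") (auto simp: f_def ennreal_mult[symmetric] powr_mult)
    qed
    also have "\<dots> = (\<integral>\<^sup>+x. ennreal (norm (conv U (\<rho> n) x) powr p) \<partial>lborel)
        + ennreal (r powr p) * (\<integral>\<^sup>+x. ennreal (norm (conv V (\<rho> n) x) powr p) \<partial>lborel)"
      by (simp add: nn_integral_add nn_integral_cmult)
    also have "\<dots> \<le> (\<integral>\<^sup>+y. ennreal (norm (U y) powr p) \<partial>lborel)
        + ennreal (r powr p) * (\<integral>\<^sup>+y. ennreal (norm (V y) powr p) \<partial>lborel)"
      by (intro add_mono mult_left_mono nn_integral_conv_powr_le[OF U(1) U' \<rho>c \<rho>0 \<rho>nn p]
           nn_integral_conv_powr_le[OF V(1) V' \<rho>c \<rho>0 \<rho>nn p]) auto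
    also have "\<dots> = (\<integral>\<^sup>+y. ennreal (norm (U y) powr p) + ennreal (r powr p) * ennreal (norm (V y) powr p) \<partial>lborel)"
      by (simp add: nn_integral_add nn_integral_cmult)
    also have "\<dots> = (\<integral>\<^sup>+y. ennreal (indicator (cube x0 r) y * (\<bar>u y\<bar> powr p + (r * norm (G y)) powr p)) \<partial>lborel)"
      using r(1) by (intro nn_integral_cong)
        (auto simp: U_def V_def S'_def indicator_def powr_mult ennreal_mult[symmetric])
    finally show ?thesis using K(2) by (rule order_trans)
  qed
  define B where "B = r powr N * ((2 * \<gamma>) powr p * K) powr (q / p)"
  have smooth: "(\<integral>\<^sup>+x. ennreal (indicator S x * \<bar>f n x\<bar> powr q) \<partial>lborel) \<le> ennreal B" for n
  proof -
    have side: "((x0 + vec (r / 2)) - (x0 - vec (r / 2))) \<bullet> b = r" if "b \<in> Basis" for b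
      using that by (auto simp: Basis_vec_def inner_axis)
    show ?thesis
      unfolding B_def S_def cube_def N_def
    proof (rule cube_sobolev_smooth[OF r(1) side, where g = "g n", unfolded DIM_cart DIM_real mult_1_right])
      show "continuous_on (cbox (x0 - vec (r / 2)) (x0 + vec (r / 2))) (g n)"
        by (intro continuous_at_imp_continuous_on ballI gc)
    qed (use dim p q \<gamma> K(1) bound[of n] fd[THEN has_derivative_at_withinI] in \<open>auto simp: N_def S_def cube_def\<close>)
  qed
  have "\<exists>s. strict_mono s \<and> (AE x in lborel. x \<in> S \<longrightarrow> (\<lambda>n. conv U (\<rho> (s n)) x) \<longlonglongrightarrow> U x)"
  proof (rule conv_AE_subseq[OF U(1) cS(2) U(2) cS(1,3) \<rho>c \<rho>0 \<rho>i \<rho>1])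
    show "(\<lambda>n. (N + 1) * \<epsilon> n) \<longlonglongrightarrow> 0" using tendsto_mult_left[OF \<epsilon>0, of "N + 1"] by simp
    fix n x y assume x: "x \<in> S" and "\<rho> n (x - y) \<noteq> 0"
    then have c: "x - y \<in> cube 0 (\<epsilon> n)" using mollifier_zero[OF \<rho>] by blast
    have "norm (x - y) \<le> (\<Sum>i\<in>UNIV. \<bar>(x - y) $ i\<bar>)" by (rule norm_le_l1_cart)
    also have "\<dots> \<le> (\<Sum>i\<in>(UNIV::'n set). \<epsilon> n)" using c by (intro sum_mono) (auto simp: mem_cube)
    also have "\<dots> < (N + 1) * \<epsilon> n" using \<epsilon>(1)[of n] by (simp add: N_def algebra_simps)
    finally show "y \<in> S' \<and> norm (x - y) < (N + 1) * \<epsilon> n" using near[OF x c] by simp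
  qed
  then obtain s where s: "AE x in lborel. x \<in> S \<longrightarrow> (\<lambda>n. f (s n) x) \<longlonglongrightarrow> U x" by (auto simp: f_def)
  have "(\<integral>\<^sup>+y. ennreal (indicator S y * \<bar>u y\<bar> powr q) \<partial>lborel)
     = (\<integral>\<^sup>+x. liminf (\<lambda>n. ennreal (indicator S x * \<bar>f (s n) x\<bar> powr q)) \<partial>lborel)"
  proof (rule nn_integral_cong_AE)
    show "AE x in lborel. ennreal (indicator S x * \<bar>u x\<bar> powr q) = liminf (\<lambda>n. ennreal (indicator S x * \<bar>f (s n) x\<bar> powr q))"
      using s
    proof eventually_elim
      case (elim x)
      show ?case
      proof (cases "x \<in> S")
        case True
        then have "U x = u x" using cS(3) by (auto simp: U_def)
        then have "(\<lambda>n. ennreal (\<bar>f (s n) x\<bar> powr q)) \<longlonglongrightarrow> ennreal (\<bar>u x\<bar> powr q)"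
          using elim True q(1) by (intro tendsto_ennrealI tendsto_powr') (auto intro!: tendsto_intros)
        from lim_imp_Liminf[OF _ this] show ?thesis using True by simp
      qed (simp add: Liminf_const)
    qed
  qed
  also have "\<dots> \<le> liminf (\<lambda>n. \<integral>\<^sup>+x. ennreal (indicator S x * \<bar>f (s n) x\<bar> powr q) \<partial>lborel)"
    unfolding f_def by (rule nn_integral_liminf) measurable
  also have "\<dots> \<le> liminf (\<lambda>n::nat. ennreal B)"
    by (intro Liminf_mono always_eventually allI smooth)
  also have "\<dots> = ennreal B" by (simp add: Liminf_const)
  finally show ?thesis by (simp add: S_def B_def)
qed

section \<open>Averaging over cubes comparable to the distance from the boundary\<close>

lemma dist_le_cube:
  fixes x y :: "real^'n::finite"
  assumes "y \<in> cube x s"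
  shows "dist x y \<le> real CARD('n) * s"
proof -
  have "dist x y \<le> (\<Sum>i\<in>UNIV. \<bar>(x - y) $ i\<bar>)" unfolding dist_norm by (rule norm_le_l1_cart)
  also have "\<dots> \<le> (\<Sum>i\<in>(UNIV::'n set). s)" using assms by (intro sum_mono) (auto simp: mem_cube abs_minus_commute)
  finally show ?thesis by simp
qed

lemma emeasure_cube:
  fixes x :: "real^'n::finite"
  assumes "s \<ge> 0" shows "emeasure lborel (cube x s) = ennreal ((2 * s) ^ CARD('n))"
proof -
  have "((x + vec s) - (x - vec s)) \<bullet> b = 2 * s" "(x - vec s) \<bullet> b \<le> (x + vec s) \<bullet> b" if "b \<in> Basis" for b
    using that assms by (auto simp: Basis_vec_def inner_axis)
  then show ?thesis unfolding cube_def by (subst emeasure_lborel_cbox) auto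
qed

lemma bdry_dist_pos: "open \<Omega> \<Longrightarrow> frontier \<Omega> \<noteq> {} \<Longrightarrow> x \<in> \<Omega> \<Longrightarrow> bdry_dist \<Omega> x > 0"
  unfolding bdry_dist_def
  by (metis frontier_closed frontier_disjoint_eq disjoint_iff in_closed_iff_infdist_zero infdist_nonneg order_le_less)

lemma bdry_dist_triangle: "bdry_dist \<Omega> x \<le> bdry_dist \<Omega> y + dist x y"
  unfolding bdry_dist_def by (rule infdist_triangle)

lemma bdry_dist_ball:
  fixes \<Omega> :: "'a::euclidean_space set"
  assumes "x \<in> \<Omega>" "dist x y < bdry_dist \<Omega> x"
  shows "y \<in> \<Omega>"
proof (rule ccontr)
  assume "y \<notin> \<Omega>"
  then have "closed_segment x y \<inter> frontier \<Omega> \<noteq> {}"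
    using assms(1) by (intro connected_Int_frontier) auto
  then obtain z where z: "z \<in> closed_segment x y" "z \<in> frontier \<Omega>" by auto
  have "bdry_dist \<Omega> x \<le> dist x z" unfolding bdry_dist_def using z(2) by (rule infdist_le)
  also have "\<dots> \<le> dist x y" using z(1) by (metis dist_commute segment_bound1 dist_norm)
  finally show False using assms(2) by simp
qed

text \<open>The local inequality on the cube of half side \<open>c \<delta>(x)\<close> about \<open>x\<close> is divided by \<open>\<delta>(x)\<close> to the power \<open>2 N\<close> and
integrated over \<open>x\<close>. One factor \<open>\<delta>(x)\<^sup>N\<close> makes the measure \<open>\<mu>\<close>, the other turns the integrals over the
cube into integrals with respect to \<open>\<mu>\<close>. After exchanging the integrations, the set of centres \<open>x\<close> of cubes
containing \<open>y\<close> lies between two cubes about \<open>y\<close> with sides comparable to \<open>\<delta>(y)\<close>.\<close>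

lemma weighted_sobolev_borel:
  fixes u :: "real^'n::finite \<Rightarrow> real" and G :: "real^'n \<Rightarrow> real^'n" and \<Omega> :: "(real^'n) set"
  defines "N \<equiv> real CARD('n)" and "\<delta> \<equiv> bdry_dist \<Omega>"
  assumes dim: "CARD('n) \<ge> 2" and p: "1 \<le> p" "p \<le> N" and q: "p < q" "q * (N - p) \<le> N * p"
    and \<Omega>: "open \<Omega>" "frontier \<Omega> \<noteq> {}"
    and weak: "\<And>\<phi> i. \<phi> \<in> test_fun \<Omega> \<Longrightarrow> (LINT y|lborel. indicator \<Omega> y * (u y * partial_deriv i \<phi> y))
        = - (LINT y|lborel. indicator \<Omega> y * (G y $ i * \<phi> y))"
    and iu: "\<And>S. compact S \<Longrightarrow> S \<subseteq> \<Omega> \<Longrightarrow> integrable lborel (\<lambda>y. indicator S y * u y)"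
    and iG: "\<And>S. compact S \<Longrightarrow> S \<subseteq> \<Omega> \<Longrightarrow> integrable lborel (\<lambda>y. indicator S y *\<^sub>R G y)"
    and meas [measurable]: "u \<in> borel_measurable borel" "G \<in> borel_measurable borel"
    and a: "a \<ge> 0"
      "(\<integral>\<^sup>+y. ennreal (indicator \<Omega> y * (norm (G y) powr p / \<delta> y powr (N - p) + \<bar>u y\<bar> powr p / \<delta> y ^ CARD('n))) \<partial>lborel) \<le> ennreal a"
  shows "(\<integral>\<^sup>+y. ennreal (indicator \<Omega> y * (\<bar>u y\<bar> powr q / \<delta> y ^ CARD('n))) \<partial>lborel)
    \<le> ennreal (((2 * max 1 (q * (N - 1) / N)) powr p * (8 * N) ^ CARD('n)) powr (q / p) * 8 ^ CARD('n) * a powr (q / p))"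
proof -
  define m where "m = CARD('n)"
  have N: "N \<ge> 2" "N = real m" using dim by (auto simp: N_def m_def)
  \<comment> \<open>The factor \<open>N\<close> compares the cube with a ball: all points of the cube of half side \<open>c \<delta>(x)\<close> have distance at most
\<open>\<delta>(x) / 4\<close> from \<open>x\<close>.\<close>
  define c where "c = 1 / (4 * N)"
  have c: "c > 0" "c \<le> 1 / 4" "N * c = 1 / 4" using N by (auto simp: c_def field_simps)
  have [measurable]: "\<Omega> \<in> sets borel" using \<Omega> by simp
  have "continuous_on UNIV \<delta>" unfolding \<delta>_def bdry_dist_def by (intro continuous_intros)
  then have [measurable]: "\<delta> \<in> borel_measurable borel" by (rule borel_measurable_continuous_onI)
  have [measurable]: "(\<lambda>x::real^'n. x $ i) \<in> borel_measurable borel" for i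
    by (intro borel_measurable_continuous_onI continuous_intros)
  have \<delta>0: "\<delta> x > 0" if "x \<in> \<Omega>" for x using bdry_dist_pos[OF \<Omega> that] by (simp add: \<delta>_def)
  have \<delta>le: "\<delta> x \<le> \<delta> y + dist x y" for x y by (simp add: \<delta>_def bdry_dist_triangle)
  have comp: "y \<in> \<Omega> \<and> \<delta> y \<le> 5 / 4 * \<delta> x \<and> 3 / 4 * \<delta> x \<le> \<delta> y" if x: "x \<in> \<Omega>" and y: "y \<in> cube x (c * \<delta> x)" for x y
  proof -
    have "dist x y \<le> N * (c * \<delta> x)" using dist_le_cube[OF y] by (simp add: N_def)
    also have "\<dots> = \<delta> x / 4" using c(3) by (simp add: mult.assoc[symmetric])
    finally have d: "dist x y \<le> \<delta> x / 4" .
    then have "y \<in> \<Omega>" using x \<delta>0[OF x] unfolding \<delta>_def by (intro bdry_dist_ball[OF x]) auto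
    then show ?thesis using d \<delta>le[of x y] \<delta>le[of y x] by (simp add: dist_commute)
  qed
  define h where "h y = norm (G y) powr p / \<delta> y powr (N - p) + \<bar>u y\<bar> powr p / \<delta> y ^ m" for y
  have \<delta>nn: "\<delta> y \<ge> 0" for y by (simp add: \<delta>_def bdry_dist_def infdist_nonneg)
  have h0: "h y \<ge> 0" for y using \<delta>nn by (simp add: h_def)
  have [measurable]: "h \<in> borel_measurable borel" unfolding h_def by measurable
  have a': "(\<integral>\<^sup>+y. ennreal (indicator \<Omega> y * h y) \<partial>lborel) \<le> ennreal a" using a(2) by (simp add: h_def m_def)
  define J where "J x = (\<integral>\<^sup>+y. ennreal (indicator (cube x (c * \<delta> x)) y * h y) \<partial>lborel)" for x
  define M where "M = (2 * max 1 (q * (N - 1) / N)) powr p * (8 * N) ^ m"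
  have M: "M \<ge> 0" using N by (simp add: M_def)
  \<comment> \<open>Here the power \<open>q / p\<close> of the local integral \<open>j\<close> is split into \<open>j\<close> and a power bounded by the total \<open>a\<close>.\<close>
  define C1 where "C1 = c ^ m * M powr (q / p) * a powr (q / p - 1)"
  have C1: "C1 \<ge> 0" using c by (simp add: C1_def)
  have local: "(\<integral>\<^sup>+y. ennreal (indicator (cube x (c * \<delta> x / 2)) y * \<bar>u y\<bar> powr q) \<partial>lborel) \<le> ennreal (C1 * \<delta> x ^ m) * J x"
    if x: "x \<in> \<Omega>" for x
  proof -
    define r where "r = c * \<delta> x"
    have r: "r > 0" using c \<delta>0[OF x] by (simp add: r_def)
    have sub: "cube x r \<subseteq> \<Omega>" using comp[OF x] by (auto simp: r_def)
    have [measurable]: "cube x r \<in> sets borel" by (simp add: borel_compact compact_cube)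
    have "J x \<le> (\<integral>\<^sup>+y. ennreal (indicator \<Omega> y * h y) \<partial>lborel)"
      unfolding J_def using sub h0 by (intro nn_integral_mono ennreal_leI mult_right_mono) (auto simp: indicator_def r_def)
    then have Ja: "J x \<le> ennreal a" using a' by (rule order_trans)
    define j where "j = enn2real (J x)"
    have j: "J x = ennreal j" "j \<ge> 0"
      using Ja by (auto simp: j_def less_top[symmetric] intro!: ennreal_enn2real[symmetric] le_less_trans[OF Ja])
    have ja: "j \<le> a" using Ja a(1) by (simp add: j(1))
    define K where "K = (8 * N) ^ m * j"
    have "(\<integral>\<^sup>+y. ennreal (indicator (cube x r) y * (\<bar>u y\<bar> powr p + (r * norm (G y)) powr p)) \<partial>lborel)
       \<le> (\<integral>\<^sup>+y. ennreal ((2 * \<delta> x) ^ m) * ennreal (indicator (cube x r) y * h y) \<partial>lborel)"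
    proof (rule nn_integral_mono)
      fix y
      have "\<bar>u y\<bar> powr p + (r * norm (G y)) powr p \<le> (2 * \<delta> x) ^ m * h y" if y: "y \<in> cube x r"
      proof -
        have y': "y \<in> \<Omega>" "\<delta> y \<le> 2 * \<delta> x" "r \<le> \<delta> y"
        proof -
          have "c * \<delta> x \<le> 1 / 4 * \<delta> x" by (intro mult_right_mono c \<delta>nn)
          moreover have "y \<in> \<Omega> \<and> \<delta> y \<le> 5 / 4 * \<delta> x \<and> 3 / 4 * \<delta> x \<le> \<delta> y"
            using y by (intro comp[OF x]) (simp add: r_def)
          ultimately show "y \<in> \<Omega>" "\<delta> y \<le> 2 * \<delta> x" "r \<le> \<delta> y"
            using \<delta>0[OF x] unfolding r_def by (blast, linarith, linarith)
        qed
        have dy: "\<delta> y > 0" by (rule \<delta>0[OF y'(1)])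
        have dm: "\<delta> y ^ m = \<delta> y powr p * \<delta> y powr (N - p)"
          using dy by (simp add: powr_add[symmetric] N(2) powr_realpow)
        have "(r * norm (G y)) powr p = r powr p * norm (G y) powr p" using r by (simp add: powr_mult)
        also have "\<dots> \<le> \<delta> y powr p * norm (G y) powr p"
          using r y'(3) p by (intro mult_right_mono powr_mono2) auto
        also have "\<dots> = \<delta> y ^ m * (norm (G y) powr p / \<delta> y powr (N - p))"
          using dy by (simp add: dm)
        finally have "\<bar>u y\<bar> powr p + (r * norm (G y)) powr p \<le> \<delta> y ^ m * h y"
          using dy by (simp add: h_def distrib_left)
        also have "\<dots> \<le> (2 * \<delta> x) ^ m * h y"
          using y' dy h0 by (intro mult_right_mono power_mono) auto
        finally show ?thesis .
      qed
      then show "ennreal (indicator (cube x r) y * (\<bar>u y\<bar> powr p + (r * norm (G y)) powr p))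
         \<le> ennreal ((2 * \<delta> x) ^ m) * ennreal (indicator (cube x r) y * h y)"
        using \<delta>nn[of x] h0[of y] by (auto simp: indicator_def ennreal_mult[symmetric] intro!: ennreal_leI)
    qed
    also have "\<dots> = ennreal ((2 * \<delta> x) ^ m) * J x"
      unfolding J_def r_def[symmetric] by (rule nn_integral_cmult) measurable
    also have "\<dots> = ennreal (r powr N * K)"
    proof -
      have "(2 * \<delta> x) ^ m = r powr N * (8 * N) ^ m"
      proof -
        have "r powr N * (8 * N) ^ m = (r * (8 * N)) ^ m"
          using r by (simp add: N(2) powr_realpow power_mult_distrib)
        also have "r * (8 * N) = 2 * \<delta> x" using N(1) by (simp add: r_def c_def)
        finally show ?thesis by simp
      qed
      then show ?thesis using j(2) \<delta>nn[of x] N(1) by (simp add: j(1) K_def ennreal_mult[symmetric] mult.assoc)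
    qed
    finally have "(\<integral>\<^sup>+y. ennreal (indicator (cube x (r / 2)) y * \<bar>u y\<bar> powr q) \<partial>lborel)
       \<le> ennreal (r powr N * ((2 * max 1 (q * (N - 1) / N)) powr p * K) powr (q / p))"
      unfolding N_def
      by (intro local_sobolev[OF dim p(1) _ _ refl r sub weak iu[OF compact_cube sub] iG[OF compact_cube sub] meas])
         (use p q j(2) in \<open>auto simp: N_def K_def\<close>)
    also have "(2 * max 1 (q * (N - 1) / N)) powr p * K = M * j" by (simp add: M_def K_def)
    also have "r powr N * (M * j) powr (q / p) \<le> C1 * \<delta> x ^ m * j"
    proof -
      have "j powr (q / p) = j powr (q / p - 1) * j"
        using j(2) by (cases "j = 0") (auto simp: powr_diff)
      also have "\<dots> \<le> a powr (q / p - 1) * j"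
        using ja j(2) p q by (intro mult_right_mono powr_mono2) auto
      finally have le: "j powr (q / p) \<le> a powr (q / p - 1) * j" .
      have "r powr N * (M * j) powr (q / p) = c ^ m * \<delta> x ^ m * M powr (q / p) * j powr (q / p)"
        using r M j(2) by (simp add: N(2) powr_realpow powr_mult) (simp add: r_def power_mult_distrib)
      also have "\<dots> \<le> c ^ m * \<delta> x ^ m * M powr (q / p) * (a powr (q / p - 1) * j)"
        using le c \<delta>nn by (intro mult_left_mono) auto
      also have "\<dots> = C1 * \<delta> x ^ m * j" by (simp add: C1_def)
      finally show ?thesis .
    qed
    finally have "(\<integral>\<^sup>+y. ennreal (indicator (cube x (r / 2)) y * \<bar>u y\<bar> powr q) \<partial>lborel) \<le> ennreal (C1 * \<delta> x ^ m * j)"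
      by (simp add: ennreal_leI)
    then show ?thesis using C1 \<delta>nn j(2) by (simp add: r_def j(1) ennreal_mult)
  qed
  \<comment> \<open>The kernel of the averaging: \<open>y\<close> belongs to the cube about \<open>x\<close>.\<close>
  define k where "k s x y = (if x \<in> \<Omega> \<and> (\<forall>i. \<bar>y $ i - x $ i\<bar> \<le> s * \<delta> x) then 1 else 0 :: real)" for s x y
  have km [measurable]: "(\<lambda>z. k s (fst z) (snd z)) \<in> borel_measurable (borel \<Otimes>\<^sub>M borel)" for s
    unfolding k_def by measurable
  have k: "k s x y = indicator \<Omega> x * indicator (cube x (s * \<delta> x)) y" for s x y
    by (auto simp: k_def indicator_def mem_cube)
  define Y where "Y = (\<integral>\<^sup>+y. ennreal (indicator \<Omega> y * (\<bar>u y\<bar> powr q / \<delta> y ^ m)) \<partial>lborel)"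
  \<comment> \<open>A lower bound for \<open>\<delta>(y)\<^sup>N\<close> times the integral of \<open>1 / \<delta>(x)\<close> to the power \<open>2 N\<close> over the centres \<open>x\<close> of
the small cubes that contain \<open>y\<close>: these include the cube of half side \<open>c \<delta>(y) / 4\<close> about \<open>y\<close>, where \<open>\<delta>(x) \<le> 2 \<delta>(y)\<close>.\<close>
  define c2 where "c2 = (c / 8) ^ m"
  have c2: "c2 > 0" using c by (simp add: c2_def)
  have "ennreal c2 * Y = (\<integral>\<^sup>+y. ennreal c2 * ennreal (indicator \<Omega> y * (\<bar>u y\<bar> powr q / \<delta> y ^ m)) \<partial>lborel)"
    unfolding Y_def by (rule nn_integral_cmult[symmetric]) measurable
  also have "\<dots> \<le> (\<integral>\<^sup>+y. (\<integral>\<^sup>+x. ennreal (k (c / 2) x y / \<delta> x ^ (2 * m)) * ennreal (\<bar>u y\<bar> powr q) \<partial>lborel) \<partial>lborel)"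
  proof (rule nn_integral_mono)
    fix y
    have [measurable]: "(\<lambda>x. k (c / 2) x y) \<in> borel_measurable borel" unfolding k_def by measurable
    show "ennreal c2 * ennreal (indicator \<Omega> y * (\<bar>u y\<bar> powr q / \<delta> y ^ m))
       \<le> (\<integral>\<^sup>+x. ennreal (k (c / 2) x y / \<delta> x ^ (2 * m)) * ennreal (\<bar>u y\<bar> powr q) \<partial>lborel)"
    proof (cases "y \<in> \<Omega>")
      case True
      have dy: "\<delta> y > 0" by (rule \<delta>0[OF True])
      define s where "s = c * \<delta> y / 4"
      have s: "s > 0" using c dy by (simp add: s_def)
      have [measurable]: "cube y s \<in> sets borel" by (simp add: borel_compact compact_cube)
      have pt: "indicator (cube y s) x / (2 * \<delta> y) ^ (2 * m) \<le> k (c / 2) x y / \<delta> x ^ (2 * m)" for x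
      proof (cases "x \<in> cube y s")
        case xs: True
        have "s \<le> c * \<delta> y" using c dy by (simp add: s_def)
        then have "x \<in> cube y (c * \<delta> y)" using xs unfolding mem_cube by (meson order_trans)
        from comp[OF True this] have x: "x \<in> \<Omega>" "\<delta> x \<le> 5 / 4 * \<delta> y" "3 / 4 * \<delta> y \<le> \<delta> x" by auto
        have "s \<le> c / 2 * \<delta> x" using x(3) c(1) mult_left_mono[OF x(3), of "c / 2"] dy by (simp add: s_def)
        moreover have "\<bar>y $ i - x $ i\<bar> \<le> s" for i using xs by (simp add: mem_cube abs_minus_commute)
        ultimately have "\<bar>y $ i - x $ i\<bar> \<le> c / 2 * \<delta> x" for i by (meson order_trans)
        then have "k (c / 2) x y = 1" using x(1) by (simp only: k_def simp_thms if_True)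
        moreover have "\<delta> x ^ (2 * m) \<le> (2 * \<delta> y) ^ (2 * m)" using x dy \<delta>nn by (intro power_mono) auto
        ultimately show ?thesis using xs \<delta>0[OF x(1)] by (simp add: divide_left_mono frac_le)
      qed (use \<delta>nn in \<open>simp add: k_def\<close>)
      have "ennreal (c2 / \<delta> y ^ m) = ennreal (1 / (2 * \<delta> y) ^ (2 * m)) * emeasure lborel (cube y s)"
      proof -
        have "(2 * s) ^ m / (2 * \<delta> y) ^ (2 * m) = c2 / \<delta> y ^ m"
        proof -
          have "(2 * s) ^ m / (2 * \<delta> y) ^ (2 * m) = (2 * s / (2 * \<delta> y)\<^sup>2) ^ m"
            by (simp only: power_divide power_mult)
          also have "2 * s / (2 * \<delta> y)\<^sup>2 = c / 8 / \<delta> y" using dy by (simp add: s_def power2_eq_square)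
          finally show ?thesis by (simp add: c2_def power_divide)
        qed
        then show ?thesis using s dy by (simp add: emeasure_cube m_def[symmetric] ennreal_mult[symmetric])
      qed
      also have "\<dots> = (\<integral>\<^sup>+x. ennreal (1 / (2 * \<delta> y) ^ (2 * m)) * indicator (cube y s) x \<partial>lborel)"
        by (simp add: nn_integral_cmult)
      also have "\<dots> \<le> (\<integral>\<^sup>+x. ennreal (k (c / 2) x y / \<delta> x ^ (2 * m)) \<partial>lborel)"
      proof (rule nn_integral_mono)
        fix x
        have "ennreal (1 / (2 * \<delta> y) ^ (2 * m)) * indicator (cube y s) x = ennreal (indicator (cube y s) x / (2 * \<delta> y) ^ (2 * m))"
          by (simp add: indicator_def)
        also have "\<dots> \<le> ennreal (k (c / 2) x y / \<delta> x ^ (2 * m))" using pt by (rule ennreal_leI)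
        finally show "ennreal (1 / (2 * \<delta> y) ^ (2 * m)) * indicator (cube y s) x \<le> ennreal (k (c / 2) x y / \<delta> x ^ (2 * m))" .
      qed
      finally have "ennreal (c2 / \<delta> y ^ m) * ennreal (\<bar>u y\<bar> powr q)
          \<le> (\<integral>\<^sup>+x. ennreal (k (c / 2) x y / \<delta> x ^ (2 * m)) \<partial>lborel) * ennreal (\<bar>u y\<bar> powr q)"
        by (rule mult_right_mono) simp
      then show ?thesis using True c2 dy by (simp add: nn_integral_multc ennreal_mult[symmetric])
    qed simp
  qed
  also have "\<dots> = (\<integral>\<^sup>+x. (\<integral>\<^sup>+y. ennreal (k (c / 2) x y / \<delta> x ^ (2 * m)) * ennreal (\<bar>u y\<bar> powr q) \<partial>lborel) \<partial>lborel)"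
    by (rule lborel_pair.Fubini') (unfold split_beta, measurable)
  also have "\<dots> \<le> (\<integral>\<^sup>+x. (\<integral>\<^sup>+y. ennreal C1 * ennreal (k c x y / \<delta> x ^ m * h y) \<partial>lborel) \<partial>lborel)"
  proof (rule nn_integral_mono)
    fix x
    show "(\<integral>\<^sup>+y. ennreal (k (c / 2) x y / \<delta> x ^ (2 * m)) * ennreal (\<bar>u y\<bar> powr q) \<partial>lborel)
       \<le> (\<integral>\<^sup>+y. ennreal C1 * ennreal (k c x y / \<delta> x ^ m * h y) \<partial>lborel)"
    proof (cases "x \<in> \<Omega>")
      case True
      have dx: "\<delta> x > 0" by (rule \<delta>0[OF True])
      have [measurable]: "cube x s \<in> sets borel" for s by (simp add: borel_compact compact_cube)
      have "(\<integral>\<^sup>+y. ennreal (k (c / 2) x y / \<delta> x ^ (2 * m)) * ennreal (\<bar>u y\<bar> powr q) \<partial>lborel)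
         = (\<integral>\<^sup>+y. ennreal (1 / \<delta> x ^ (2 * m)) * ennreal (indicator (cube x (c * \<delta> x / 2)) y * \<bar>u y\<bar> powr q) \<partial>lborel)"
        using True dx by (intro nn_integral_cong) (simp add: k ennreal_mult[symmetric])
      also have "\<dots> = ennreal (1 / \<delta> x ^ (2 * m)) * (\<integral>\<^sup>+y. ennreal (indicator (cube x (c * \<delta> x / 2)) y * \<bar>u y\<bar> powr q) \<partial>lborel)"
        by (rule nn_integral_cmult) measurable
      also have "\<dots> \<le> ennreal (1 / \<delta> x ^ (2 * m)) * (ennreal (C1 * \<delta> x ^ m) * J x)"
        by (intro mult_left_mono local True) simp
      also have "\<dots> = ennreal (C1 / \<delta> x ^ m) * J x"
      proof -
        have "1 / \<delta> x ^ (2 * m) * (C1 * \<delta> x ^ m) = C1 / \<delta> x ^ m"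
          using dx by (simp add: mult_2 power_add)
        then show ?thesis using C1 dx by (simp add: mult.assoc[symmetric] ennreal_mult[symmetric])
      qed
      also have "\<dots> = (\<integral>\<^sup>+y. ennreal (C1 / \<delta> x ^ m) * ennreal (indicator (cube x (c * \<delta> x)) y * h y) \<partial>lborel)"
        unfolding J_def by (rule nn_integral_cmult[symmetric]) measurable
      also have "\<dots> = (\<integral>\<^sup>+y. ennreal C1 * ennreal (k c x y / \<delta> x ^ m * h y) \<partial>lborel)"
        using True dx C1 h0 by (intro nn_integral_cong) (simp add: k ennreal_mult[symmetric])
      finally show ?thesis .
    qed (simp add: k)
  qed
  also have "\<dots> = (\<integral>\<^sup>+y. (\<integral>\<^sup>+x. ennreal C1 * ennreal (k c x y / \<delta> x ^ m * h y) \<partial>lborel) \<partial>lborel)"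
    by (rule lborel_pair.Fubini'[symmetric]) (unfold split_beta, measurable)
  also have "\<dots> \<le> (\<integral>\<^sup>+y. ennreal (C1 * (8 * c) ^ m) * ennreal (indicator \<Omega> y * h y) \<partial>lborel)"
  proof (rule nn_integral_mono)
    fix y
    have [measurable]: "(\<lambda>x. k c x y) \<in> borel_measurable borel" unfolding k_def by measurable
    define s where "s = 2 * c * \<delta> y"
    have s: "s \<ge> 0" using c \<delta>nn by (simp add: s_def)
    have [measurable]: "cube y s \<in> sets borel" by (simp add: borel_compact compact_cube)
    have "(\<integral>\<^sup>+x. ennreal C1 * ennreal (k c x y / \<delta> x ^ m * h y) \<partial>lborel)
      \<le> (\<integral>\<^sup>+x. ennreal (C1 * (2 / \<delta> y) ^ m * (indicator \<Omega> y * h y)) * indicator (cube y s) x \<partial>lborel)"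
    proof (rule nn_integral_mono)
      fix x
      show "ennreal C1 * ennreal (k c x y / \<delta> x ^ m * h y)
          \<le> ennreal (C1 * (2 / \<delta> y) ^ m * (indicator \<Omega> y * h y)) * indicator (cube y s) x"
      proof (cases "x \<in> \<Omega> \<and> y \<in> cube x (c * \<delta> x)")
        case True
        then have "y \<in> \<Omega> \<and> \<delta> y \<le> 5 / 4 * \<delta> x \<and> 3 / 4 * \<delta> x \<le> \<delta> y" by (intro comp) auto
        then have y: "y \<in> \<Omega>" "\<delta> y \<le> 2 * \<delta> x" "\<delta> x \<le> 2 * \<delta> y" using \<delta>0[of x] \<delta>0[of y] True by auto
        have "c * \<delta> x \<le> s" using y(3) c by (simp add: s_def)
        then have xs: "x \<in> cube y s" using True unfolding mem_cube by (metis abs_minus_commute order_trans)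
        have "1 / \<delta> x ^ m \<le> (2 / \<delta> y) ^ m"
        proof -
          have "1 / \<delta> x \<le> 2 / \<delta> y" using y(2) \<delta>0[of x] \<delta>0[OF y(1)] True by (simp add: field_simps)
          then have "(1 / \<delta> x) ^ m \<le> (2 / \<delta> y) ^ m" using \<delta>nn by (intro power_mono) auto
          then show ?thesis by (simp add: power_divide)
        qed
        then have "C1 * (1 / \<delta> x ^ m * h y) \<le> C1 * ((2 / \<delta> y) ^ m * h y)"
          using C1 h0 by (intro mult_left_mono mult_right_mono) auto
        then show ?thesis
          using True y(1) xs C1 h0 \<delta>nn by (auto simp: k ennreal_mult[symmetric] mult.assoc intro!: ennreal_leI)
      qed (auto simp: k)
    qed
    also have "\<dots> = ennreal (C1 * (2 / \<delta> y) ^ m * (indicator \<Omega> y * h y)) * ennreal ((2 * s) ^ m)"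
      using s by (simp add: nn_integral_cmult emeasure_cube m_def)
    also have "\<dots> = ennreal (C1 * (8 * c) ^ m) * ennreal (indicator \<Omega> y * h y)"
    proof (cases "y \<in> \<Omega>")
      case True
      have "(2 / \<delta> y) ^ m * (2 * s) ^ m = (8 * c) ^ m"
      proof -
        have "2 / \<delta> y * (2 * s) = 8 * c" using \<delta>0[OF True] by (simp add: s_def)
        then show ?thesis by (simp only: power_mult_distrib[symmetric])
      qed
      moreover have "C1 * (2 / \<delta> y) ^ m * h y * (2 * s) ^ m = C1 * ((2 / \<delta> y) ^ m * (2 * s) ^ m) * h y"
        by (simp only: mult_ac)
      ultimately have "C1 * (2 / \<delta> y) ^ m * h y * (2 * s) ^ m = C1 * (8 * c) ^ m * h y" by simp
      then show ?thesis using True C1 h0 s c \<delta>nn by (simp add: ennreal_mult[symmetric])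
    qed simp
    finally show "(\<integral>\<^sup>+x. ennreal C1 * ennreal (k c x y / \<delta> x ^ m * h y) \<partial>lborel)
       \<le> ennreal (C1 * (8 * c) ^ m) * ennreal (indicator \<Omega> y * h y)" .
  qed
  also have "\<dots> = ennreal (C1 * (8 * c) ^ m) * (\<integral>\<^sup>+y. ennreal (indicator \<Omega> y * h y) \<partial>lborel)"
    by (rule nn_integral_cmult) measurable
  also have "\<dots> \<le> ennreal (C1 * (8 * c) ^ m) * ennreal a"
    by (intro mult_left_mono a') simp
  also have "\<dots> \<le> ennreal c2 * ennreal (M powr (q / p) * 8 ^ m * a powr (q / p))"
  proof -
    have "a powr (q / p - 1) * a = a powr (q / p)"
      using a(1) by (cases "a = 0") (auto simp: powr_diff)
    moreover have "c ^ m = c2 * 8 ^ m" by (simp add: c2_def power_divide)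
    ultimately have "C1 * a = c2 * (M powr (q / p) * 8 ^ m * a powr (q / p))"
      by (simp add: C1_def mult_ac)
    have "(8 * c) ^ m \<le> 1" using N(1) c by (intro power_le_one) (auto simp: c_def)
    have "C1 * (8 * c) ^ m * a = C1 * a * (8 * c) ^ m" by (simp only: mult_ac)
    also have "\<dots> \<le> C1 * a * 1"
      using C1 a(1) \<open>(8 * c) ^ m \<le> 1\<close> by (intro mult_left_mono) auto
    also have "\<dots> = c2 * (M powr (q / p) * 8 ^ m * a powr (q / p))"
      using \<open>C1 * a = _\<close> by simp
    finally have "C1 * (8 * c) ^ m * a \<le> c2 * (M powr (q / p) * 8 ^ m * a powr (q / p))" .
    then show ?thesis
      using C1 c a(1) c2 by (simp add: ennreal_mult[symmetric] ennreal_leI)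
  qed
  finally have "ennreal c2 * Y \<le> ennreal c2 * ennreal (M powr (q / p) * 8 ^ m * a powr (q / p))" .
  then have "Y \<le> ennreal (M powr (q / p) * 8 ^ m * a powr (q / p))"
    using c2 by (subst (asm) ennreal_mult_le_mult_iff) auto
  then show ?thesis by (simp add: Y_def M_def m_def)
qed

section \<open>Borel representatives and the weighted inequality\<close>

text \<open>An open set is exhausted by compact sets, on each of which the function is measurable.\<close>

lemma locally_integrable_imp_measurable:
  fixes f :: "'a::euclidean_space \<Rightarrow> 'b::euclidean_space"
  assumes f: "locally_integrable_on f \<Omega>" and \<Omega>: "open \<Omega>"
  shows "(\<lambda>x. indicator \<Omega> x *\<^sub>R f x) \<in> borel_measurable lebesgue"
proof -
  obtain C :: "nat \<Rightarrow> 'a set" where C: "\<And>n. compact (C n)" "\<And>n. C n \<subseteq> \<Omega>"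
      "\<And>K. compact K \<Longrightarrow> K \<subseteq> \<Omega> \<Longrightarrow> \<exists>N. \<forall>n\<ge>N. K \<subseteq> C n"
    using open_Union_compact_subsets[OF \<Omega>] by metis
  show ?thesis
  proof (rule borel_measurable_LIMSEQ_metric)
    fix n
    have "set_integrable lebesgue (C n) f"
      using f C(1,2) by (simp add: locally_integrable_on_def)
    then show "(\<lambda>x. indicator (C n) x *\<^sub>R f x) \<in> borel_measurable lebesgue"
      unfolding set_integrable_def by (rule borel_measurable_integrable)
  next
    fix x :: 'a
    show "(\<lambda>n. indicator (C n) x *\<^sub>R f x) \<longlonglongrightarrow> indicator \<Omega> x *\<^sub>R f x"
    proof (cases "x \<in> \<Omega>")
      case True
      then obtain N where "\<And>n. n \<ge> N \<Longrightarrow> x \<in> C n" using C(3)[of "{x}"] by auto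
      then have "\<forall>\<^sub>F n in sequentially. indicator (C n) x *\<^sub>R f x = indicator \<Omega> x *\<^sub>R f x"
        using True by (auto simp: eventually_sequentially intro!: exI[of _ N])
      then show ?thesis by (rule tendsto_eventually)
    next
      case False
      then have "x \<notin> C n" for n using C(2) by blast
      then show ?thesis using False by simp
    qed
  qed
qed

text \<open>Fubini's theorem is applied to Borel functions on the product of two copies of the space; hence
Lebesgue measurable functions are first replaced by Borel measurable ones.\<close>

lemma lebesgue_ex_borel_measurable:
  fixes f :: "'a::euclidean_space \<Rightarrow> 'b::euclidean_space"
  assumes f: "f \<in> borel_measurable lebesgue"
  shows "\<exists>g\<in>borel_measurable borel. AE x in lborel. f x = g x"
proof -
  have "\<forall>b. \<exists>g. g \<in> borel_measurable borel \<and> (AE x in lborel. f x \<bullet> b = g x)"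
  proof
    fix b
    have "(\<lambda>x. f x \<bullet> b) \<in> borel_measurable lebesgue" using f by measurable
    from completion_ex_borel_measurable_real[OF this]
    show "\<exists>g. g \<in> borel_measurable borel \<and> (AE x in lborel. f x \<bullet> b = g x)" by auto
  qed
  from choice[OF this] obtain g where
    g: "\<And>b. g b \<in> borel_measurable borel" "\<And>b. AE x in lborel. f x \<bullet> b = g b x" by blast
  have "AE x in lborel. \<forall>b\<in>Basis. f x \<bullet> b = g b x"
    using g(2) by (intro AE_finite_allI) auto
  then have "AE x in lborel. f x = (\<Sum>b\<in>Basis. g b x *\<^sub>R b)"
  proof eventually_elim
    case (elim x)
    then have "(\<Sum>b\<in>Basis. g b x *\<^sub>R b) = (\<Sum>b\<in>Basis. (f x \<bullet> b) *\<^sub>R b)" by (intro sum.cong) auto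
    then show ?case by (simp add: euclidean_representation)
  qed
  moreover have "(\<lambda>x. \<Sum>b\<in>Basis. g b x *\<^sub>R b) \<in> borel_measurable borel"
    using g(1) by (intro borel_measurable_sum borel_measurable_scaleR) auto
  ultimately show ?thesis by (rule bexI)
qed

lemma integral_lebesgue_eq_lborel:
  fixes f g :: "'a::euclidean_space \<Rightarrow> 'b::euclidean_space"
  assumes "g \<in> borel_measurable borel" "f \<in> borel_measurable lebesgue" "AE x in lborel. f x = g x"
  shows "integral\<^sup>L lebesgue f = integral\<^sup>L lborel g"
proof -
  have "integral\<^sup>L lebesgue f = integral\<^sup>L lebesgue g"
  proof (rule integral_cong_AE)
    show "g \<in> borel_measurable lebesgue" using assms(1) by (intro measurable_completion) simp
    show "AE x in lebesgue. f x = g x" by (rule AE_completion[OF assms(3)])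
  qed (rule assms(2))
  then show ?thesis using assms(1) by (simp add: integral_completion)
qed

lemma integrable_lebesgue_imp_lborel:
  fixes f g :: "'a::euclidean_space \<Rightarrow> 'b::euclidean_space"
  assumes "g \<in> borel_measurable borel" "integrable lebesgue f" "AE x in lborel. f x = g x"
  shows "integrable lborel g"
proof -
  have "integrable lebesgue g"
  proof (rule integrable_cong_AE_imp[OF assms(2)])
    show "g \<in> borel_measurable lebesgue" using assms(1) by (intro measurable_completion) simp
    show "AE x in lebesgue. f x = g x" by (rule AE_completion[OF assms(3)])
  qed
  then show ?thesis using assms(1) by (simp add: integrable_completion)
qed

lemma nn_integral_lebesgue_on_eq:
  assumes "\<Omega> \<in> sets borel" "AE x in lborel. x \<in> \<Omega> \<longrightarrow> f x = g x"
  shows "(\<integral>\<^sup>+x. ennreal (f x) \<partial>lebesgue_on \<Omega>) = (\<integral>\<^sup>+x. ennreal (indicator \<Omega> x * g x) \<partial>lborel)"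
proof -
  have "(\<integral>\<^sup>+x. ennreal (f x) \<partial>lebesgue_on \<Omega>) = (\<integral>\<^sup>+x. ennreal (f x) * indicator \<Omega> x \<partial>lborel)"
    using assms(1) by (simp add: nn_integral_restrict_space nn_integral_completion)
  also have "\<dots> = (\<integral>\<^sup>+x. ennreal (indicator \<Omega> x * g x) \<partial>lborel)"
    using assms(2) by (intro nn_integral_cong_AE) (auto elim!: eventually_mono simp: indicator_def)
  finally show ?thesis .
qed

lemma ennreal_powr_le:
  assumes "Y \<le> ennreal b" "b \<ge> 0" "s \<ge> 0"
  shows "ennreal_powr Y s \<le> ennreal (b powr s)"
proof -
  have "Y \<noteq> \<infinity>" using assms(1) by (auto simp: top_unique)
  moreover have "enn2real Y \<le> b" using assms(1,2) by (simp add: enn2real_leI)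
  ultimately show ?thesis
    using assms(3) by (auto simp: ennreal_powr_def intro!: ennreal_leI powr_mono2)
qed

theorem theorem6:
  fixes p q :: real
  assumes "CARD('n::finite) \<ge> 2"
    and "1 \<le> p" and "p \<le> real CARD('n)"
    and "1 \<le> q" and "p < q" and "ereal q \<le> sobolev_exponent CARD('n) p"
  shows "\<exists>\<Sigma>::real. \<Sigma> > 0 \<and>
    (\<forall>\<Omega>::(real^'n) set. open \<Omega> \<and> connected \<Omega> \<and> frontier \<Omega> \<noteq> {} \<longrightarrow>
      (\<forall>u\<in>sobolev_W1 p \<Omega>. \<forall>G. has_weak_gradient \<Omega> u G \<longrightarrow>
        ennreal_powr
          (\<integral>\<^sup>+x. ennreal (\<bar>u x\<bar> powr q / bdry_dist \<Omega> x ^ CARD('n)) \<partial>lebesgue_on \<Omega>) (1 / q)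
        \<le> ennreal \<Sigma> * ennreal_powr
          (\<integral>\<^sup>+x. ennreal (norm (G x) powr p / bdry_dist \<Omega> x powr (real CARD('n) - p)
                         + \<bar>u x\<bar> powr p / bdry_dist \<Omega> x ^ CARD('n)) \<partial>lebesgue_on \<Omega>) (1 / p)))"
proof -
  let ?N = "real CARD('n)"
  define C where "C = ((2 * max 1 (q * (?N - 1) / ?N)) powr p * (8 * ?N) ^ CARD('n)) powr (q / p) * 8 ^ CARD('n)"
  have C: "C > 0" using assms(1) by (simp add: C_def)
  have exponent: "q * (?N - p) \<le> ?N * p"
  proof (cases "p < ?N")
    case True
    then have "q \<le> ?N * p / (?N - p)" using assms(6) by (simp add: sobolev_exponent_def)
    then show ?thesis using True by (simp add: pos_le_divide_eq)
  next
    case False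
    then show ?thesis using assms(2,3) by simp
  qed
  show ?thesis
  proof (intro exI[of _ "C powr (1 / q)"] conjI allI impI ballI)
    show "C powr (1 / q) > 0" using C by simp
    fix \<Omega> :: "(real^'n) set" and u :: "real^'n \<Rightarrow> real" and G :: "real^'n \<Rightarrow> real^'n"
    assume \<Omega>: "open \<Omega> \<and> connected \<Omega> \<and> frontier \<Omega> \<noteq> {}" and G: "has_weak_gradient \<Omega> u G"
    have [measurable]: "\<Omega> \<in> sets borel" using \<Omega> by simp
    have lu: "locally_integrable_on u \<Omega>" and lG: "locally_integrable_on G \<Omega>" using G by (auto simp: has_weak_gradient_def)
    have um: "(\<lambda>x. indicator \<Omega> x *\<^sub>R u x) \<in> borel_measurable lebesgue" and Gm: "(\<lambda>x. indicator \<Omega> x *\<^sub>R G x) \<in> borel_measurable lebesgue"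
      using locally_integrable_imp_measurable lu lG \<Omega> by blast+
    obtain u' where u'[measurable]: "u' \<in> borel_measurable borel" and u'eq: "AE x in lborel. indicator \<Omega> x *\<^sub>R u x = u' x"
      using lebesgue_ex_borel_measurable[OF um] by blast
    obtain G' where G'[measurable]: "G' \<in> borel_measurable borel" and G'eq: "AE x in lborel. indicator \<Omega> x *\<^sub>R G x = G' x"
      using lebesgue_ex_borel_measurable[OF Gm] by blast
    let ?\<delta> = "bdry_dist \<Omega>"
    define A where "A = (\<integral>\<^sup>+x. ennreal (norm (G x) powr p / ?\<delta> x powr (?N - p) + \<bar>u x\<bar> powr p / ?\<delta> x ^ CARD('n)) \<partial>lebesgue_on \<Omega>)"
    define Y where "Y = (\<integral>\<^sup>+x. ennreal (\<bar>u x\<bar> powr q / ?\<delta> x ^ CARD('n)) \<partial>lebesgue_on \<Omega>)"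
    have eq: "AE x in lborel. x \<in> \<Omega> \<longrightarrow> u x = u' x \<and> G x = G' x"
      using u'eq G'eq by eventually_elim auto
    have A: "A = (\<integral>\<^sup>+x. ennreal (indicator \<Omega> x * (norm (G' x) powr p / ?\<delta> x powr (?N - p) + \<bar>u' x\<bar> powr p / ?\<delta> x ^ CARD('n))) \<partial>lborel)"
      and Y: "Y = (\<integral>\<^sup>+x. ennreal (indicator \<Omega> x * (\<bar>u' x\<bar> powr q / ?\<delta> x ^ CARD('n))) \<partial>lborel)"
      unfolding A_def Y_def
      by (rule nn_integral_lebesgue_on_eq, simp, rule eventually_mono[OF eq], simp)+
    show "ennreal_powr (\<integral>\<^sup>+x. ennreal (\<bar>u x\<bar> powr q / ?\<delta> x ^ CARD('n)) \<partial>lebesgue_on \<Omega>) (1 / q)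
      \<le> ennreal (C powr (1 / q)) * ennreal_powr (\<integral>\<^sup>+x. ennreal (norm (G x) powr p / ?\<delta> x powr (?N - p)
             + \<bar>u x\<bar> powr p / ?\<delta> x ^ CARD('n)) \<partial>lebesgue_on \<Omega>) (1 / p)"
      unfolding A_def[symmetric] Y_def[symmetric]
    proof (cases "A = \<infinity>")
      case True
      then show "ennreal_powr Y (1 / q) \<le> ennreal (C powr (1 / q)) * ennreal_powr A (1 / p)"
        using C by (simp add: ennreal_powr_def ennreal_mult_top)
    next
      case False
      define a where "a = enn2real A"
      have a: "a \<ge> 0" "A = ennreal a" using False by (auto simp: a_def ennreal_enn2real_if)
      have test: "continuous_on UNIV \<phi>" "continuous_on UNIV (partial_deriv i \<phi>)" if "\<phi> \<in> test_fun \<Omega>" for \<phi> i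
      proof -
        have "Ck k \<phi>" for k using that by (simp add: test_fun_def)
        from this[of 0] this[of "Suc 0"] show "continuous_on UNIV \<phi>" "continuous_on UNIV (partial_deriv i \<phi>)" by auto
      qed
      have weak: "(LINT y|lborel. indicator \<Omega> y * (u' y * partial_deriv i \<phi> y)) = - (LINT y|lborel. indicator \<Omega> y * (G' y $ i * \<phi> y))"
        if \<phi>: "\<phi> \<in> test_fun \<Omega>" for \<phi> i
      proof -
        have [measurable]: "\<phi> \<in> borel_measurable borel" "partial_deriv i \<phi> \<in> borel_measurable borel"
          using test[OF \<phi>] by (auto intro: borel_measurable_continuous_onI)
        have [measurable]: "(\<lambda>x::real^'n. x $ i) \<in> borel_measurable borel"
          by (intro borel_measurable_continuous_onI continuous_intros)
        have [measurable]: "\<phi> \<in> borel_measurable lebesgue" "partial_deriv i \<phi> \<in> borel_measurable lebesgue"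
          by (auto intro!: measurable_completion)
        have "(LINT x:\<Omega>|lebesgue. u x * partial_deriv i \<phi> x) = (LINT y|lborel. indicator \<Omega> y * (u' y * partial_deriv i \<phi> y))"
          unfolding set_lebesgue_integral_def
        proof (rule integral_lebesgue_eq_lborel)
          have "(\<lambda>x. (indicator \<Omega> x *\<^sub>R u x) * partial_deriv i \<phi> x) \<in> borel_measurable lebesgue"
            using um by measurable
          then show "(\<lambda>x. indicator \<Omega> x *\<^sub>R (u x * partial_deriv i \<phi> x)) \<in> borel_measurable lebesgue" by (simp add: mult.assoc)
          show "AE x in lborel. indicator \<Omega> x *\<^sub>R (u x * partial_deriv i \<phi> x) = indicator \<Omega> x * (u' x * partial_deriv i \<phi> x)"
            using u'eq by eventually_elim (auto simp: indicator_def)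
        qed measurable
        moreover have "(LINT x:\<Omega>|lebesgue. G x $ i * \<phi> x) = (LINT y|lborel. indicator \<Omega> y * (G' y $ i * \<phi> y))"
          unfolding set_lebesgue_integral_def
        proof (rule integral_lebesgue_eq_lborel)
          have "(\<lambda>x. (indicator \<Omega> x *\<^sub>R G x) $ i * \<phi> x) \<in> borel_measurable lebesgue"
            using Gm by measurable
          then show "(\<lambda>x. indicator \<Omega> x *\<^sub>R (G x $ i * \<phi> x)) \<in> borel_measurable lebesgue" by (simp add: mult.assoc)
          show "AE x in lborel. indicator \<Omega> x *\<^sub>R (G x $ i * \<phi> x) = indicator \<Omega> x * (G' x $ i * \<phi> x)"
            using G'eq by eventually_elim (auto simp: indicator_def)
        qed measurable
        ultimately show ?thesis using G \<phi> by (simp add: has_weak_gradient_def)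
      qed
      have iu: "integrable lborel (\<lambda>y. indicator S y * u' y)" and iG: "integrable lborel (\<lambda>y. indicator S y *\<^sub>R G' y)"
        if S: "compact S" "S \<subseteq> \<Omega>" for S
      proof -
        have [measurable]: "S \<in> sets borel" using S by (simp add: borel_compact)
        have "set_integrable lebesgue S u" "set_integrable lebesgue S G"
          using lu lG S by (auto simp: locally_integrable_on_def)
        then have i: "integrable lebesgue (\<lambda>y. indicator S y *\<^sub>R u y)" "integrable lebesgue (\<lambda>y. indicator S y *\<^sub>R G y)"
          by (auto simp: set_integrable_def)
        have "AE y in lborel. indicator S y *\<^sub>R u y = indicator S y * u' y"
          using u'eq by eventually_elim (use S(2) in \<open>auto simp: indicator_def\<close>)
        then show "integrable lborel (\<lambda>y. indicator S y * u' y)"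
          by (rule integrable_lebesgue_imp_lborel[OF _ i(1), rotated]) measurable
        have "AE y in lborel. indicator S y *\<^sub>R G y = indicator S y *\<^sub>R G' y"
          using G'eq by eventually_elim (use S(2) in \<open>auto simp: indicator_def\<close>)
        then show "integrable lborel (\<lambda>y. indicator S y *\<^sub>R G' y)"
          by (rule integrable_lebesgue_imp_lborel[OF _ i(2), rotated]) measurable
      qed
      have "Y \<le> ennreal (C * a powr (q / p))"
        unfolding Y C_def
      proof (rule weighted_sobolev_borel[OF assms(1,2,3,5) exponent _ _ weak iu iG u' G' a(1)])
        show "(\<integral>\<^sup>+y. ennreal (indicator \<Omega> y * (norm (G' y) powr p / ?\<delta> y powr (?N - p) + \<bar>u' y\<bar> powr p / ?\<delta> y ^ CARD('n))) \<partial>lborel) \<le> ennreal a"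
          using A a(2) by (simp only: order_refl)
      qed (use \<Omega> in auto)
      then have "ennreal_powr Y (1 / q) \<le> ennreal ((C * a powr (q / p)) powr (1 / q))"
        using C assms(4) by (intro ennreal_powr_le) auto
      also have "(C * a powr (q / p)) powr (1 / q) = C powr (1 / q) * a powr (1 / p)"
        using C assms(4) by (simp add: powr_mult powr_powr)
      also have "ennreal (C powr (1 / q) * a powr (1 / p)) = ennreal (C powr (1 / q)) * ennreal_powr A (1 / p)"
        using a by (simp add: ennreal_powr_def ennreal_mult)
      finally show "ennreal_powr Y (1 / q) \<le> ennreal (C powr (1 / q)) * ennreal_powr A (1 / p)" .
    qed
  qed
qed

end
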